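(* Let $d\ge1$ and let $\mathcal{T}_1,\dots,\mathcal{T}_d$ be weakly mixing flows. Suppose that for each $i\in\{1,\dots,d\}$ there are a sequence of reals $t_n\to\infty$, a number $a\in[0,1)$ and a Borel probability measure $P$ on $\mathbb{R}$ (all possibly depending on $i$) such that $$T_i^{t_n}\to a\cdot\Pi+(1-a)\cdot\int_{\mathbb{R}} T_i^t\,dP(t)$$ in the weak operator topology, where $P$ is not a Dirac measure and its Fourier transform $\widehat{P}$ is analytic. If $\mathcal{S}_1,\dots,\mathcal{S}_d$ are flows such that $\mathcal{T}_1\times\dots\times\mathcal{T}_d$ is isomorphic to $\mathcal{S}_1\times\dots\times\mathcal{S}_d$, then there is a permutation $\sigma$ of $\{1,\dots,d\}$ such that $\mathcal{T}_i$ is isomorphic to $\mathcal{S}_{\sigma(i)}$ for $i=1,\dots,d$. In particular, the same conclusion holds if for each $i\in\{1,\dots,d\}$ there are a sequence of reals $t_n\to\infty$, a number $a\in[0,1)$ and a Borel probability measure $P$ on $\mathbb{R}$ (all possibly depending on $i$) such that $$T_i^{t_n}\to a\cdot\Pi+(1-a)\cdot\int_{\mathbb{R}} T_i^t\,dP(t)$$ in the weak operator topology, where the measures $P$ are only assumed to be continuous (non-atomic) and to have bounded support.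
   Context: A flow $\mathcal{T}=(T^t)_{t\in\mathbb{R}}$ is a measure-preserving $\mathbb{R}$-action on a standard Borel probability space $(X,\mathcal{B},\mu)$ such that $t\mapsto\langle f\circ T^t,g\rangle$ is continuous for all $f,g\in L^2(X,\mathcal{B},\mu)$. All flows are assumed nontrivial (the space is not a one-point space up to measure zero). The product flow is $(T_1^t\times\dots\times T_d^t)_{t\in\mathbb{R}}$ on the product probability space. A flow $\mathcal{T}$ is weakly mixing if $\mathcal{T}\times\mathcal{T}$ is ergodic. Flows $\mathcal{T}$ on $X$ and $\mathcal{S}$ on $Y$ are isomorphic if there is an invertible (mod null sets) measure-preserving map $\Phi\colon Y\to X$ with $T^t\circ\Phi=\Phi\circ S^t$ a.e. for every $t\in\mathbb{R}$. On $L^2(X,\mathcal{B},\mu)$ write $T^tf=f\circ T^t$, $\Pi f=\int f\,d\mu$, and define $\int_{\mathbb{R}}T^t\,dP(t)$ by $\langle(\int_{\mathbb{R}}T^t\,dP(t))f,g\rangle=\int_{\mathbb{R}}\langle T^tf,g\rangle\,dP(t)$. The Fourier transform is $\widehat{P}(s)=\int_{\mathbb{R}}e^{ist}\,dP(t)$, $s\in\mathbb{R}$; it is analytic as a function on $\mathbb{R}$. *)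

theory Defs
  imports "HOL-Probability.Probability" "HOL-Combinatorics.Permutations"
begin

section \<open>Measure-preserving maps and flows\<close>

definition standard_borel :: "'a measure \<Rightarrow> bool" where
  "standard_borel M \<longleftrightarrow>
     (\<exists>X. topspace X = space M \<and> completely_metrizable_space X \<and> second_countable X \<and>
          sets M = sigma_sets (space M) {U. openin X U})"

definition measure_preserving :: "'a measure \<Rightarrow> 'b measure \<Rightarrow> ('a \<Rightarrow> 'b) \<Rightarrow> bool" where
  "measure_preserving M N f \<longleftrightarrow> f \<in> measurable M N \<and> distr M N f = N"

text \<open>Elements of the complex Hilbert space \<open>L\<^sup>2\<close> are handled through representatives:
  every notion below depends on functions only through integrals against \<open>M\<close>.\<close>

definition L2 :: "'a measure \<Rightarrow> ('a \<Rightarrow> complex) set" where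
  "L2 M = {f \<in> borel_measurable M. integrable M (\<lambda>x. (cmod (f x))\<^sup>2)}"

definition l2_inner :: "'a measure \<Rightarrow> ('a \<Rightarrow> complex) \<Rightarrow> ('a \<Rightarrow> complex) \<Rightarrow> complex" where
  "l2_inner M f g = (CLINT x|M. f x * cnj (g x))"

definition koopman :: "(real \<Rightarrow> 'a \<Rightarrow> 'a) \<Rightarrow> real \<Rightarrow> ('a \<Rightarrow> complex) \<Rightarrow> 'a \<Rightarrow> complex" where
  "koopman T t f = f \<circ> T t"

definition mean_op :: "'a measure \<Rightarrow> ('a \<Rightarrow> complex) \<Rightarrow> 'a \<Rightarrow> complex" where
  "mean_op M f = (\<lambda>_. CLINT x|M. f x)"

locale flow = prob_space M for M :: "'a measure" and T :: "real \<Rightarrow> 'a \<Rightarrow> 'a" +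
  assumes standard_borel: "standard_borel M"
    and preserving: "\<And>t. measure_preserving M M (T t)"
    and act_zero: "\<And>x. x \<in> space M \<Longrightarrow> T 0 x = x"
    and act_add: "\<And>s t x. x \<in> space M \<Longrightarrow> T (s + t) x = T s (T t x)"
    and weakly_continuous:
      "\<And>f g. f \<in> L2 M \<Longrightarrow> g \<in> L2 M \<Longrightarrow> continuous_on UNIV (\<lambda>t. l2_inner M (koopman T t f) g)"
    and nontrivial: "\<not> (\<exists>x\<in>space M. AE y in M. y = x)"

text \<open>Invariance is required modulo null sets, separately for each time \<open>t\<close>.\<close>

definition ergodic :: "'a measure \<Rightarrow> (real \<Rightarrow> 'a \<Rightarrow> 'a) \<Rightarrow> bool" where
  "ergodic M T \<longleftrightarrow>
     (\<forall>A\<in>sets M. (\<forall>t. AE x in M. T t x \<in> A \<longleftrightarrow> x \<in> A) \<longrightarrow> measure M A = 0 \<or> measure M A = 1)"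

definition weakly_mixing :: "'a measure \<Rightarrow> (real \<Rightarrow> 'a \<Rightarrow> 'a) \<Rightarrow> bool" where
  "weakly_mixing M T \<longleftrightarrow> ergodic (M \<Otimes>\<^sub>M M) (\<lambda>t. map_prod (T t) (T t))"

text \<open>The product flow acts on \<open>PiM I M\<close>, whose points are functions that are
  \<open>undefined\<close> outside \<open>I\<close>.\<close>

definition product_flow :: "'i set \<Rightarrow> ('i \<Rightarrow> real \<Rightarrow> 'a \<Rightarrow> 'a) \<Rightarrow> real \<Rightarrow> ('i \<Rightarrow> 'a) \<Rightarrow> 'i \<Rightarrow> 'a" where
  "product_flow I T t x = (\<lambda>i\<in>I. T i t (x i))"

text \<open>Here \<open>\<Phi>\<close> maps the second space to the first, and \<open>\<Psi>\<close> is its inverse modulo null sets.\<close>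

definition isomorphic_flows ::
    "'a measure \<Rightarrow> (real \<Rightarrow> 'a \<Rightarrow> 'a) \<Rightarrow> 'b measure \<Rightarrow> (real \<Rightarrow> 'b \<Rightarrow> 'b) \<Rightarrow> bool" where
  "isomorphic_flows M T N S \<longleftrightarrow>
     (\<exists>\<Phi> \<Psi>. measure_preserving N M \<Phi> \<and> measure_preserving M N \<Psi> \<and>
        (AE y in N. \<Psi> (\<Phi> y) = y) \<and> (AE x in M. \<Phi> (\<Psi> x) = x) \<and>
        (\<forall>t. AE y in N. T t (\<Phi> y) = \<Phi> (S t y)))"

section \<open>Weak limits and conditions on the limiting measure\<close>

text \<open>Weak operator convergence of \<open>T\<^sup>t\<close> along \<open>t = \<tau> n\<close> to
  \<open>a \<cdot> \<Pi> + (1 - a) \<cdot> \<integral> T\<^sup>s dP(s)\<close>. The operator \<open>\<integral> T\<^sup>s dP(s)\<close> is by definition the one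
  whose matrix coefficient at \<open>f, g\<close> is the integral of \<open>\<langle>T\<^sup>s f, g\<rangle>\<close> over \<open>s\<close> against \<open>P\<close>.\<close>

definition flow_integral_coeff ::
    "'a measure \<Rightarrow> (real \<Rightarrow> 'a \<Rightarrow> 'a) \<Rightarrow> real measure \<Rightarrow> ('a \<Rightarrow> complex) \<Rightarrow> ('a \<Rightarrow> complex) \<Rightarrow> complex" where
  "flow_integral_coeff M T P f g = (CLINT s|P. l2_inner M (koopman T s f) g)"

definition weak_limit_along ::
    "'a measure \<Rightarrow> (real \<Rightarrow> 'a \<Rightarrow> 'a) \<Rightarrow> (nat \<Rightarrow> real) \<Rightarrow> real \<Rightarrow> real measure \<Rightarrow> bool" where
  "weak_limit_along M T \<tau> a P \<longleftrightarrow>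
     (\<forall>f\<in>L2 M. \<forall>g\<in>L2 M.
        (\<lambda>n. l2_inner M (koopman T (\<tau> n) f) g) \<longlonglongrightarrow>
          of_real a * l2_inner M (mean_op M f) g + of_real (1 - a) * flow_integral_coeff M T P f g)"

definition real_analytic :: "(real \<Rightarrow> complex) \<Rightarrow> bool" where
  "real_analytic f \<longleftrightarrow>
     (\<forall>s. \<exists>c :: nat \<Rightarrow> complex. \<exists>r > 0. \<forall>h. \<bar>h\<bar> < r \<longrightarrow> (\<lambda>n. c n * of_real h ^ n) sums f (s + h))"

definition measure_support :: "real measure \<Rightarrow> real set" where
  "measure_support P = {x. \<forall>U. open U \<longrightarrow> x \<in> U \<longrightarrow> emeasure P U > 0}"

end

theory Submission
  imports Defs "HOL-Complex_Analysis.Great_Picard"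
begin

text \<open>
  Split \<open>S\<^sub>1 \<times> \<dots> \<times> S\<^sub>d\<close> as \<open>S\<^sub>j \<times> S'\<close>. On the span of the translates of a product function
  \<open>h \<otimes> h'\<close> of mean zero factors, the two-parameter action is multiplication by characters on
  \<open>L2 (\<tau> \<Otimes> \<tau>')\<close> with \<open>\<tau>, \<tau>'\<close> atomless by weak mixing. If a mean zero function lifted from
  \<open>T\<^sub>i\<close> had a nonzero component there, passing to weak limits along the times \<open>t\<^sub>n\<close> would give
  \<open>\<phi>(x) \<phi>'(y) = (1 - a) \<G>(x + y)\<close> on a set of positive \<open>\<tau> \<Otimes> \<tau>'\<close> measure, where \<open>\<G>\<close> is the Fourier transform
  of \<open>P\<close>. Comparing two vertical sections and using that \<open>\<G>\<close> is analytic, \<open>\<G>(p + y) = \<G>(p) \<G>(y)\<close>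
  for all \<open>p\<close> and \<open>y\<close>, so \<open>P\<close> is a Dirac measure. Hence the indicator of every set coming from \<open>T\<^sub>i\<close> is a
  sum of a function of the \<open>j\<close>-th coordinate and a function of the others; being idempotent, it
  depends on only one of the two. So the factor \<open>T\<^sub>i\<close> is contained in exactly one \<open>S\<^bsub>\<sigma> i\<^esub>\<close>, and
  inverting the isomorphism for fixed generic values of the remaining coordinates shows
  that \<open>\<sigma>\<close> is a permutation and that \<open>T\<^sub>i\<close> and \<open>S\<^bsub>\<sigma> i\<^esub>\<close> are isomorphic.
\<close>


section \<open>Real-analytic functions and characteristic functions\<close>

text \<open>The \<open>S\<close>-flows come without any mixing hypothesis: weak mixing is known for
  the \<open>T\<close>-flows and has to reach every \<open>S j\<close> and every complementary
  product through the isomorphism. It is therefore used in a form that passes to products and to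
  factors: absolute covariances of sets have convex averages over translates that tend to 0
  uniformly in the shift. The same form makes spectral measures atomless. The two limits compared in
  the spectral picture have different shapes for a reason. The lifted function only knows the
  diagonal times \<open>(t, t)\<close>, so its weak limit is a function of \<open>x + y\<close>,
  with the factor \<open>1 - a\<close> because mean zero kills \<open>\<Pi>\<close>. The characters
  of the two coordinates have weak limits separately, along a common subsequence, and on a product
  measure these multiply. The two agree only where the component lives, which is a mere measurable
  set of positive measure; atomlessness turns positive measure into uncountably many points, enough
  for analytic continuation. The Hilbert space geometry rests on minimizing one quadratic
  functional, which yields the Riesz representation as well as the ergodic averages.\<close>

lemma real_analytic_locally_zero_or_isolated:
  assumes "real_analytic f"
  shows "(\<exists>r>0. \<forall>h. \<bar>h\<bar> < r \<longrightarrow> f (s + h) = 0) \<or> (\<exists>r>0. \<forall>h. 0 < \<bar>h\<bar> \<and> \<bar>h\<bar> < r \<longrightarrow> f (s + h) \<noteq> 0)"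
proof -
  obtain c :: "nat \<Rightarrow> complex" and r where r: "r > 0"
    and c: "\<And>h. \<bar>h\<bar> < r \<Longrightarrow> (\<lambda>n. c n * of_real h ^ n) sums f (s + h)"
    using assms unfolding real_analytic_def by metis
  show ?thesis
  proof (cases "\<forall>n. c n = 0")
    case True
    then show ?thesis using c r by (metis (no_types, lifting) mult_zero_left sums_0 sums_unique2)
  next
    case False
    then obtain m where m: "c m \<noteq> 0" by blast
    \<comment> \<open>Isolation of zeros is taken from complex power series, so the real expansion
      is continued to a disc: convergence at the real point halfway between \<open>norm z\<close>
      and \<open>r\<close> gives convergence at \<open>z\<close>.\<close>
    define F where "F z = (\<Sum>n. c n * z ^ n)" for z
    have sm: "(\<lambda>n. c n * z ^ n) sums F z" if z: "norm z < r" for z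
    proof -
      have "norm z < (norm z + r) / 2" "(norm z + r) / 2 < r" "0 \<le> (norm z + r) / 2" using z r by auto
      then have "summable (\<lambda>n. c n * of_real ((norm z + r) / 2) ^ n)"
        using c[of "(norm z + r) / 2"] unfolding summable_def by (metis abs_of_nonneg)
      moreover have "norm z < norm (complex_of_real ((norm z + r) / 2))"
        using \<open>norm z < (norm z + r) / 2\<close> \<open>0 \<le> (norm z + r) / 2\<close> unfolding norm_of_real by linarith
      ultimately have "summable (\<lambda>n. c n * z ^ n)" using powser_inside by blast
      then show ?thesis unfolding F_def by (rule summable_sums)
    qed
    \<comment> \<open>multiplying by \<open>z\<close> makes the zeros at \<open>0\<close> forced, so that \<open>powser_0_nonzero\<close> also covers \<open>c 0 \<noteq> 0\<close>\<close>
    have sm2: "(\<lambda>n. (case n of 0 \<Rightarrow> 0 | Suc k \<Rightarrow> c k) * (z - 0) ^ n) sums (z * F z)"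
      if z: "norm (z - 0) < r" for z
    proof -
      have "(\<lambda>n. z * (c n * z ^ n)) sums (z * F z)" using sm z by (intro sums_mult) auto
      then have "(\<lambda>n. (case Suc n of 0 \<Rightarrow> 0 | Suc k \<Rightarrow> c k) * z ^ Suc n) sums (z * F z)"
        by (simp add: mult_ac)
      then show ?thesis by (subst (asm) sums_Suc_iff) simp
    qed
    obtain d where d: "0 < d" "\<And>z. z \<in> cball 0 d - {0} \<Longrightarrow> z * F z \<noteq> 0"
      by (rule powser_0_nonzero[OF r sm2, of "Suc m"]) (use m in auto)
    have "f (s + h) \<noteq> 0" if "0 < \<bar>h\<bar>" "\<bar>h\<bar> < min d r" for h
    proof -
      have "F (of_real h) = f (s + h)"
        using sm[of "of_real h"] c[of h] that by (auto intro: sums_unique2)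
      moreover have "of_real h * F (of_real h) \<noteq> 0" using d(2)[of "of_real h"] that by auto
      ultimately show ?thesis by auto
    qed
    then show ?thesis using d(1) r by (intro disjI2 exI[of _ "min d r"]) auto
  qed
qed

text \<open>Connectedness of the line: the set \<open>Z\<close> of points near which
  \<open>f\<close> vanishes is open, and so is its complement, because outside \<open>Z\<close>
  zeros are isolated. If \<open>Z\<close> were empty, the zero set would be sparse and hence
  countable.\<close>

lemma real_analytic_uncountable_zeros:
  assumes f: "real_analytic f" and unc: "uncountable {x. f x = 0}"
  shows "f x = 0"
proof -
  define Z where "Z = {s. \<exists>r>0. \<forall>h. \<bar>h\<bar> < r \<longrightarrow> f (s + h) = 0}"
  have "open Z"
    unfolding open_dist dist_real_def
  proof
    fix s assume "s \<in> Z"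
    then obtain r where r: "r > 0" "\<And>h. \<bar>h\<bar> < r \<Longrightarrow> f (s + h) = 0" unfolding Z_def by blast
    have "y \<in> Z" if "\<bar>y - s\<bar> < r" for y
    proof -
      have "f (y + h) = 0" if "\<bar>h\<bar> < r - \<bar>y - s\<bar>" for h
        using r(2)[of "y - s + h"] that by auto
      then show ?thesis using that unfolding Z_def by (auto intro!: exI[of _ "r - \<bar>y - s\<bar>"])
    qed
    then show "\<exists>e>0. \<forall>y. \<bar>y - s\<bar> < e \<longrightarrow> y \<in> Z" using r(1) by blast
  qed
  have iso: "\<exists>r>0. \<forall>y. y \<noteq> s \<and> \<bar>y - s\<bar> < r \<longrightarrow> f y \<noteq> 0" if s: "s \<notin> Z" for s
  proof -
    obtain r where r: "r > 0" "\<And>h. 0 < \<bar>h\<bar> \<and> \<bar>h\<bar> < r \<Longrightarrow> f (s + h) \<noteq> 0"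
      using real_analytic_locally_zero_or_isolated[OF f, of s] s unfolding Z_def by blast
    have "f y \<noteq> 0" if "y \<noteq> s \<and> \<bar>y - s\<bar> < r" for y
      using r(2)[of "y - s"] that by auto
    then show ?thesis using r(1) by blast
  qed
  have "open (- Z)"
    unfolding open_dist dist_real_def
  proof
    fix s assume s: "s \<in> - Z"
    then obtain r where r: "r > 0" "\<And>y. y \<noteq> s \<and> \<bar>y - s\<bar> < r \<Longrightarrow> f y \<noteq> 0" using iso by blast
    have "y \<in> - Z" if y: "\<bar>y - s\<bar> < r" for y
    proof (cases "y = s")
      case False
      then have "f (y + 0) \<noteq> 0" using r(2) y by auto
      then show ?thesis unfolding Z_def by (auto intro!: exI[of _ 0])
    qed (use s in simp)
    then show "\<exists>e>0. \<forall>y. \<bar>y - s\<bar> < e \<longrightarrow> y \<in> - Z" using r(1) by blast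
  qed
  then have "Z = {} \<or> Z = UNIV" using \<open>open Z\<close> by (metis clopen closed_def)
  moreover have "Z \<noteq> {}"
  proof
    assume "Z = {}"
    have "{x. f x = 0} sparse_in UNIV"
      unfolding sparse_in_def
    proof
      fix s :: real
      obtain r where r: "r > 0" "\<And>y. y \<noteq> s \<and> \<bar>y - s\<bar> < r \<Longrightarrow> f y \<noteq> 0" using iso \<open>Z = {}\<close> by blast
      have "\<not> y islimpt {x. f x = 0}" if y: "y \<in> ball s r" for y
      proof
        assume lim: "y islimpt {x. f x = 0}"
        have "infinite (ball s r \<inter> {x. f x = 0})"
          using lim y unfolding islimpt_eq_acc_point by auto
        moreover have "ball s r \<inter> {x. f x = 0} \<subseteq> {s}" using r(2) by (force simp: dist_real_def abs_minus_commute)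
        ultimately show False using finite_subset by blast
      qed
      then show "\<exists>B. s \<in> B \<and> open B \<and> (\<forall>y\<in>B. \<not> y islimpt {x. f x = 0})"
        using r(1) by (intro exI[of _ "ball s r"]) auto
    qed
    then have "countable (UNIV \<inter> {x. f x = 0})" by (intro sparse_imp_countable) auto
    then show False using unc by simp
  qed
  ultimately have "x \<in> Z" by auto
  then obtain r where "r > 0" "\<forall>h. \<bar>h\<bar> < r \<longrightarrow> f (x + h) = 0" unfolding Z_def by blast
  then show ?thesis by (metis abs_zero add.right_neutral)
qed

text \<open>One shape for three uses: comparing two sections of a set, a single shifted function
  (\<open>b = 0\<close>), and the functional equation read as a function of one argument.\<close>

lemma real_analytic_linear_combination:
  assumes f: "real_analytic f"
  shows "real_analytic (\<lambda>y. a * f (x + y) - b * f (x' + y))"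
  unfolding real_analytic_def
proof
  fix s
  obtain c :: "nat \<Rightarrow> complex" and r where r: "r > 0"
    and c: "\<And>h. \<bar>h\<bar> < r \<Longrightarrow> (\<lambda>n. c n * of_real h ^ n) sums f ((x + s) + h)"
    using f unfolding real_analytic_def by metis
  obtain c' :: "nat \<Rightarrow> complex" and r' where r': "r' > 0"
    and c': "\<And>h. \<bar>h\<bar> < r' \<Longrightarrow> (\<lambda>n. c' n * of_real h ^ n) sums f ((x' + s) + h)"
    using f unfolding real_analytic_def by metis
  have "(\<lambda>n. (a * c n - b * c' n) * of_real h ^ n) sums (a * f (x + (s + h)) - b * f (x' + (s + h)))"
    if "\<bar>h\<bar> < min r r'" for h
    using sums_diff[OF sums_mult[OF c, of h a] sums_mult[OF c', of h b]] that
    by (simp add: algebra_simps)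
  then show "\<exists>c. \<exists>r>0. \<forall>h. \<bar>h\<bar> < r \<longrightarrow>
    (\<lambda>n. c n * of_real h ^ n) sums (a * f (x + (s + h)) - b * f (x' + (s + h)))"
    using r r' by (intro exI[of _ "\<lambda>n. a * c n - b * c' n"] exI[of _ "min r r'"]) auto
qed

section \<open>Characteristic functions: multiplicativity, and analyticity for bounded
  support\<close>

lemma borel_measurable_cis [measurable]: "cis \<in> borel_measurable borel"
  by (intro borel_measurable_continuous_onI continuous_intros)

lemma (in real_distribution) char_uminus: "char M (- t) = cnj (char M t)"
  unfolding char_def
  by (subst Bochner_Integration.integral_cnj[symmetric]) (simp add: exp_cnj)

lemma (in prob_space) AE_witness:
  assumes "AE x in M. Q x"
  obtains x where "x \<in> space M" "Q x"
proof -
  have "\<exists>x\<in>space M. Q x"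
  proof (rule ccontr)
    assume *: "\<not> (\<exists>x\<in>space M. Q x)"
    have "AE x in M. False" using assms AE_space by eventually_elim (use * in auto)
    then show False by simp
  qed
  then show thesis using that by blast
qed

lemma eq_return_borel:
  assumes "real_distribution P" "AE x in P. x = z"
  shows "P = return borel z"
proof -
  interpret P: real_distribution P by fact
  show ?thesis
  proof (rule measure_eqI)
    fix A assume A: "A \<in> sets P"
    have "emeasure P A = emeasure P (if z \<in> A then space P else {})"
      using A assms(2) by (intro emeasure_eq_AE) (auto split: if_splits)
    then show "emeasure P A = emeasure (return borel z) A"
      using A P.emeasure_space_1 by (auto split: if_splits)
  qed simp
qed

text \<open>If \<open>\<bar>char P t\<bar> = 1\<close> then \<open>cos (t * (x - x')) = 1\<close> for \<open>P \<Otimes>\<^sub>M P\<close>-almost all \<open>(x, x')\<close>; the times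
  \<open>t = 1 / (n + 1)\<close> together force \<open>x = x'\<close>.\<close>

lemma multiplicative_char_imp_return:
  assumes P: "real_distribution P" and mult: "\<And>p y. char P (p + y) = char P p * char P y"
  shows "\<exists>z. P = return borel z"
proof -
  interpret P: real_distribution P by fact
  interpret PP: pair_prob_space P P ..
  have norm1: "cmod (char P t) = 1" for t
  proof -
    have "char P t * char P (- t) = 1" using mult[of t "- t"] P.char_zero by simp
    then have "char P t * cnj (char P t) = 1" using P.char_uminus by simp
    then have "of_real ((cmod (char P t))\<^sup>2) = (1::complex)" by (simp only: complex_norm_square)
    then have "(cmod (char P t))\<^sup>2 = 1" using of_real_eq_1_iff by blast
    then show ?thesis by (simp add: power2_eq_1_iff) (smt (verit) norm_ge_zero)
  qed
  have ae: "AE w in P \<Otimes>\<^sub>M P. cos (t * (fst w - snd w)) = 1" for t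
  proof -
    \<comment> \<open>By Fubini this integral is \<open>char P t * cnj (char P t) = 1\<close>; a
      real part bounded by 1 and of mean 1 equals 1 almost everywhere.\<close>
    have "(\<integral>w. cis (t * (fst w - snd w)) \<partial>(P \<Otimes>\<^sub>M P)) = (\<integral>x. \<integral>y. cis (t * (x - y)) \<partial>P \<partial>P)"
      by (subst PP.integral_fst'[symmetric]) (auto intro!: PP.P.integrable_const_bound[where B=1])
    also have "\<dots> = (\<integral>x. \<integral>y. cis (t * x) * cnj (cis (t * y)) \<partial>P \<partial>P)"
      by (simp add: cis_cnj cis_mult right_diff_distrib)
    also have "\<dots> = (\<integral>x. cis (t * x) \<partial>P) * cnj (\<integral>y. cis (t * y) \<partial>P)"
      by simp
    also have "\<dots> = char P t * cnj (char P t)"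
      unfolding char_def by (simp add: cis_conv_exp)
    also have "\<dots> = 1" using norm1[of t] by (simp add: complex_norm_square[symmetric] del: of_real_power)
    finally have "Re (\<integral>w. cis (t * (fst w - snd w)) \<partial>(P \<Otimes>\<^sub>M P)) = 1" by simp
    then have "(\<integral>w. cos (t * (fst w - snd w)) \<partial>(P \<Otimes>\<^sub>M P)) = 1"
      by (subst (asm) integral_Re[symmetric]) (auto intro!: PP.P.integrable_const_bound[where B=1])
    then have "(\<integral>w. 1 - cos (t * (fst w - snd w)) \<partial>(P \<Otimes>\<^sub>M P)) = 0"
      by (subst Bochner_Integration.integral_diff)
        (auto intro!: PP.P.integrable_const_bound[where B=1] simp: PP.P.prob_space)
    then have "AE w in P \<Otimes>\<^sub>M P. 1 - cos (t * (fst w - snd w)) = 0"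
      by (subst (asm) integral_nonneg_eq_0_iff_AE) (auto intro!: PP.P.integrable_const_bound[where B=2])
    then show ?thesis by auto
  qed
  have "AE w in P \<Otimes>\<^sub>M P. \<forall>n. cos (1 / real (Suc n) * (fst w - snd w)) = 1"
    by (subst AE_all_countable) (use ae in blast)
  then have "AE w in P \<Otimes>\<^sub>M P. fst w = snd w"
  proof eventually_elim
    case (elim w)
    define u where "u = fst w - snd w"
    \<comment> \<open>For this \<open>n\<close> the angle lies in \<open>(-1, 1)\<close>, which
      contains no multiple of \<open>2 * pi\<close> except 0.\<close>
    obtain n where n: "\<bar>u\<bar> < real (Suc n)"
      using reals_Archimedean2[of "\<bar>u\<bar>"] by (metis lessI less_trans of_nat_less_iff)
    have "cos (1 / real (Suc n) * u) = 1" using elim u_def by auto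
    then obtain k :: int where k: "1 / real (Suc n) * u = of_int k * 2 * pi"
      unfolding cos_one_2pi_int by blast
    have "\<bar>1 / real (Suc n) * u\<bar> < 1" using n by (auto simp: abs_mult divide_simps)
    then have "\<bar>of_int k * 2 * pi\<bar> < 1" by (simp only: k)
    then have "real_of_int \<bar>k\<bar> * (2 * pi) < 1" by (simp add: abs_mult mult_ac)
    moreover have "1 * 1 \<le> real_of_int \<bar>k\<bar> * (2 * pi)" if "k \<noteq> 0"
      by (rule mult_mono) (use pi_gt3 that in auto)
    ultimately have "k = 0" by fastforce
    then show ?case using k u_def by simp
  qed
  then have "AE x in P. AE y in P. x = y"
    by (drule_tac PP.AE_pair) simp
  then obtain z where "AE y in P. z = y" by (rule P.AE_witness)
  then have "P = return borel z" by (intro eq_return_borel[OF P]) auto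
  then show ?thesis ..
qed

text \<open>The complement of the support is the union of all open null sets, and by Lindelof's
  theorem countably many of them already cover it.\<close>

lemma compl_measure_support_null:
  assumes "sets P = sets borel"
  shows "- measure_support P \<in> null_sets P"
proof -
  define \<U> where "\<U> = {U. open U \<and> emeasure P U = 0}"
  have eq: "- measure_support P = \<Union>\<U>"
    unfolding measure_support_def \<U>_def by (auto simp: not_less)
  obtain \<V> where \<V>: "\<V> \<subseteq> \<U>" "countable \<V>" "\<Union>\<V> = \<Union>\<U>"
    using Lindelof[of \<U>] unfolding \<U>_def by (metis (no_types, lifting) mem_Collect_eq)
  have "(\<Union>U\<in>\<V>. U) \<in> null_sets P"
    using \<V> assms unfolding \<U>_def by (intro null_sets_UN') (auto simp: null_sets_def)
  then show ?thesis using eq \<V>(3) by auto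
qed

text \<open>The exponential series in \<open>h\<close> is integrated term by term. As
  \<open>\<bar>x\<bar> \<le> K\<close> almost surely, the \<open>n\<close>-th term is dominated by
  \<open>(K * \<bar>h\<bar>) ^ n / fact n\<close>, and the coefficients are moments twisted by
  \<open>cis (s * x)\<close>.\<close>

lemma real_analytic_char_bounded_support:
  assumes P: "real_distribution P" and bdd: "bounded (measure_support P)"
  shows "real_analytic (char P)"
proof -
  interpret P: real_distribution P by fact
  obtain K where K: "K > 0" "\<And>x. x \<in> measure_support P \<Longrightarrow> \<bar>x\<bar> \<le> K"
    using bdd unfolding bounded_pos by auto
  have ae: "AE x in P. \<bar>x\<bar> \<le> K"
    by (rule AE_I'[OF compl_measure_support_null]) (use K in auto)
  show ?thesis
    unfolding real_analytic_def
  proof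
    fix s
    define c where "c n = (CLINT x|P. cis (s * x) * (\<i> * of_real x) ^ n / fact n)" for n
    define g where "g h n x = cis (s * x) * (\<i> * of_real x) ^ n / fact n * of_real h ^ n" for h :: real and n x
    have bound: "AE x in P. norm (g h n x) \<le> (K * \<bar>h\<bar>) ^ n / fact n" for h n
      using ae
    proof eventually_elim
      case (elim x)
      have "norm (g h n x) = (\<bar>x\<bar> * \<bar>h\<bar>) ^ n / fact n"
        unfolding g_def by (simp add: norm_mult norm_divide norm_power power_mult_distrib)
      also have "\<dots> \<le> (K * \<bar>h\<bar>) ^ n / fact n"
        by (intro divide_right_mono power_mono mult_right_mono) (use elim in auto)
      finally show ?case .
    qed
    have int: "integrable P (g h n)" for h n
      by (rule P.integrable_const_bound[OF bound]) (simp add: g_def)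
    have "(\<lambda>n. c n * of_real h ^ n) sums char P (s + h)" for h
    proof -
      have sm: "summable (\<lambda>n. (K * \<bar>h\<bar>) ^ n / fact n)"
        using summable_exp[of "K * \<bar>h\<bar>"] by (simp add: divide_inverse mult.commute)
      have "(\<lambda>n. \<integral>x. g h n x \<partial>P) sums (\<integral>x. (\<Sum>n. g h n x) \<partial>P)"
      proof (rule sums_integral[OF int])
        have "AE x in P. \<forall>n. norm (g h n x) \<le> (K * \<bar>h\<bar>) ^ n / fact n"
          by (subst AE_all_countable) (use bound in blast)
        then show "AE x in P. summable (\<lambda>n. norm (g h n x))"
          by eventually_elim (rule summable_comparison_test[OF _ sm], auto)
        have "(\<integral>x. norm (g h n x) \<partial>P) \<le> (K * \<bar>h\<bar>) ^ n / fact n" for n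
          using integral_mono_AE[OF _ _ bound, of h n] int using P.prob_space by simp
        then show "summable (\<lambda>n. \<integral>x. norm (g h n x) \<partial>P)"
          by (intro summable_comparison_test[OF _ sm]) auto
      qed
      moreover have "(\<integral>x. g h n x \<partial>P) = c n * of_real h ^ n" for n
        unfolding g_def c_def by simp
      moreover have "(\<Sum>n. g h n x) = iexp ((s + h) * x)" for x
      proof -
        have "(\<lambda>n. cis (s * x) * ((\<i> * of_real (h * x)) ^ n /\<^sub>R fact n)) sums (cis (s * x) * exp (\<i> * of_real (h * x)))"
          by (intro sums_mult exp_converges)
        moreover have "cis (s * x) * ((\<i> * of_real (h * x)) ^ n /\<^sub>R fact n) = g h n x" for n
          unfolding g_def by (simp add: scaleR_conv_of_real field_simps)
        moreover have "cis (s * x) * exp (\<i> * of_real (h * x)) = iexp ((s + h) * x)"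
          unfolding cis_conv_exp by (simp add: exp_add[symmetric] algebra_simps)
        ultimately show ?thesis by (simp add: sums_iff)
      qed
      ultimately show ?thesis unfolding char_def by simp
    qed
    \<comment> \<open>The expansion holds for every \<open>h\<close>, so the radius 1 is
      arbitrary.\<close>
    then show "\<exists>c. \<exists>r>0. \<forall>h. \<bar>h\<bar> < r \<longrightarrow> (\<lambda>n. c n * of_real h ^ n) sums char P (s + h)"
      by (intro exI[of _ c] exI[of _ 1]) auto
  qed
qed

section \<open>Minimization and representation in \<open>L2\<close>\<close>

lemma L2_measurable [measurable_dest]: "f \<in> L2 M \<Longrightarrow> f \<in> borel_measurable M"
  unfolding L2_def by simp

lemma L2_integrable_power2: "f \<in> L2 M \<Longrightarrow> integrable M (\<lambda>x. (cmod (f x))\<^sup>2)"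
  unfolding L2_def by simp

lemma L2_integrable_cmod_mult:
  assumes "f \<in> L2 M" "g \<in> L2 M"
  shows "integrable M (\<lambda>x. cmod (f x) * cmod (g x))"
proof (rule Bochner_Integration.integrable_bound)
  show "integrable M (\<lambda>x. (cmod (f x))\<^sup>2 + (cmod (g x))\<^sup>2)"
    using assms by (simp add: L2_integrable_power2)
  show "(\<lambda>x. cmod (f x) * cmod (g x)) \<in> borel_measurable M"
    using assms[THEN L2_measurable] by measurable
  have "cmod (f x) * cmod (g x) \<le> (cmod (f x))\<^sup>2 + (cmod (g x))\<^sup>2" for x
  proof -
    have "2 * cmod (f x) * cmod (g x) \<le> (cmod (f x))\<^sup>2 + (cmod (g x))\<^sup>2" by (rule sum_squares_bound)
    moreover have "0 \<le> cmod (f x) * cmod (g x)" by simp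
    ultimately show ?thesis by linarith
  qed
  then show "AE x in M. norm (cmod (f x) * cmod (g x)) \<le> norm ((cmod (f x))\<^sup>2 + (cmod (g x))\<^sup>2)"
    by simp
qed

lemma L2_integrable_mult:
  assumes "f \<in> L2 M" "g \<in> L2 M"
  shows "integrable M (\<lambda>x. f x * g x)"
  by (rule Bochner_Integration.integrable_bound[OF L2_integrable_cmod_mult[OF assms]])
    (use assms[THEN L2_measurable] in \<open>auto simp: norm_mult\<close>)

lemma borel_measurable_cnj [measurable]: "cnj \<in> borel_measurable borel"
  by (intro borel_measurable_continuous_onI continuous_intros)

lemma L2_cnj: "f \<in> L2 M \<Longrightarrow> (\<lambda>x. cnj (f x)) \<in> L2 M"
  unfolding L2_def by (simp add: measurable_compose[OF _ borel_measurable_cnj])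

lemma L2_scale: "f \<in> L2 M \<Longrightarrow> (\<lambda>x. c * f x) \<in> L2 M"
  unfolding L2_def by (auto simp: norm_mult power_mult_distrib)

lemma L2_add:
  assumes "f \<in> L2 M" "g \<in> L2 M"
  shows "(\<lambda>x. f x + g x) \<in> L2 M"
proof -
  have [measurable]: "f \<in> borel_measurable M" "g \<in> borel_measurable M" using assms[THEN L2_measurable] by auto
  have "integrable M (\<lambda>x. (cmod (f x + g x))\<^sup>2)"
  proof (rule Bochner_Integration.integrable_bound)
    show "integrable M (\<lambda>x. 2 * (cmod (f x))\<^sup>2 + 2 * (cmod (g x))\<^sup>2)"
      using assms by (simp add: L2_integrable_power2)
    have "(cmod (f x + g x))\<^sup>2 \<le> 2 * (cmod (f x))\<^sup>2 + 2 * (cmod (g x))\<^sup>2" for x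
    proof -
      have "(cmod (f x + g x))\<^sup>2 \<le> (cmod (f x) + cmod (g x))\<^sup>2"
        by (intro power_mono norm_triangle_ineq) auto
      also have "\<dots> \<le> 2 * (cmod (f x))\<^sup>2 + 2 * (cmod (g x))\<^sup>2"
        using sum_squares_bound[of "cmod (f x)" "cmod (g x)"] by (simp add: power2_sum)
      finally show ?thesis .
    qed
    then show "AE x in M. norm ((cmod (f x + g x))\<^sup>2) \<le> norm (2 * (cmod (f x))\<^sup>2 + 2 * (cmod (g x))\<^sup>2)"
      by simp
  qed simp
  then show ?thesis unfolding L2_def by simp
qed

lemma L2_diff: "f \<in> L2 M \<Longrightarrow> g \<in> L2 M \<Longrightarrow> (\<lambda>x. f x - g x) \<in> L2 M"
  using L2_add[OF _ L2_scale[of g M "-1"]] by simp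

lemma L2_sum:
  assumes "\<And>k. k \<in> K \<Longrightarrow> f k \<in> L2 M"
  shows "(\<lambda>x. \<Sum>k\<in>K. f k x) \<in> L2 M"
  using assms
proof (induction K rule: infinite_finite_induct)
  case (insert k K)
  then show ?case using L2_add[of "f k" M "\<lambda>x. \<Sum>k\<in>K. f k x"] by simp
qed (simp_all add: L2_def)

lemma (in finite_measure) L2_bounded:
  assumes "f \<in> borel_measurable M" "\<And>x. x \<in> space M \<Longrightarrow> cmod (f x) \<le> B"
  shows "f \<in> L2 M"
proof -
  have "integrable M (\<lambda>x. (cmod (f x))\<^sup>2)"
    by (rule integrable_const_bound[of _ "B\<^sup>2"]) (use assms in \<open>auto intro!: power_mono\<close>)
  then show ?thesis using assms(1) unfolding L2_def by simp
qed

lemma L2_cauchy_schwarz: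
  assumes f: "f \<in> L2 M" and g: "g \<in> L2 M"
  shows "(\<integral>x. cmod (f x) * cmod (g x) \<partial>M)\<^sup>2 \<le> (\<integral>x. (cmod (f x))\<^sup>2 \<partial>M) * (\<integral>x. (cmod (g x))\<^sup>2 \<partial>M)"
proof -
  define a b c where "a = (\<integral>x. (cmod (f x))\<^sup>2 \<partial>M)" and "b = (\<integral>x. cmod (f x) * cmod (g x) \<partial>M)"
    and "c = (\<integral>x. (cmod (g x))\<^sup>2 \<partial>M)"
  note int = L2_integrable_power2[OF f] L2_integrable_power2[OF g] L2_integrable_cmod_mult[OF f g]
  have quad: "0 \<le> a - 2 * t * b + t\<^sup>2 * c" for t
  proof -
    have "0 \<le> (\<integral>x. (cmod (f x) - t * cmod (g x))\<^sup>2 \<partial>M)" by simp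
    also have "\<dots> = (\<integral>x. (cmod (f x))\<^sup>2 - (2 * t) * (cmod (f x) * cmod (g x)) + t\<^sup>2 * (cmod (g x))\<^sup>2 \<partial>M)"
      by (intro Bochner_Integration.integral_cong) (auto simp: power2_eq_square algebra_simps)
    also have "\<dots> = a - 2 * t * b + t\<^sup>2 * c"
      using int unfolding a_def b_def c_def by simp
    finally show ?thesis .
  qed
  have "0 \<le> c" unfolding c_def by simp
  have "b\<^sup>2 \<le> a * c"
  proof (cases "c = 0")
    case True
    have "b = 0"
    proof (rule ccontr)
      assume "b \<noteq> 0"
      \<comment> \<open>For \<open>c = 0\<close> the quadratic is linear in \<open>t\<close>, and
        this \<open>t\<close> gives it the value \<open>-1\<close>.\<close>
      then show False using quad[of "(a + 1) / (2 * b)"] True by simp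
    qed
    then show ?thesis using True by simp
  next
    case False
    then have "c > 0" using \<open>0 \<le> c\<close> by simp
    have "0 \<le> (a - 2 * (b / c) * b + (b / c)\<^sup>2 * c) * c" using quad[of "b / c"] \<open>0 \<le> c\<close> by simp
    also have "\<dots> = a * c - b\<^sup>2" using \<open>c > 0\<close> by (simp add: field_simps power2_eq_square)
    finally show ?thesis by simp
  qed
  then show ?thesis unfolding a_def b_def c_def .
qed

lemma L2_cauchy_schwarz_norm:
  assumes f: "f \<in> L2 M" and g: "g \<in> L2 M"
  shows "(cmod (\<integral>x. f x * g x \<partial>M))\<^sup>2 \<le> (\<integral>x. (cmod (f x))\<^sup>2 \<partial>M) * (\<integral>x. (cmod (g x))\<^sup>2 \<partial>M)"
proof -
  have "cmod (\<integral>x. f x * g x \<partial>M) \<le> (\<integral>x. cmod (f x) * cmod (g x) \<partial>M)"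
    using integral_norm_bound[of M "\<lambda>x. f x * g x"] by (simp add: norm_mult)
  then have "(cmod (\<integral>x. f x * g x \<partial>M))\<^sup>2 \<le> (\<integral>x. cmod (f x) * cmod (g x) \<partial>M)\<^sup>2"
    by (intro power_mono) auto
  then show ?thesis using L2_cauchy_schwarz[OF f g] by linarith
qed

lemma cmod_diff_power2_le: "(cmod (a - b))\<^sup>2 \<le> 2 * (cmod (a - c))\<^sup>2 + 2 * (cmod (c - b))\<^sup>2"
proof -
  have "(cmod (a - b))\<^sup>2 \<le> (cmod (a - c) + cmod (c - b))\<^sup>2"
    by (intro power_mono) (use norm_triangle_ineq[of "a - c" "c - b"] in auto)
  also have "\<dots> \<le> 2 * (cmod (a - c))\<^sup>2 + 2 * (cmod (c - b))\<^sup>2"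
    using sum_squares_bound[of "cmod (a - c)" "cmod (c - b)"] by (simp add: power2_sum)
  finally show ?thesis .
qed

text \<open>Distances are kept squared throughout; the factor 2 is the price for avoiding square
  roots.\<close>

lemma L2_triangle:
  assumes "f \<in> L2 M" "g \<in> L2 M" "h \<in> L2 M"
  shows "(\<integral>x. (cmod (f x - h x))\<^sup>2 \<partial>M) \<le> 2 * (\<integral>x. (cmod (f x - g x))\<^sup>2 \<partial>M) + 2 * (\<integral>x. (cmod (g x - h x))\<^sup>2 \<partial>M)"
proof -
  have "(\<integral>x. (cmod (f x - h x))\<^sup>2 \<partial>M) \<le> (\<integral>x. 2 * (cmod (f x - g x))\<^sup>2 + 2 * (cmod (g x - h x))\<^sup>2 \<partial>M)"
    using L2_integrable_power2[OF L2_diff[OF assms(1,3)]] L2_integrable_power2[OF L2_diff[OF assms(1,2)]]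
      L2_integrable_power2[OF L2_diff[OF assms(2,3)]]
    by (intro integral_mono cmod_diff_power2_le) simp_all
  also have "\<dots> = 2 * (\<integral>x. (cmod (f x - g x))\<^sup>2 \<partial>M) + 2 * (\<integral>x. (cmod (g x - h x))\<^sup>2 \<partial>M)"
    using L2_integrable_power2[OF L2_diff[OF assms(1,2)]] L2_integrable_power2[OF L2_diff[OF assms(2,3)]] by simp
  finally show ?thesis .
qed

section \<open>Completeness, minimizers and the Riesz representation\<close>

text \<open>Riesz-Fischer with a rate. Weighted by \<open>2 ^ n\<close> the squared increments still
  have summable integrals, since \<open>2 ^ n * (1/4) ^ n = (1/2) ^ n\<close>, and this forces
  pointwise convergence almost everywhere. Fatou's lemma hands the bound on to the limit.\<close>

lemma L2_complete:
  assumes Q: "\<And>n. Q n \<in> L2 M"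
    and cauchy: "\<And>n m. n \<le> m \<Longrightarrow> (\<integral>x. (cmod (Q n x - Q m x))\<^sup>2 \<partial>M) \<le> (1/4) ^ n"
  shows "\<exists>F\<in>L2 M. \<forall>n. (\<integral>x. (cmod (Q n x - F x))\<^sup>2 \<partial>M) \<le> (1/4) ^ n"
proof -
  have [measurable]: "Q n \<in> borel_measurable M" for n using Q L2_measurable by auto
  define D where "D n x = (cmod (Q (Suc n) x - Q n x))\<^sup>2" for n x
  have [measurable]: "D n \<in> borel_measurable M" for n unfolding D_def by measurable
  have intd: "integrable M (\<lambda>x. (cmod (Q n x - Q m x))\<^sup>2)" for n m
    by (intro L2_integrable_power2 L2_diff Q)
  have "(\<integral>\<^sup>+x. (\<Sum>n. ennreal (2 ^ n * D n x)) \<partial>M) = (\<Sum>n. \<integral>\<^sup>+x. ennreal (2 ^ n * D n x) \<partial>M)"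
    by (intro nn_integral_suminf) measurable
  also have "\<dots> \<le> (\<Sum>n. ennreal ((1/2) ^ n))"
  proof (intro suminf_le)
    fix n
    have "(\<integral>\<^sup>+x. ennreal (2 ^ n * D n x) \<partial>M) = ennreal (\<integral>x. 2 ^ n * D n x \<partial>M)"
      by (intro nn_integral_eq_integral) (use intd in \<open>auto simp: D_def\<close>)
    also have "\<dots> \<le> ennreal ((1/2) ^ n)"
    proof (rule ennreal_leI)
      have "(\<integral>x. D n x \<partial>M) \<le> (1/4) ^ n"
        using cauchy[of n "Suc n"] unfolding D_def by (simp add: norm_minus_commute)
      then have "2 ^ n * (\<integral>x. D n x \<partial>M) \<le> 2 ^ n * (1/4) ^ n" by simp
      also have "\<dots> = (1/2) ^ n" by (simp flip: power_mult_distrib)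
      finally show "(\<integral>x. 2 ^ n * D n x \<partial>M) \<le> (1/2) ^ n" by simp
    qed
    finally show "(\<integral>\<^sup>+x. ennreal (2 ^ n * D n x) \<partial>M) \<le> ennreal ((1/2) ^ n)" .
  qed auto
  also have "\<dots> < \<infinity>"
    by (subst suminf_ennreal2) (auto simp: summable_geometric)
  finally have "AE x in M. (\<Sum>n. ennreal (2 ^ n * D n x)) \<noteq> \<infinity>"
    by (intro nn_integral_PInf_AE) (auto simp: less_top)
  then have "AE x in M. convergent (\<lambda>n. Q n x)"
  proof eventually_elim
    case (elim x)
    have "summable (\<lambda>n. 2 ^ n * D n x)"
      by (rule summable_suminf_not_top) (use elim in \<open>auto simp: D_def\<close>)
    then have sm: "summable (\<lambda>n. (1/2) ^ n + 2 ^ n * D n x)"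
      by (intro summable_add summable_geometric) auto
    have "summable (\<lambda>n. Q (Suc n) x - Q n x)"
    proof (rule summable_comparison_test[OF _ sm], intro exI allI impI)
      fix n :: nat
      \<comment> \<open>The increment \<open>v\<close> is bounded by
        \<open>u + v\<^sup>2 / u\<close> with \<open>u = (1/2) ^ n\<close>: both terms are summable,
        the second by the choice of weights.\<close>
      define u v where "u = ((1/2) ^ n :: real)" and "v = cmod (Q (Suc n) x - Q n x)"
      have u: "u > 0" "2 ^ n = inverse u" unfolding u_def by (simp_all add: power_one_over)
      have "2 * u * v \<le> u\<^sup>2 + v\<^sup>2" by (rule sum_squares_bound)
      moreover have "0 \<le> u * v" using u unfolding v_def by simp
      ultimately have "u * v \<le> u * u + v\<^sup>2" unfolding power2_eq_square by linarith
      moreover have "u * (u + inverse u * v\<^sup>2) = u * u + v\<^sup>2"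
        using u(1) by (simp add: distrib_left)
      ultimately have "u * v \<le> u * (u + inverse u * v\<^sup>2)" by simp
      then have "v \<le> u + inverse u * v\<^sup>2" using u by simp
      then show "norm (Q (Suc n) x - Q n x) \<le> (1/2) ^ n + 2 ^ n * D n x"
        unfolding D_def u(2) u_def[symmetric] v_def[symmetric] .
    qed
    then have "convergent (\<lambda>n. \<Sum>i<n. Q (Suc i) x - Q i x)" by (simp add: summable_iff_convergent)
    then have "convergent (\<lambda>n. Q n x - Q 0 x)" by (subst (asm) sum_lessThan_telescope)
    then show ?case using convergent_diff_const_right_iff by blast
  qed
  define F where "F x = lim (\<lambda>n. Q n x)" for x
  have [measurable]: "F \<in> borel_measurable M" unfolding F_def by measurable
  have lim: "AE x in M. (\<lambda>n. Q n x) \<longlonglongrightarrow> F x"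
    using \<open>AE x in M. convergent (\<lambda>n. Q n x)\<close> unfolding F_def by (simp add: convergent_LIMSEQ_iff)
  have nn: "(\<integral>\<^sup>+x. ennreal ((cmod (Q n x - F x))\<^sup>2) \<partial>M) \<le> ennreal ((1/4) ^ n)" for n
  proof -
    have "AE x in M. ennreal ((cmod (Q n x - F x))\<^sup>2) = liminf (\<lambda>m. ennreal ((cmod (Q n x - Q m x))\<^sup>2))"
      using lim
    proof eventually_elim
      case (elim x)
      have "(\<lambda>m. ennreal ((cmod (Q n x - Q m x))\<^sup>2)) \<longlonglongrightarrow> ennreal ((cmod (Q n x - F x))\<^sup>2)"
        using elim by (intro tendsto_ennrealI tendsto_intros)
      from lim_imp_Liminf[OF sequentially_bot this] show ?case by (rule sym)
    qed
    then have "(\<integral>\<^sup>+x. ennreal ((cmod (Q n x - F x))\<^sup>2) \<partial>M) = (\<integral>\<^sup>+x. liminf (\<lambda>m. ennreal ((cmod (Q n x - Q m x))\<^sup>2)) \<partial>M)"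
      by (rule nn_integral_cong_AE)
    also have "\<dots> \<le> liminf (\<lambda>m. \<integral>\<^sup>+x. ennreal ((cmod (Q n x - Q m x))\<^sup>2) \<partial>M)"
      by (rule nn_integral_liminf) measurable
    also have "\<dots> \<le> liminf (\<lambda>m::nat. ennreal ((1/4) ^ n))"
    proof (rule Liminf_mono)
      have "(\<integral>\<^sup>+x. ennreal ((cmod (Q n x - Q m x))\<^sup>2) \<partial>M) \<le> ennreal ((1/4) ^ n)" if "n \<le> m" for m
        using nn_integral_eq_integral[OF intd[of n m]] cauchy[OF that] by (simp add: ennreal_leI)
      then show "\<forall>\<^sub>F m in sequentially. (\<integral>\<^sup>+x. ennreal ((cmod (Q n x - Q m x))\<^sup>2) \<partial>M) \<le> ennreal ((1/4) ^ n)"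
        unfolding eventually_sequentially by blast
    qed
    also have "\<dots> = ennreal ((1/4) ^ n)" by (simp add: Liminf_const)
    finally show ?thesis .
  qed
  have int: "integrable M (\<lambda>x. (cmod (Q n x - F x))\<^sup>2)" for n
    by (rule integrableI_bounded) (use le_less_trans[OF nn[of n]] in auto)
  have le: "(\<integral>x. (cmod (Q n x - F x))\<^sup>2 \<partial>M) \<le> (1/4) ^ n" for n
    using nn[of n] nn_integral_eq_integral[OF int[of n]] by simp
  have "(\<lambda>x. Q 0 x - F x) \<in> L2 M" unfolding L2_def using int[of 0] by simp
  from L2_diff[OF Q[of 0] this] have "F \<in> L2 M" by simp
  then show ?thesis using le by blast
qed

text \<open>The parallelogram law makes near-minimizers of a quadratic functional close to each other.
  The set \<open>D\<close> is the graph of the linear part of the functional.\<close>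

lemma L2_minimizer:
  fixes D :: "(('a \<Rightarrow> complex) \<times> complex) set"
  assumes ne: "D \<noteq> {}" and L2: "\<And>Q l. (Q, l) \<in> D \<Longrightarrow> Q \<in> L2 M"
    and mid: "\<And>Q l Q' l'. (Q, l) \<in> D \<Longrightarrow> (Q', l') \<in> D \<Longrightarrow> (\<lambda>x. (Q x + Q' x) / 2, (l + l') / 2) \<in> D"
    and J: "\<And>Q l. J Q l = (\<integral>x. (cmod (Q x))\<^sup>2 \<partial>M) - 2 * Re l"
    and lower: "\<And>Q l. (Q, l) \<in> D \<Longrightarrow> B \<le> J Q l"
  obtains F m where "F \<in> L2 M" "\<And>Q l. (Q, l) \<in> D \<Longrightarrow> m \<le> J Q l"
    "\<And>\<delta>. \<delta> > 0 \<Longrightarrow> \<exists>Q l. (Q, l) \<in> D \<and> J Q l < m + \<delta>"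
    "\<And>Q l. (Q, l) \<in> D \<Longrightarrow> (\<integral>x. (cmod (Q x - F x))\<^sup>2 \<partial>M) \<le> 4 * (J Q l - m)"
proof -
  define m where "m = Inf ((\<lambda>(Q, l). J Q l) ` D)"
  have bdd: "bdd_below ((\<lambda>(Q, l). J Q l) ` D)" by (intro bdd_belowI2[of _ B]) (use lower in auto)
  have m: "m \<le> J Q l" if "(Q, l) \<in> D" for Q l
    unfolding m_def using cInf_lower[OF _ bdd] that by force
  have near: "\<exists>Q l. (Q, l) \<in> D \<and> J Q l < m + \<delta>" if "\<delta> > 0" for \<delta>
  proof -
    have "m < m + \<delta>" using that by simp
    from cInf_lessD[OF _ this[unfolded m_def]] ne show ?thesis unfolding m_def by force
  qed
  have par: "(\<integral>x. (cmod (Q x - Q' x))\<^sup>2 \<partial>M) \<le> 2 * (J Q l - m) + 2 * (J Q' l' - m)"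
    if D: "(Q, l) \<in> D" "(Q', l') \<in> D" for Q l Q' l'
  proof -
    define P where "P x = (Q x + Q' x) / 2" for x
    have P: "(P, (l + l') / 2) \<in> D" using mid[OF D] unfolding P_def .
    note int [simp] = L2_integrable_power2[OF L2[OF D(1)]] L2_integrable_power2[OF L2[OF D(2)]]
      L2_integrable_power2[OF L2[OF P]]
    have quarter: "4 * (cmod (z / 2))\<^sup>2 = (cmod z)\<^sup>2" for z
      by (simp add: norm_divide power_divide)
    have "(cmod (Q x - Q' x))\<^sup>2 = 2 * (cmod (Q x))\<^sup>2 + 2 * (cmod (Q' x))\<^sup>2 - 4 * (cmod (P x))\<^sup>2" for x
      unfolding P_def quarter cmod_power2 by (simp add: power2_eq_square algebra_simps add_divide_distrib)
    then have "(\<integral>x. (cmod (Q x - Q' x))\<^sup>2 \<partial>M) = 2 * (\<integral>x. (cmod (Q x))\<^sup>2 \<partial>M) + 2 * (\<integral>x. (cmod (Q' x))\<^sup>2 \<partial>M)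
        - 4 * (\<integral>x. (cmod (P x))\<^sup>2 \<partial>M)"
      by simp
    also have "\<dots> = 2 * J Q l + 2 * J Q' l' - 4 * J P ((l + l') / 2)"
      unfolding J by (simp add: field_simps)
    also have "\<dots> \<le> 2 * (J Q l - m) + 2 * (J Q' l' - m)" using m[OF P] by simp
    finally show ?thesis .
  qed
  \<comment> \<open>An excess below \<open>(1/4) ^ n / 4\<close> makes the bound in
    \<open>par\<close> at most \<open>(1/4) ^ n\<close>, the rate that \<open>L2_complete\<close>
    asks for.\<close>
  have "\<forall>n. \<exists>p. p \<in> D \<and> J (fst p) (snd p) < m + (1/4) ^ n / 4"
    using near[of "(1/4) ^ _ / 4"] by fastforce
  then obtain p where p: "\<And>n. p n \<in> D" "\<And>n. J (fst (p n)) (snd (p n)) < m + (1/4) ^ n / 4" by metis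
  have pD: "(fst (p n), snd (p n)) \<in> D" for n using p(1) by simp
  have "(\<integral>x. (cmod (fst (p n) x - fst (p k) x))\<^sup>2 \<partial>M) \<le> (1/4) ^ n" if "n \<le> k" for n k
  proof -
    have "(1/4 :: real) ^ k \<le> (1/4) ^ n" using that by (intro power_decreasing) auto
    moreover have "A \<le> u" if "v \<le> u" "A \<le> 2 * (B - m) + 2 * (C - m)" "B < m + u / 4" "C < m + v / 4"
      for A B C u v :: real using that by argo
    ultimately show ?thesis using par[OF pD[of n] pD[of k]] p(2)[of n] p(2)[of k] by blast
  qed
  from L2_complete[OF L2[OF pD] this] obtain F where F: "F \<in> L2 M"
    "\<And>n. (\<integral>x. (cmod (fst (p n) x - F x))\<^sup>2 \<partial>M) \<le> (1/4) ^ n" by blast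
  have "(\<integral>x. (cmod (Q x - F x))\<^sup>2 \<partial>M) \<le> 4 * (J Q l - m)" if D: "(Q, l) \<in> D" for Q l
  proof (rule LIMSEQ_le_const)
    \<comment> \<open>Passing through \<open>p n\<close>: twice the bound of \<open>par\<close>
      contributes \<open>4 * (J Q l - m) + (1/4) ^ n\<close>, twice the distance from
      \<open>p n\<close> to \<open>F\<close> another \<open>2 * (1/4) ^ n\<close>.\<close>
    show "(\<lambda>n. 4 * (J Q l - m) + 3 * (1/4) ^ n) \<longlonglongrightarrow> 4 * (J Q l - m)"
      by (auto intro!: tendsto_eq_intros LIMSEQ_power_zero)
    show "\<exists>N. \<forall>n\<ge>N. (\<integral>x. (cmod (Q x - F x))\<^sup>2 \<partial>M) \<le> 4 * (J Q l - m) + 3 * (1/4) ^ n"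
    proof (intro exI allI impI)
      fix n :: nat
      show "(\<integral>x. (cmod (Q x - F x))\<^sup>2 \<partial>M) \<le> 4 * (J Q l - m) + 3 * (1/4) ^ n"
        using L2_triangle[OF L2[OF D] L2[OF pD[of n]] F(1)] par[OF D pD[of n]] p(2)[of n] F(2)[of n] by argo
    qed
  qed
  then show thesis using that F(1) m near by blast
qed

text \<open>Minimize the squared norm minus twice the real part of the functional over the span of
  the \<open>e k\<close>. The bound says that the functional given by \<open>l\<close> has norm at
  most 1; it makes the functional well defined on the span although the \<open>e k\<close> may be
  dependent, and keeps the infimum above \<open>-1\<close>. That \<open>F\<close> lies in the
  closure of the conjugated span is part of the conclusion because weak limits are later tested on
  finite combinations only.\<close>

lemma L2_riesz:
  fixes e :: "'k \<Rightarrow> 'a \<Rightarrow> complex" and l :: "'k \<Rightarrow> complex"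
  assumes e: "\<And>k. e k \<in> L2 M"
    and bound: "\<And>K c. finite K \<Longrightarrow> (cmod (\<Sum>k\<in>K. c k * l k))\<^sup>2 \<le> (\<integral>x. (cmod (\<Sum>k\<in>K. c k * e k x))\<^sup>2 \<partial>M)"
  obtains F where "F \<in> L2 M" "\<And>k. (\<integral>x. F x * e k x \<partial>M) = l k"
    "\<And>\<epsilon>. \<epsilon> > 0 \<Longrightarrow> \<exists>K c. finite K \<and> (\<integral>x. (cmod (F x - cnj (\<Sum>k\<in>K. c k * e k x)))\<^sup>2 \<partial>M) < \<epsilon>"
proof -
  define D where "D = {(Q, r) |Q r. \<exists>K c. finite K \<and> Q = (\<lambda>x. \<Sum>k\<in>K. c k * e k x) \<and> r = (\<Sum>k\<in>K. c k * l k)}"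
  define J where "J Q r = (\<integral>x. (cmod (Q x))\<^sup>2 \<partial>M) - 2 * Re r" for Q and r :: complex
  have DL2: "Q \<in> L2 M" if "(Q, r) \<in> D" for Q r
    using that unfolding D_def by (auto intro!: L2_sum L2_scale e)
  have Dbound: "(cmod r)\<^sup>2 \<le> (\<integral>x. (cmod (Q x))\<^sup>2 \<partial>M)" if "(Q, r) \<in> D" for Q r
    using that bound unfolding D_def by auto
  have comb: "(\<lambda>x. a * Q x + b * Q' x, a * r + b * r') \<in> D" if D: "(Q, r) \<in> D" "(Q', r') \<in> D" for Q r Q' r' a b
  proof -
    obtain K c where K: "finite K" "Q = (\<lambda>x. \<Sum>k\<in>K. c k * e k x)" "r = (\<Sum>k\<in>K. c k * l k)"
      using D(1) unfolding D_def by blast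
    obtain K' c' where K': "finite K'" "Q' = (\<lambda>x. \<Sum>k\<in>K'. c' k * e k x)" "r' = (\<Sum>k\<in>K'. c' k * l k)"
      using D(2) unfolding D_def by blast
    define d where "d k = a * (if k \<in> K then c k else 0) + b * (if k \<in> K' then c' k else 0)" for k
    have ext: "(\<Sum>k\<in>K \<union> K'. d k * f k) = a * (\<Sum>k\<in>K. c k * f k) + b * (\<Sum>k\<in>K'. c' k * f k)" for f :: "'k \<Rightarrow> complex"
    proof -
      have "(\<Sum>k\<in>K. c k * f k) = (\<Sum>k\<in>K \<union> K'. (if k \<in> K then c k else 0) * f k)"
        using K(1) K'(1) by (intro sum.mono_neutral_cong_left) auto
      moreover have "(\<Sum>k\<in>K'. c' k * f k) = (\<Sum>k\<in>K \<union> K'. (if k \<in> K' then c' k else 0) * f k)"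
        using K(1) K'(1) by (intro sum.mono_neutral_cong_left) auto
      ultimately show ?thesis
        unfolding d_def by (simp add: sum_distrib_left sum.distrib[symmetric] distrib_right mult.assoc)
    qed
    show ?thesis unfolding D_def K(2,3) K'(2,3)
      using K(1) K'(1) ext[symmetric] by (auto intro!: exI[of _ "K \<union> K'"] exI[of _ d])
  qed
  have lower: "-1 \<le> J Q r" if "(Q, r) \<in> D" for Q r
  proof -
    have "2 * Re r \<le> 2 * 1 * cmod r" using complex_Re_le_cmod[of r] by simp
    also have "\<dots> \<le> 1\<^sup>2 + (cmod r)\<^sup>2" by (rule sum_squares_bound)
    finally show ?thesis using Dbound[OF that] unfolding J_def by simp
  qed
  have "(\<lambda>x. 0, 0) \<in> D" unfolding D_def by (auto intro!: exI[of _ "{}"])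
  then have ne: "D \<noteq> {}" by blast
  have mid: "(\<lambda>x. (Q x + Q' x) / 2, (r + r') / 2) \<in> D" if "(Q, r) \<in> D" "(Q', r') \<in> D" for Q r Q' r'
    using comb[OF that, of "1/2" "1/2"] by (simp add: add_divide_distrib)
  obtain F m where F: "F \<in> L2 M" and m: "\<And>Q r. (Q, r) \<in> D \<Longrightarrow> m \<le> J Q r"
    and near: "\<And>\<delta>. \<delta> > 0 \<Longrightarrow> \<exists>Q r. (Q, r) \<in> D \<and> J Q r < m + \<delta>"
    and close: "\<And>Q r. (Q, r) \<in> D \<Longrightarrow> (\<integral>x. (cmod (Q x - F x))\<^sup>2 \<partial>M) \<le> 4 * (J Q r - m)"
    by (rule L2_minimizer[of D M J "-1", OF ne DL2 mid J_def lower]) blast+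
  have approx: "\<exists>Q r. (Q, r) \<in> D \<and> J Q r < m + \<epsilon> \<and> (\<integral>x. (cmod (Q x - F x))\<^sup>2 \<partial>M) < \<epsilon>" if "\<epsilon> > 0" for \<epsilon>
  proof -
    have "\<epsilon> / 4 > 0" using that by simp
    from near[OF this] obtain Q r where Q: "(Q, r) \<in> D" "J Q r < m + \<epsilon> / 4" by blast
    then show ?thesis using close[OF Q(1)] that by (intro exI[of _ Q] exI[of _ r]) auto
  qed
  have eq: "(\<integral>x. F x * cnj (e k x) \<partial>M) = cnj (l k)" for k
  proof -
    define E where "E = (\<integral>x. (cmod (e k x))\<^sup>2 \<partial>M)"
    define \<beta> where "\<beta> = (\<integral>x. F x * cnj (e k x) \<partial>M) - cnj (l k)"
    have E: "E \<ge> 0" unfolding E_def by simp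
    have ek: "(e k, l k) \<in> D" unfolding D_def by (auto intro!: exI[of _ "{k}"] exI[of _ "\<lambda>_. 1"])
    \<comment> \<open>first variation of \<open>J\<close> at the minimizer in the direction \<open>e k\<close>\<close>
    have var: "0 \<le> 2 * Re (cnj z * \<beta>) + (cmod z)\<^sup>2 * E" for z
    proof (rule field_le_epsilon)
      fix \<epsilon> :: real assume "\<epsilon> > 0"
      \<comment> \<open>By Cauchy-Schwarz, replacing \<open>F\<close> by the near-minimizer
        \<open>Q\<close> changes the first-order term by at most
        \<open>(C - 1) * (\<epsilon> / (2 * C)) \<le> \<epsilon> / 2\<close>; the summand 1 keeps
        \<open>C\<close> positive. The other half of \<open>\<epsilon>\<close> pays for the excess
        \<open>\<eta>\<close> of \<open>Q\<close>.\<close>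
      define C where "C = 2 * cmod z * sqrt E + 1"
      have C: "C > 0" unfolding C_def using E by (simp add: add_nonneg_pos)
      define \<eta> where "\<eta> = min (\<epsilon> / 2) ((\<epsilon> / (2 * C))\<^sup>2)"
      have "\<eta> > 0" unfolding \<eta>_def using \<open>\<epsilon> > 0\<close> C by simp
      from approx[OF this] obtain Q r where Q: "(Q, r) \<in> D" "J Q r < m + \<eta>"
        "(\<integral>x. (cmod (Q x - F x))\<^sup>2 \<partial>M) < \<eta>" by blast
      note QL = DL2[OF Q(1)]
      have "(\<lambda>x. 1 * Q x + z * e k x, 1 * r + z * l k) \<in> D" by (rule comb[OF Q(1) ek])
      from m[OF this] have "m \<le> J (\<lambda>x. Q x + z * e k x) (r + z * l k)" by simp
      also have "\<dots> = J Q r + 2 * Re (cnj z * ((\<integral>x. Q x * cnj (e k x) \<partial>M) - cnj (l k))) + (cmod z)\<^sup>2 * E"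
      proof -
        define q where "q x = Re (cnj z * (Q x * cnj (e k x)))" for x
        have iq [simp]: "integrable M q" unfolding q_def
          using L2_integrable_mult[OF QL L2_cnj[OF e[of k]]] by (intro integrable_Re integrable_mult_right)
        note [simp] = L2_integrable_power2[OF QL] L2_integrable_power2[OF e[of k]]
        have "(cmod (Q x + z * e k x))\<^sup>2 = (cmod (Q x))\<^sup>2 + 2 * q x + (cmod z)\<^sup>2 * (cmod (e k x))\<^sup>2" for x
          unfolding cmod_power2 q_def by (simp add: power2_eq_square algebra_simps)
        then have "(\<integral>x. (cmod (Q x + z * e k x))\<^sup>2 \<partial>M) = (\<integral>x. (cmod (Q x))\<^sup>2 \<partial>M)
            + 2 * (\<integral>x. q x \<partial>M) + (cmod z)\<^sup>2 * E"
          unfolding E_def by simp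
        also have "(\<integral>x. q x \<partial>M) = Re (\<integral>x. cnj z * (Q x * cnj (e k x)) \<partial>M)"
          unfolding q_def using L2_integrable_mult[OF QL L2_cnj[OF e[of k]]]
          by (intro integral_Re integrable_mult_right)
        also have "(\<integral>x. cnj z * (Q x * cnj (e k x)) \<partial>M) = cnj z * (\<integral>x. Q x * cnj (e k x) \<partial>M)" by simp
        finally show ?thesis unfolding J_def by (simp add: algebra_simps)
      qed
      finally have "0 \<le> \<eta> + 2 * Re (cnj z * ((\<integral>x. Q x * cnj (e k x) \<partial>M) - cnj (l k))) + (cmod z)\<^sup>2 * E"
        using Q(2) by simp
      moreover have "(\<integral>x. Q x * cnj (e k x) \<partial>M) - cnj (l k) = \<beta> + (\<integral>x. (Q x - F x) * cnj (e k x) \<partial>M)"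
        unfolding \<beta>_def using L2_integrable_mult[OF QL L2_cnj[OF e[of k]]] L2_integrable_mult[OF F L2_cnj[OF e[of k]]]
        by (simp add: left_diff_distrib)
      moreover have "2 * Re (cnj z * (\<integral>x. (Q x - F x) * cnj (e k x) \<partial>M)) \<le> \<epsilon> / 2"
      proof -
        have "(cmod (\<integral>x. (Q x - F x) * cnj (e k x) \<partial>M))\<^sup>2 \<le> (\<integral>x. (cmod (Q x - F x))\<^sup>2 \<partial>M) * E"
          using L2_cauchy_schwarz_norm[OF L2_diff[OF QL F] L2_cnj[OF e[of k]]] unfolding E_def by simp
        also have "\<dots> \<le> (\<epsilon> / (2 * C))\<^sup>2 * E"
          using Q(3) E unfolding \<eta>_def by (intro mult_right_mono) auto
        also have "\<dots> = (\<epsilon> / (2 * C) * sqrt E)\<^sup>2" using E by (simp add: power_mult_distrib power_divide)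
        finally have le: "cmod (\<integral>x. (Q x - F x) * cnj (e k x) \<partial>M) \<le> \<epsilon> / (2 * C) * sqrt E"
          by (rule power2_le_imp_le) (use \<open>\<epsilon> > 0\<close> C E in simp)
        have "2 * Re (cnj z * (\<integral>x. (Q x - F x) * cnj (e k x) \<partial>M)) \<le> 2 * (cmod z * cmod (\<integral>x. (Q x - F x) * cnj (e k x) \<partial>M))"
          using complex_Re_le_cmod[of "cnj z * (\<integral>x. (Q x - F x) * cnj (e k x) \<partial>M)"] by (simp add: norm_mult)
        also have "\<dots> \<le> 2 * (cmod z * (\<epsilon> / (2 * C) * sqrt E))"
          using le by (intro mult_left_mono) auto
        also have "\<dots> = (C - 1) * (\<epsilon> / (2 * C))" unfolding C_def by simp
        also have "\<dots> \<le> C * (\<epsilon> / (2 * C))" using C \<open>\<epsilon> > 0\<close> by (intro mult_right_mono) auto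
        also have "\<dots> = \<epsilon> / 2" using C by simp
        finally show ?thesis .
      qed
      ultimately have "0 \<le> \<eta> + (2 * Re (cnj z * \<beta>) + \<epsilon> / 2) + (cmod z)\<^sup>2 * E"
        by (simp add: distrib_left)
      moreover have "\<eta> \<le> \<epsilon> / 2" unfolding \<eta>_def by simp
      ultimately show "0 \<le> 2 * Re (cnj z * \<beta>) + (cmod z)\<^sup>2 * E + \<epsilon>" by argo
    qed
    have "\<beta> = 0"
    proof (rule ccontr)
      assume "\<beta> \<noteq> 0"
      \<comment> \<open>Moving by \<open>- t * \<beta>\<close> changes the functional by
        \<open>t * (cmod \<beta>)\<^sup>2 * (t * E - 2)\<close>, which is negative because this
        \<open>t\<close> has \<open>t * E < 1\<close>.\<close>
      define t where "t = 1 / (E + 1)"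
      have t: "t > 0" "t * E < 1" unfolding t_def using E by (auto simp: field_simps)
      have "cnj (- of_real t * \<beta>) * \<beta> = of_real (- t * (cmod \<beta>)\<^sup>2)"
        using complex_norm_square[of \<beta>] by (simp add: mult_ac)
      then have "0 \<le> 2 * (- t * (cmod \<beta>)\<^sup>2) + (cmod (- of_real t * \<beta>))\<^sup>2 * E"
        using var[of "- of_real t * \<beta>"] by (simp only: Re_complex_of_real)
      also have "(cmod (- of_real t * \<beta>))\<^sup>2 = t\<^sup>2 * (cmod \<beta>)\<^sup>2" by (simp add: norm_mult power_mult_distrib)
      also have "2 * (- t * (cmod \<beta>)\<^sup>2) + t\<^sup>2 * (cmod \<beta>)\<^sup>2 * E = t * (cmod \<beta>)\<^sup>2 * (t * E - 2)"
        by (simp add: power2_eq_square algebra_simps)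
      also have "\<dots> < 0" using t \<open>\<beta> \<noteq> 0\<close> by (intro mult_pos_neg) auto
      finally show False by simp
    qed
    then show ?thesis unfolding \<beta>_def by simp
  qed
  show thesis
  \<comment> \<open>The minimizer represents the functional in the sesquilinear pairing; conjugation
    converts this to the bilinear pairing of the statement.\<close>
  proof (rule that[of "\<lambda>x. cnj (F x)"])
    show "(\<lambda>x. cnj (F x)) \<in> L2 M" by (rule L2_cnj[OF F])
    show "(\<integral>x. cnj (F x) * e k x \<partial>M) = l k" for k
      using arg_cong[OF eq[of k], of cnj] by (simp flip: Bochner_Integration.integral_cnj)
    show "\<exists>K c. finite K \<and> (\<integral>x. (cmod (cnj (F x) - cnj (\<Sum>k\<in>K. c k * e k x)))\<^sup>2 \<partial> M) < \<epsilon>" if eps: "\<epsilon> > 0" for \<epsilon>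
    proof -
      obtain K c where "finite K" "(\<integral>x. (cmod ((\<Sum>k\<in>K. c k * e k x) - F x))\<^sup>2 \<partial>M) < \<epsilon>"
        using approx[OF eps] unfolding D_def by blast
      then show ?thesis
        by (intro exI[of _ K] exI[of _ c])
          (simp add: norm_minus_commute complex_cnj_diff[symmetric] del: complex_cnj_diff cnj_sum complex_cnj_mult)
    qed
  qed
qed

section \<open>Joint weak limits on the spectral side\<close>

lemma (in real_distribution) char_eq_cis: "char M t = (CLINT x|M. cis (t * x))"
  unfolding char_def by (simp add: cis_conv_exp)

lemma (in prob_space) integrable_cis:
  "f \<in> borel_measurable M \<Longrightarrow> integrable M (\<lambda>x. cis (f x))"
  by (rule integrable_const_bound[of _ 1]) auto

text \<open>The integral of \<open>cmod (cis (h * x) - 1)\<close> bounds the increment for every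
  \<open>u\<close> and tends to 0 with \<open>h\<close> by dominated convergence.\<close>

lemma (in real_distribution) char_uniformly_continuous:
  assumes "\<epsilon> > 0"
  shows "\<exists>\<delta>>0. \<forall>h u. \<bar>h\<bar> < \<delta> \<longrightarrow> cmod (char M (u + h) - char M u) < \<epsilon>"
proof -
  have "((\<lambda>h. \<integral>x. cmod (cis (h * x) - 1) \<partial>M) \<longlongrightarrow> (\<integral>x. cmod (cis (0 * x) - 1) \<partial>M)) (at 0)"
    unfolding tendsto_at_iff_sequentially
  proof (intro allI impI)
    fix X :: "nat \<Rightarrow> real" assume X: "X \<longlonglongrightarrow> 0"
    have "cmod (cis t - 1) \<le> 2" for t using norm_triangle_ineq4[of "cis t" 1] by simp
    moreover have "(\<lambda>n. cmod (cis (X n * x) - 1)) \<longlonglongrightarrow> cmod (cis (0 * x) - 1)" for x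
      by (intro tendsto_intros X)
    ultimately have "(\<lambda>n. \<integral>x. cmod (cis (X n * x) - 1) \<partial>M) \<longlonglongrightarrow> (\<integral>x. cmod (cis (0 * x) - 1) \<partial>M)"
      by (intro integral_dominated_convergence[where w="\<lambda>_. 2"]) auto
    then show "((\<lambda>h. \<integral>x. cmod (cis (h * x) - 1) \<partial>M) \<circ> X) \<longlonglongrightarrow> (\<integral>x. cmod (cis (0 * x) - 1) \<partial>M)"
      by (simp add: comp_def)
  qed
  then have "\<forall>\<^sub>F h in at 0. (\<integral>x. cmod (cis (h * x) - 1) \<partial>M) < \<epsilon>"
    using assms by (intro order_tendstoD(2)) auto
  then obtain \<delta> where \<delta>: "\<delta> > 0" "\<And>h. h \<noteq> 0 \<Longrightarrow> \<bar>h\<bar> < \<delta> \<Longrightarrow> (\<integral>x. cmod (cis (h * x) - 1) \<partial>M) < \<epsilon>"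
    unfolding eventually_at by (auto simp: dist_real_def)
  have "cmod (char M (u + h) - char M u) < \<epsilon>" if h: "\<bar>h\<bar> < \<delta>" for h u
  proof (cases "h = 0")
    case False
    have "char M (u + h) - char M u = (\<integral>x. cis (u * x) * (cis (h * x) - 1) \<partial>M)"
      unfolding char_eq_cis
      by (subst Bochner_Integration.integral_diff[symmetric])
        (auto intro!: integrable_cis simp: cis_mult algebra_simps)
    also have "cmod \<dots> \<le> (\<integral>x. cmod (cis (u * x) * (cis (h * x) - 1)) \<partial>M)" by (rule integral_norm_bound)
    also have "\<dots> = (\<integral>x. cmod (cis (h * x) - 1) \<partial>M)" by (simp add: norm_mult)
    finally show ?thesis using \<delta>(2)[OF False h] by simp
  qed (use assms in simp)
  then show ?thesis using \<delta>(1) by blast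
qed

text \<open>Weak compactness of the characters \<open>cis (u n * x)\<close>, expressed by their
  Fourier coefficients: a diagonal sequence settles rational \<open>s\<close>, and uniform
  continuity carries convergence to all \<open>s\<close>.\<close>

lemma (in real_distribution) char_convergent_subsequence:
  fixes u :: "nat \<Rightarrow> real"
  obtains \<rho> \<psi> where "strict_mono (\<rho> :: nat \<Rightarrow> nat)" "\<And>s. (\<lambda>n. char M (u (\<rho> n) + s)) \<longlonglongrightarrow> \<psi> s"
proof -
  obtain \<rho> :: "nat \<Rightarrow> nat" where \<rho>: "strict_mono \<rho>"
    and q: "\<And>s. s \<in> \<rat> \<Longrightarrow> \<exists>l. (\<lambda>n. char M (u (\<rho> n) + s)) \<longlonglongrightarrow> l"
    by (rule function_convergent_subsequence[of "\<rat>" "\<lambda>n s. char M (u n + s)" 1])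
      (auto simp: countable_rat cmod_char_le_1)
  have "\<exists>l. (\<lambda>n. char M (u (\<rho> n) + s)) \<longlonglongrightarrow> l" for s
  proof -
    have "Cauchy (\<lambda>n. char M (u (\<rho> n) + s))"
    proof (rule metric_CauchyI)
      fix \<epsilon> :: real assume "\<epsilon> > 0"
      then have "\<epsilon> / 3 > 0" by simp
      from char_uniformly_continuous[OF this] obtain \<delta> where \<delta>: "\<delta> > 0"
        "\<And>h v. \<bar>h\<bar> < \<delta> \<Longrightarrow> cmod (char M (v + h) - char M v) < \<epsilon> / 3" by blast
      obtain p where p: "p \<in> \<rat>" "\<bar>p - s\<bar> < \<delta>"
        using Rats_dense_in_real[of s "s + \<delta>"] \<delta>(1) by force
      have "Cauchy (\<lambda>n. char M (u (\<rho> n) + p))" using q[OF p(1)] LIMSEQ_imp_Cauchy by blast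
      from metric_CauchyD[OF this \<open>\<epsilon> / 3 > 0\<close>] obtain N where
        N: "\<And>m n. m \<ge> N \<Longrightarrow> n \<ge> N \<Longrightarrow> dist (char M (u (\<rho> m) + p)) (char M (u (\<rho> n) + p)) < \<epsilon> / 3" by blast
      have "dist (char M (u (\<rho> m) + s)) (char M (u (\<rho> n) + s)) < \<epsilon>" if "m \<ge> N" "n \<ge> N" for m n
      proof -
        have near: "dist (char M (u (\<rho> k) + p)) (char M (u (\<rho> k) + s)) < \<epsilon> / 3" for k
          using \<delta>(2)[OF p(2), of "u (\<rho> k) + s"] by (simp add: dist_norm algebra_simps)
        show ?thesis
          using N[OF that] near[of m] near[of n]
            dist_triangle3[of "char M (u (\<rho> m) + s)" "char M (u (\<rho> n) + p)" "char M (u (\<rho> m) + p)"]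
            dist_triangle[of "char M (u (\<rho> m) + s)" "char M (u (\<rho> n) + s)" "char M (u (\<rho> n) + p)"]
          by argo
      qed
      then show "\<exists>N. \<forall>m\<ge>N. \<forall>n\<ge>N. dist (char M (u (\<rho> m) + s)) (char M (u (\<rho> n) + s)) < \<epsilon>" by blast
    qed
    then show ?thesis by (simp add: Cauchy_convergent_iff convergent_def)
  qed
  then show thesis using that[OF \<rho>] by metis
qed

section \<open>Densities determined by their Fourier coefficients\<close>

text \<open>Positive and negative part of \<open>R\<close> have equal mass (the coefficient at
  \<open>s = 0\<close>), and after normalization they are densities of two distributions with the
  same characteristic function, so Levy's uniqueness theorem identifies them.\<close>

lemma real_density_zero:
  assumes M: "real_distribution M" and [measurable]: "R \<in> borel_measurable borel"
    and R: "integrable M R"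
    and ft: "\<And>s. (CLINT x|M. of_real (R x) * cis (s * x)) = 0"
  shows "AE x in M. R x = (0::real)"
proof -
  interpret M: real_distribution M by fact
  define p n where "p x = max (R x) 0" and "n x = max (- R x) 0" for x
  have [measurable]: "p \<in> borel_measurable borel" "n \<in> borel_measurable borel" unfolding p_def n_def by measurable
  have R_eq: "R x = p x - n x" "\<bar>R x\<bar> = p x + n x" for x unfolding p_def n_def by auto
  have nonneg: "p x \<ge> 0" "n x \<ge> 0" for x unfolding p_def n_def by auto
  have int: "integrable M p" "integrable M n" unfolding p_def n_def using R by auto
  define m where "m = (\<integral>x. p x \<partial>M)"
  have intc: "integrable M (\<lambda>x. of_real (f x) * cis (s * x))" if "integrable M f" for f :: "real \<Rightarrow> real" and s
    by (rule Bochner_Integration.integrable_bound[OF that]) (use that in \<open>auto simp: norm_mult\<close>)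
  have eq: "(CLINT x|M. of_real (p x) * cis (s * x)) = (CLINT x|M. of_real (n x) * cis (s * x))" for s
    using ft[of s] intc[OF int(1), of s] intc[OF int(2), of s] unfolding R_eq(1)
    by (simp add: left_diff_distrib)
  have mn: "(\<integral>x. n x \<partial>M) = m"
    using eq[of 0] unfolding m_def by (simp del: of_real_eq_iff flip: of_real_eq_iff[where 'a=complex])
  show ?thesis
  proof (cases "m = 0")
    case True
    then have "(\<integral>x. p x \<partial>M) = 0" "(\<integral>x. n x \<partial>M) = 0" using mn m_def by auto
    then have "AE x in M. p x = 0" "AE x in M. n x = 0"
      using integral_nonneg_eq_0_iff_AE[OF int(1)] integral_nonneg_eq_0_iff_AE[OF int(2)] nonneg by auto
    then show ?thesis by eventually_elim (simp add: R_eq)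
  next
    case False
    moreover have "m \<ge> 0" unfolding m_def using nonneg by simp
    ultimately have m: "m > 0" by simp
    define \<mu> where "\<mu> f = density M (\<lambda>x. ennreal (f x / m))" for f :: "real \<Rightarrow> real"
    have dist: "real_distribution (\<mu> f)" and ch: "char (\<mu> f) s = (CLINT x|M. of_real (f x) * cis (s * x)) / m"
      if [measurable]: "f \<in> borel_measurable borel" and f: "integrable M f" "\<And>x. f x \<ge> 0" "(\<integral>x. f x \<partial>M) = m" for f s
    proof -
      have "(\<integral>\<^sup>+x. ennreal (f x / m) \<partial>M) = ennreal (\<integral>x. f x / m \<partial>M)"
        by (intro nn_integral_eq_integral) (use f m in auto)
      also have "\<dots> = 1" using f m by simp
      finally have "prob_space (\<mu> f)"
        unfolding \<mu>_def by (intro prob_spaceI) (simp add: emeasure_density)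
      then show d: "real_distribution (\<mu> f)"
        unfolding \<mu>_def real_distribution_def real_distribution_axioms_def by simp
      interpret d: real_distribution "\<mu> f" by fact
      have "char (\<mu> f) s = (CLINT x|M. (f x / m) *\<^sub>R cis (s * x))"
        unfolding d.char_eq_cis unfolding \<mu>_def by (subst integral_density) (use f m in auto)
      also have "\<dots> = (CLINT x|M. of_real (f x) * cis (s * x) / m)"
        by (simp add: scaleR_conv_of_real)
      finally show "char (\<mu> f) s = (CLINT x|M. of_real (f x) * cis (s * x)) / m" by simp
    qed
    have "\<mu> p = \<mu> n"
      using int nonneg mn m_def
      by (intro Levy_uniqueness dist ext) (simp_all add: ch eq)
    moreover have "(\<integral>\<^sup>+x. ennreal (p x / m) \<partial>M) \<noteq> \<infinity>"
      using nn_integral_eq_integral[of M "\<lambda>x. p x / m"] int m nonneg by simp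
    ultimately have "AE x in M. ennreal (p x / m) = ennreal (n x / m)"
      unfolding \<mu>_def by (subst finite_density_unique[symmetric]) auto
    then show ?thesis
      by eventually_elim (use m nonneg R_eq in auto)
  qed
qed

text \<open>Dominated convergence along rational frequencies. Working with countably many
  frequencies matters when each comes with its own exceptional null set.\<close>

lemma integral_cis_zero:
  fixes D :: "'a \<Rightarrow> complex"
  assumes D: "integrable M D" and [measurable]: "g \<in> borel_measurable M"
    and ft: "\<And>s. s \<in> \<rat> \<Longrightarrow> (\<integral>x. D x * cis (s * g x) \<partial>M) = 0"
  shows "(\<integral>x. D x * cis (s * g x) \<partial>M) = 0"
proof -
  have [measurable]: "D \<in> borel_measurable M" using D by auto
  have "s \<in> closure \<rat>" using Rats_closure_real by simp
  then obtain q where q: "\<And>n. q n \<in> \<rat>" "q \<longlonglongrightarrow> s" unfolding closure_sequential by blast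
  have "(\<lambda>n. \<integral>x. D x * cis (q n * g x) \<partial>M) \<longlonglongrightarrow> (\<integral>x. D x * cis (s * g x) \<partial>M)"
  proof (rule integral_dominated_convergence)
    show "integrable M (\<lambda>x. cmod (D x))" using D by simp
    show "AE x in M. (\<lambda>n. D x * cis (q n * g x)) \<longlonglongrightarrow> D x * cis (s * g x)"
      by (intro AE_I2 tendsto_intros q(2))
  qed (auto simp: norm_mult)
  then show ?thesis using ft[OF q(1)] by (simp add: LIMSEQ_const_iff)
qed

text \<open>Conjugation turns the coefficient at \<open>- s\<close> into that of
  \<open>cnj D\<close> at \<open>s\<close>, so real and imaginary part of \<open>D\<close> have
  vanishing coefficients as well and the real case applies to each.\<close>

lemma complex_density_zero:
  assumes M: "real_distribution M" and D: "integrable M D"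
    and ft: "\<And>s. s \<in> \<rat> \<Longrightarrow> (CLINT x|M. D x * cis (s * x)) = 0"
  shows "AE x in M. D x = 0"
proof -
  interpret M: real_distribution M by fact
  have [measurable]: "D \<in> borel_measurable borel" using D by auto
  have intc: "integrable M (\<lambda>x. D x * cis (s * x))" for s
    by (rule Bochner_Integration.integrable_bound[OF D]) (auto simp: norm_mult)
  have ft': "(CLINT x|M. D x * cis (s * x)) = 0" for s
    by (rule integral_cis_zero[OF D _ ft]) auto
  have cn: "(CLINT x|M. cnj (D x) * cis (s * x)) = 0" for s
    using arg_cong[OF ft'[of "- s"], of cnj] by (simp flip: Bochner_Integration.integral_cnj add: cis_cnj)
  have intc': "integrable M (\<lambda>x. cnj (D x) * cis (s * x))" for s
    by (rule Bochner_Integration.integrable_bound[OF D]) (auto simp: norm_mult)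
  have "(CLINT x|M. of_real (Re (D x)) * cis (s * x)) = 0" for s
  proof -
    have "of_real (Re (D x)) * cis (s * x) = (D x * cis (s * x) + cnj (D x) * cis (s * x)) / 2" for x
      by (simp add: complex_add_cnj distrib_right[symmetric])
    then have "(CLINT x|M. of_real (Re (D x)) * cis (s * x))
        = (CLINT x|M. (D x * cis (s * x) + cnj (D x) * cis (s * x)) / 2)" by (simp only:)
    then show ?thesis using intc[of s] intc'[of s] ft'[of s] cn[of s] by simp
  qed
  then have "AE x in M. Re (D x) = 0" by (intro real_density_zero[OF M]) (use D in auto)
  moreover have "(CLINT x|M. of_real (Im (D x)) * cis (s * x)) = 0" for s
  proof -
    have "of_real (Im (D x)) * cis (s * x) = (D x * cis (s * x) - cnj (D x) * cis (s * x)) * (- \<i> / 2)" for x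
      by (simp add: complex_eq_iff algebra_simps add_divide_distrib diff_divide_distrib)
    then have "(CLINT x|M. of_real (Im (D x)) * cis (s * x))
        = (CLINT x|M. (D x * cis (s * x) - cnj (D x) * cis (s * x)) * (- \<i> / 2))" by (simp only:)
    then show ?thesis using intc[of s] intc'[of s] ft'[of s] cn[of s] by simp
  qed
  then have "AE x in M. Im (D x) = 0" by (intro real_density_zero[OF M]) (use D in auto)
  ultimately show ?thesis by eventually_elim (simp add: complex_eq_iff)
qed

text \<open>For fixed \<open>r\<close>, uniqueness in the variable \<open>x\<close> kills the
  coefficient of almost every section. Letting \<open>r\<close> run over the rationals leaves one
  null set for all of them, after which uniqueness applies in \<open>y\<close>.\<close>

lemma complex_density_zero_pair:
  assumes M: "real_distribution M" and N: "real_distribution N" and D: "integrable (M \<Otimes>\<^sub>M N) D"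
    and ft: "\<And>s r. (\<integral>w. D w * cis (s * fst w + r * snd w) \<partial>(M \<Otimes>\<^sub>M N)) = 0"
  shows "AE w in M \<Otimes>\<^sub>M N. D w = 0"
proof -
  interpret M: real_distribution M by fact
  interpret N: real_distribution N by fact
  interpret MN: pair_prob_space M N ..
  have [measurable]: "D \<in> borel_measurable (M \<Otimes>\<^sub>M N)" using D by auto
  have intc: "integrable (M \<Otimes>\<^sub>M N) (\<lambda>w. D w * cis (r * snd w))" for r
    by (rule Bochner_Integration.integrable_bound[OF D]) (auto simp: norm_mult)
  have intcc: "integrable (M \<Otimes>\<^sub>M N) (\<lambda>w. D w * cis (s * fst w + r * snd w))" for s r
    by (rule Bochner_Integration.integrable_bound[OF D]) (auto simp: norm_mult)
  have sec: "AE x in M. (\<integral>y. D (x, y) * cis (r * y) \<partial>N) = 0" for r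
  proof (rule complex_density_zero[OF M])
    show "integrable M (\<lambda>x. \<integral>y. D (x, y) * cis (r * y) \<partial>N)"
      using MN.integrable_fst'[OF intc[of r]] by simp
    fix s
    have "(\<integral>x. (\<integral>y. D (x, y) * cis (r * y) \<partial>N) * cis (s * x) \<partial>M)
        = (\<integral>x. \<integral>y. D (x, y) * cis (s * x + r * y) \<partial>N \<partial>M)"
      by (simp add: cis_mult[symmetric] mult_ac flip: Bochner_Integration.integral_mult_right_zero)
    also have "\<dots> = 0" using MN.integral_fst'[OF intcc[of s r]] ft[of s r] by simp
    finally show "(\<integral>x. (\<integral>y. D (x, y) * cis (r * y) \<partial>N) * cis (s * x) \<partial>M) = 0" .
  qed
  have "AE x in M. \<forall>r\<in>\<rat>. (\<integral>y. D (x, y) * cis (r * y) \<partial>N) = 0"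
    using sec by (intro AE_ball_countable[THEN iffD2]) (auto simp: countable_rat)
  moreover have "AE x in M. integrable N (\<lambda>y. D (x, y))" by (rule MN.AE_integrable_fst'[OF D])
  ultimately have "AE x in M. AE y in N. D (x, y) = 0"
    by eventually_elim (rule complex_density_zero[OF N], auto)
  moreover have "{w \<in> space (M \<Otimes>\<^sub>M N). D w = 0} \<in> sets (M \<Otimes>\<^sub>M N)" by measurable
  ultimately show ?thesis by (intro MN.AE_pair_measure)
qed

section \<open>Weak limits and product functions\<close>

text \<open>A norm-bounded sequence that converges weakly against a family of functions also does so
  against every \<open>F\<close> in the closure of that family.\<close>

lemma L2_weak_limit_extend:
  assumes g: "\<And>n. g n \<in> L2 M" "g' \<in> L2 M" and F: "F \<in> L2 M"
    and B: "\<And>n. (\<integral>x. (cmod (g n x))\<^sup>2 \<partial>M) \<le> B" "(\<integral>x. (cmod (g' x))\<^sup>2 \<partial>M) \<le> B"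
    and approx: "\<And>\<epsilon>. \<epsilon> > 0 \<Longrightarrow> \<exists>Q\<in>L2 M. (\<integral>x. (cmod (F x - Q x))\<^sup>2 \<partial>M) < \<epsilon> \<and>
      (\<lambda>n. \<integral>x. Q x * g n x \<partial>M) \<longlonglongrightarrow> (\<integral>x. Q x * g' x \<partial>M)"
  shows "(\<lambda>n. \<integral>x. F x * g n x \<partial>M) \<longlonglongrightarrow> (\<integral>x. F x * g' x \<partial>M)"
proof (rule metric_LIMSEQ_I)
  fix \<epsilon> :: real assume \<epsilon>: "\<epsilon> > 0"
  have "0 \<le> (\<integral>x. (cmod (g' x))\<^sup>2 \<partial>M)" by simp
  then have "B \<ge> 0" using B(2) by linarith
  \<comment> \<open>By Cauchy-Schwarz, \<open>Q\<close> in place of \<open>F\<close> costs less than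
    \<open>\<epsilon> / 3\<close> against every function with squared norm at most \<open>B\<close>;
    the \<open>+ 1\<close> makes the estimate strict and admits \<open>B = 0\<close>.\<close>
  define \<eta> where "\<eta> = (\<epsilon> / 3)\<^sup>2 / (B + 1)"
  have "\<eta> > 0" unfolding \<eta>_def using \<epsilon> \<open>B \<ge> 0\<close> by simp
  from approx[OF this] obtain Q where Q: "Q \<in> L2 M" "(\<integral>x. (cmod (F x - Q x))\<^sup>2 \<partial>M) < \<eta>"
    and lim: "(\<lambda>n. \<integral>x. Q x * g n x \<partial>M) \<longlonglongrightarrow> (\<integral>x. Q x * g' x \<partial>M)" by blast
  have small: "dist (\<integral>x. F x * h x \<partial>M) (\<integral>x. Q x * h x \<partial>M) < \<epsilon> / 3"
    if h: "h \<in> L2 M" "(\<integral>x. (cmod (h x))\<^sup>2 \<partial>M) \<le> B" for h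
  proof -
    have "dist (\<integral>x. F x * h x \<partial>M) (\<integral>x. Q x * h x \<partial>M) = cmod (\<integral>x. (F x - Q x) * h x \<partial>M)"
      using L2_integrable_mult[OF F h(1)] L2_integrable_mult[OF Q(1) h(1)] by (simp add: dist_norm left_diff_distrib)
    moreover have "(cmod (\<integral>x. (F x - Q x) * h x \<partial>M))\<^sup>2 < (\<epsilon> / 3)\<^sup>2"
    proof -
      have "(cmod (\<integral>x. (F x - Q x) * h x \<partial>M))\<^sup>2 \<le> (\<integral>x. (cmod (F x - Q x))\<^sup>2 \<partial>M) * (\<integral>x. (cmod (h x))\<^sup>2 \<partial>M)"
        by (rule L2_cauchy_schwarz_norm[OF L2_diff[OF F Q(1)] h(1)])
      also have "\<dots> \<le> \<eta> * B" using Q(2) h(2) \<open>\<eta> > 0\<close> by (intro mult_mono) auto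
      also have "\<dots> < \<eta> * (B + 1)" using \<open>\<eta> > 0\<close> by simp
      also have "\<dots> = (\<epsilon> / 3)\<^sup>2" unfolding \<eta>_def using \<open>B \<ge> 0\<close> by simp
      finally show ?thesis .
    qed
    then have "cmod (\<integral>x. (F x - Q x) * h x \<partial>M) < \<epsilon> / 3" by (rule power2_less_imp_less) (use \<epsilon> in simp)
    ultimately show ?thesis by simp
  qed
  have "\<epsilon> / 3 > 0" using \<epsilon> by simp
  from metric_LIMSEQ_D[OF lim this] obtain N where
    N: "\<And>n. n \<ge> N \<Longrightarrow> dist (\<integral>x. Q x * g n x \<partial>M) (\<integral>x. Q x * g' x \<partial>M) < \<epsilon> / 3" by blast
  have "dist (\<integral>x. F x * g n x \<partial>M) (\<integral>x. F x * g' x \<partial>M) < \<epsilon>" if "n \<ge> N" for n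
    using N[OF that] small[OF g(1) B(1), of n] small[OF g(2) B(2)]
      dist_triangle[of "\<integral>x. F x * g n x \<partial>M" "\<integral>x. F x * g' x \<partial>M" "\<integral>x. Q x * g n x \<partial>M"]
      dist_triangle3[of "\<integral>x. Q x * g n x \<partial>M" "\<integral>x. F x * g' x \<partial>M" "\<integral>x. Q x * g' x \<partial>M"]
      dist_commute[of "\<integral>x. F x * g' x \<partial>M" "\<integral>x. Q x * g' x \<partial>M"]
      dist_triangle[of "\<integral>x. Q x * g n x \<partial>M" "\<integral>x. F x * g' x \<partial>M" "\<integral>x. Q x * g' x \<partial>M"]
      dist_commute[of "\<integral>x. Q x * g' x \<partial>M" "\<integral>x. F x * g' x \<partial>M"]
    by argo
  then show "\<exists>N. \<forall>n\<ge>N. dist (\<integral>x. F x * g n x \<partial>M) (\<integral>x. F x * g' x \<partial>M) < \<epsilon>" by blast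
qed

lemma pair_integral_mult:
  fixes f :: "'a \<Rightarrow> 'c::{real_normed_field, banach, second_countable_topology}" and g :: "'b \<Rightarrow> 'c"
  assumes "prob_space M" "prob_space N" and f: "integrable M f" and g: "integrable N g"
  shows "integrable (M \<Otimes>\<^sub>M N) (\<lambda>w. f (fst w) * g (snd w))"
    and "(\<integral>w. f (fst w) * g (snd w) \<partial>(M \<Otimes>\<^sub>M N)) = (\<integral>x. f x \<partial>M) * (\<integral>y. g y \<partial>N)"
proof -
  interpret M: prob_space M by fact
  interpret N: prob_space N by fact
  interpret MN: pair_prob_space M N ..
  have [measurable]: "f \<in> borel_measurable M" "g \<in> borel_measurable N" using f g by auto
  show int: "integrable (M \<Otimes>\<^sub>M N) (\<lambda>w. f (fst w) * g (snd w))"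
    by (rule MN.Fubini_integrable) (use f g in \<open>auto simp: norm_mult\<close>)
  show "(\<integral>w. f (fst w) * g (snd w) \<partial>(M \<Otimes>\<^sub>M N)) = (\<integral>x. f x \<partial>M) * (\<integral>y. g y \<partial>N)"
    using MN.integral_fst'[OF int] by simp
qed

lemma L2_pair_mult:
  assumes M: "prob_space M" "prob_space N" and f: "f \<in> L2 M" and g: "g \<in> L2 N"
  shows "(\<lambda>w. f (fst w) * g (snd w)) \<in> L2 (M \<Otimes>\<^sub>M N)"
proof -
  note [measurable] = L2_measurable[OF f] L2_measurable[OF g]
  have "integrable (M \<Otimes>\<^sub>M N) (\<lambda>w. complex_of_real ((cmod (f (fst w)))\<^sup>2) * complex_of_real ((cmod (g (snd w)))\<^sup>2))"
    by (rule pair_integral_mult(1)[OF M]) (use f g in \<open>auto simp: L2_integrable_power2 simp del: of_real_power\<close>)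
  then have "integrable (M \<Otimes>\<^sub>M N) (\<lambda>w. Re (complex_of_real ((cmod (f (fst w)))\<^sup>2) * complex_of_real ((cmod (g (snd w)))\<^sup>2)))"
    by (rule integrable_Re)
  then show ?thesis unfolding L2_def by (simp add: norm_mult power_mult_distrib)
qed

section \<open>Sections of sets of positive measure and the functional equation\<close>

lemma (in prob_space) atomless_uncountable:
  assumes atomless: "\<And>x. measure M {x} = 0" and sets: "\<And>x. {x} \<in> sets M"
    and A: "\<not> (AE x in M. x \<notin> A)"
  shows "uncountable A"
proof
  assume A': "countable A"
  have "(\<Union>x\<in>A. {x}) \<in> null_sets M"
    by (intro null_sets_UN' A') (simp add: null_sets_def sets emeasure_eq_measure atomless)
  then have "AE x in M. x \<notin> A" by (intro AE_not_in) simp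
  with A show False by simp
qed

text \<open>By Tonelli, the measure of \<open>{(x, x', y). (x, y) \<in> E \<and> (x', y) \<in> E}\<close> is the integral over \<open>y\<close>
  of the squared measure of the section of \<open>E\<close> at \<open>y\<close>, hence positive.\<close>

lemma positive_rectangle_pairs:
  assumes M: "prob_space M" and N: "prob_space N" and E: "E \<in> sets (M \<Otimes>\<^sub>M N)"
    and pos: "\<not> (AE w in M \<Otimes>\<^sub>M N. w \<notin> E)"
  obtains x' where "\<not> (AE x in M. AE y in N. \<not> ((x, y) \<in> E \<and> (x', y) \<in> E))"
proof -
  interpret M: prob_space M by fact
  interpret N: prob_space N by fact
  interpret MN: pair_prob_space M N ..
  note E [measurable]
  define f :: "'a \<Rightarrow> 'b \<Rightarrow> ennreal" where "f x y = indicator E (x, y)" for x y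
  have [measurable]: "(\<lambda>w. f (fst w) (snd w)) \<in> borel_measurable (M \<Otimes>\<^sub>M N)" unfolding f_def by measurable
  have fm [measurable]: "(\<lambda>x. f x y) \<in> borel_measurable M" if "y \<in> space N" for y
    using that unfolding f_def by measurable
  have fn [measurable]: "(\<lambda>y. f x y) \<in> borel_measurable N" if "x \<in> space M" for x
    using that unfolding f_def by measurable
  have "\<exists>x'. \<not> (AE x in M. AE y in N. \<not> ((x, y) \<in> E \<and> (x', y) \<in> E))"
  proof (rule ccontr)
    assume neg: "\<not> ?thesis"
    have inner: "(\<integral>\<^sup>+x. \<integral>\<^sup>+y. f x y * f x' y \<partial>N \<partial>M) = 0" if [measurable]: "x' \<in> space M" for x'
    proof -
      have "AE x in M. AE y in N. \<not> ((x, y) \<in> E \<and> (x', y) \<in> E)" using neg by blast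
      then have "AE x in M. AE y in N. f x y * f x' y = 0"
        by (simp add: f_def indicator_def)
      then have "AE x in M. (\<integral>\<^sup>+y. f x y * f x' y \<partial>N) = 0"
        using AE_space
      proof eventually_elim
        case (elim x)
        then have "(\<integral>\<^sup>+y. f x y * f x' y \<partial>N) = (\<integral>\<^sup>+y. 0 \<partial>N)" by (intro nn_integral_cong_AE) auto
        then show ?case by simp
      qed
      then have "(\<integral>\<^sup>+x. \<integral>\<^sup>+y. f x y * f x' y \<partial>N \<partial>M) = (\<integral>\<^sup>+x. 0 \<partial>M)" by (intro nn_integral_cong_AE) auto
      then show ?thesis by simp
    qed
    have "(\<integral>\<^sup>+y. (\<integral>\<^sup>+x. f x y \<partial>M) * (\<integral>\<^sup>+x. f x y \<partial>M) \<partial>N) = (\<integral>\<^sup>+y. \<integral>\<^sup>+x'. (\<integral>\<^sup>+x. f x y \<partial>M) * f x' y \<partial>M \<partial>N)"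
      by (intro nn_integral_cong) (simp add: nn_integral_cmult fm)
    also have "\<dots> = (\<integral>\<^sup>+x'. \<integral>\<^sup>+y. (\<integral>\<^sup>+x. f x y \<partial>M) * f x' y \<partial>N \<partial>M)"
      by (rule MN.Fubini') (unfold f_def, measurable)
    also have "\<dots> = (\<integral>\<^sup>+x'. \<integral>\<^sup>+y. (\<integral>\<^sup>+x. f x y * f x' y \<partial>M) \<partial>N \<partial>M)"
      by (intro nn_integral_cong) (simp add: nn_integral_multc fm)
    also have "\<dots> = (\<integral>\<^sup>+x'. \<integral>\<^sup>+x. (\<integral>\<^sup>+y. f x y * f x' y \<partial>N) \<partial>M \<partial>M)"
      by (intro nn_integral_cong MN.Fubini') (unfold f_def, measurable)
    also have "\<dots> = (\<integral>\<^sup>+x'. 0 \<partial>M)" using inner by (intro nn_integral_cong) auto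
    finally have "(\<integral>\<^sup>+y. (\<integral>\<^sup>+x. f x y \<partial>M) * (\<integral>\<^sup>+x. f x y \<partial>M) \<partial>N) = 0" by simp
    moreover have hm: "(\<lambda>y. \<integral>\<^sup>+x. f x y \<partial>M) \<in> borel_measurable N" unfolding f_def by measurable
    ultimately have "AE y in N. (\<integral>\<^sup>+x. f x y \<partial>M) * (\<integral>\<^sup>+x. f x y \<partial>M) = 0"
      by (subst nn_integral_0_iff_AE[symmetric]) auto
    then have "AE y in N. (\<integral>\<^sup>+x. f x y \<partial>M) = 0" by simp
    then have "(\<integral>\<^sup>+y. (\<integral>\<^sup>+x. f x y \<partial>M) \<partial>N) = (\<integral>\<^sup>+y. 0 \<partial>N)" by (intro nn_integral_cong_AE) auto
    then have "(\<integral>\<^sup>+w. f (fst w) (snd w) \<partial>(M \<Otimes>\<^sub>M N)) = 0"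
      by (subst MN.nn_integral_snd[symmetric]) auto
    then have "AE w in M \<Otimes>\<^sub>M N. f (fst w) (snd w) = 0"
      by (subst (asm) nn_integral_0_iff_AE) auto
    then have "AE w in M \<Otimes>\<^sub>M N. w \<notin> E" by (simp add: f_def indicator_def)
    then show False using pos by simp
  qed
  then show thesis using that by blast
qed

text \<open>Two points \<open>x\<close>, \<open>x'\<close> with uncountably many common
  \<open>y\<close> allow \<open>g y\<close> to be eliminated, which leaves an identity between two
  translates of \<open>char P\<close> on an uncountable set, hence everywhere. It is the
  multiplicativity of \<open>char P\<close> for the single shift \<open>x - x'\<close>. There are
  uncountably many such \<open>x\<close>, so a second continuation, now in the shift, yields it in
  full and \<open>P\<close> would be a Dirac measure.\<close>

lemma separated_char_impossible:
  assumes M: "real_distribution M" "\<And>x. measure M {x} = 0"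
    and N: "real_distribution N" "\<And>x. measure N {x} = 0"
    and P: "real_distribution P" "real_analytic (char P)" "\<And>x. P \<noteq> return borel x"
    and c: "c \<noteq> 0" and E: "E \<in> sets (M \<Otimes>\<^sub>M N)"
    and eq: "\<And>x y. (x, y) \<in> E \<Longrightarrow> f x * g y = c * char P (x + y)"
  shows "AE w in M \<Otimes>\<^sub>M N. w \<notin> E"
proof (rule ccontr)
  assume pos: "\<not> (AE w in M \<Otimes>\<^sub>M N. w \<notin> E)"
  interpret M: real_distribution M by fact
  interpret N: real_distribution N by fact
  interpret P: real_distribution P by fact
  obtain x' where x': "\<not> (AE x in M. AE y in N. \<not> ((x, y) \<in> E \<and> (x', y) \<in> E))"
    by (rule positive_rectangle_pairs[OF M.prob_space_axioms N.prob_space_axioms E pos])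
  define A where "A = {x. \<not> (AE y in N. \<not> ((x, y) \<in> E \<and> (x', y) \<in> E))}"
  have "uncountable A"
    by (rule M.atomless_uncountable[OF M(2)]) (use x' in \<open>auto simp: A_def\<close>)
  \<comment> \<open>No translate of \<open>char P\<close> vanishes identically, as
    \<open>char P 0 = 1\<close>.\<close>
  have zeros: "countable {y. char P (z + y) = 0}" for z
  proof (rule ccontr)
    assume "uncountable {y. char P (z + y) = 0}"
    moreover have "real_analytic (\<lambda>y. char P (z + y))"
      using real_analytic_linear_combination[OF P(2), of 1 z 0 0] by simp
    ultimately have "char P (z + (- z)) = 0" by (rule real_analytic_uncountable_zeros[rotated])
    then show False using P.char_zero by simp
  qed
  have mult: "char P (x - x' + y) = char P (x - x') * char P y" if x: "x \<in> A" for x y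
  proof -
    define Y where "Y = {y. (x, y) \<in> E \<and> (x', y) \<in> E}"
    have Y: "uncountable Y"
      by (rule N.atomless_uncountable[OF N(2)]) (use x in \<open>auto simp: A_def Y_def\<close>)
    have "f x' * char P (x + y) - f x * char P (x' + y) = 0" if "y \<in> Y" for y
    proof -
      have "f x * g y = c * char P (x + y)" "f x' * g y = c * char P (x' + y)"
        using that eq unfolding Y_def by auto
      then have "c * (f x' * char P (x + y) - f x * char P (x' + y)) = f x' * (f x * g y) - f x * (f x' * g y)"
        by (simp add: algebra_simps)
      also have "\<dots> = 0" by simp
      finally show ?thesis using c by simp
    qed
    then have "Y \<subseteq> {y. f x' * char P (x + y) - f x * char P (x' + y) = 0}" by blast
    then have "uncountable {y. f x' * char P (x + y) - f x * char P (x' + y) = 0}"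
      using Y countable_subset by blast
    from real_analytic_uncountable_zeros[OF real_analytic_linear_combination[OF P(2)] this]
    have all: "f x' * char P (x + y) = f x * char P (x' + y)" for y by simp
    \<comment> \<open>\<open>Y\<close> is too large to consist of zeros of the translate, so the
      equation at some \<open>y0\<close> has a nonzero right-hand side and \<open>f x'\<close> can
      be cancelled.\<close>
    have "\<not> Y \<subseteq> {y. char P (x' + y) = 0}" using Y zeros[of x'] countable_subset by blast
    then obtain y0 where "y0 \<in> Y" "char P (x' + y0) \<noteq> 0" by blast
    then have "f x' * g y0 \<noteq> 0" using eq[of x' y0] c unfolding Y_def by auto
    then have fx': "f x' \<noteq> 0" by auto
    have shift: "f x' * char P (x - x' + y) = f x * char P y" for y
      using all[of "y - x'"] by (simp add: algebra_simps)
    have "f x' * char P (x - x') = f x" using shift[of 0] P.char_zero by simp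
    then have "f x' * char P (x - x' + y) = f x' * (char P (x - x') * char P y)"
      using shift[of y] by (metis mult.assoc)
    then show ?thesis using fx' by simp
  qed
  \<comment> \<open>Second analytic continuation: \<open>y\<close> is fixed and the shift
    \<open>p\<close> varies, starting from the uncountable set of differences
    \<open>x - x'\<close>.\<close>
  have "char P (p + y) = char P p * char P y" for p y
  proof -
    have "uncountable ((\<lambda>x. x - x') ` A)"
      using \<open>uncountable A\<close> countable_image_inj_eq[of "\<lambda>x. x - x'" A] by (simp add: inj_on_def)
    moreover have "(\<lambda>x. x - x') ` A \<subseteq> {p. 1 * char P (y + p) - char P y * char P (0 + p) = 0}"
      using mult by (auto simp: algebra_simps)
    ultimately have "uncountable {p. 1 * char P (y + p) - char P y * char P (0 + p) = 0}"
      using countable_subset by blast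
    from real_analytic_uncountable_zeros[OF real_analytic_linear_combination[OF P(2)] this, of p]
    show ?thesis by (simp add: algebra_simps)
  qed
  from multiplicative_char_imp_return[OF P(1) this] P(3) show False by blast
qed

text \<open>The bound makes \<open>l\<close> a functional on combinations of characters, represented
  by a density \<open>F\<close>. Shifting both arguments by \<open>u n\<close> multiplies
  \<open>F\<close> by a character whose weak limit is a product \<open>\<phi>\<close>, while
  \<open>lim\<close> gives the factor \<open>c * G\<close> with
  \<open>G w = char P (fst w + snd w)\<close>. Equal Fourier coefficients force
  \<open>F * (\<phi> - c * G) = 0\<close>; as \<open>\<phi>\<close> and \<open>c * G\<close> cannot
  agree on a set of positive measure, \<open>F\<close> vanishes, and with it its integral
  \<open>l 0 0\<close>.\<close>

lemma joint_functional_zero: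
  fixes l :: "real \<Rightarrow> real \<Rightarrow> complex" and u :: "nat \<Rightarrow> real"
  assumes M: "real_distribution M" "\<And>x. measure M {x} = 0"
    and N: "real_distribution N" "\<And>x. measure N {x} = 0"
    and P: "real_distribution P" "real_analytic (char P)" "\<And>x. P \<noteq> return borel x"
    and c: "c \<noteq> 0"
    and bound: "\<And>K a. finite K \<Longrightarrow> (cmod (\<Sum>k\<in>K. a k * l (fst k) (snd k)))\<^sup>2
        \<le> (\<integral>w. (cmod (\<Sum>k\<in>K. a k * cis (fst k * fst w + snd k * snd w)))\<^sup>2 \<partial>(M \<Otimes>\<^sub>M N))"
    and lim: "\<And>s r. (\<lambda>n. l (u n + s) (u n + r)) \<longlonglongrightarrow> c * (CLINT t|P. l (t + s) (t + r))"
  shows "l 0 0 = 0"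
proof -
  interpret M: real_distribution M by fact
  interpret N: real_distribution N by fact
  interpret P: real_distribution P by fact
  interpret MN: pair_prob_space M N ..
  interpret PMN: pair_prob_space P "M \<Otimes>\<^sub>M N" ..
  define e where "e k w = cis (fst k * fst w + snd k * snd w)" for k w :: "real \<times> real"
  have em [measurable]: "e k \<in> borel_measurable (M \<Otimes>\<^sub>M N)" for k unfolding e_def by measurable
  have eL2: "e k \<in> L2 (M \<Otimes>\<^sub>M N)" for k
    by (rule MN.P.L2_bounded[OF em, of _ 1]) (simp add: e_def)
  have e_add: "e (s + s', r + r') w = e (s, r) w * e (s', r') w" for s s' r r' w
    by (simp add: e_def cis_mult algebra_simps)
  have cnj_e: "cnj (e (s, r) w) = e (- s, - r) w" for s r w
    by (simp add: e_def cis_cnj)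
  obtain F where F: "F \<in> L2 (M \<Otimes>\<^sub>M N)"
    and Fl: "\<And>k. (\<integral>w. F w * e k w \<partial>(M \<Otimes>\<^sub>M N)) = l (fst k) (snd k)"
    and Fapprox: "\<And>\<epsilon>. \<epsilon> > 0 \<Longrightarrow> \<exists>K a. finite K \<and>
      (\<integral>w. (cmod (F w - cnj (\<Sum>k\<in>K. a k * e k w)))\<^sup>2 \<partial>(M \<Otimes>\<^sub>M N)) < \<epsilon>"
    by (rule L2_riesz[of e "M \<Otimes>\<^sub>M N" "\<lambda>k. l (fst k) (snd k)", OF eL2])
      (use bound in \<open>auto simp: e_def\<close>)
  have [measurable]: "F \<in> borel_measurable (M \<Otimes>\<^sub>M N)" using F by (rule L2_measurable)
  \<comment> \<open>The characters \<open>cis (v n * x)\<close> have norm 1, so the functional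
    defined by their limiting coefficients \<open>\<psi>\<close> is bounded by 1 and is represented
    by a function \<open>\<phi>\<close>, their weak limit.\<close>
  have weak: "\<exists>\<phi>\<in>L2 R. \<forall>s. (CLINT x|R. \<phi> x * cis (s * x)) = \<psi> s"
    if R: "real_distribution R" and \<psi>: "\<And>s. (\<lambda>n. char R (v n + s)) \<longlonglongrightarrow> \<psi> s" for R v \<psi>
  proof -
    interpret R: real_distribution R by fact
    have L: "(\<lambda>x. cis (s * x)) \<in> L2 R" for s by (rule R.L2_bounded[of _ 1]) auto
    obtain \<phi> where "\<phi> \<in> L2 R" "\<And>s. (CLINT x|R. \<phi> x * cis (s * x)) = \<psi> s"
    proof (rule L2_riesz[of "\<lambda>s x. cis (s * x)" R \<psi>, OF L])
      fix K :: "real set" and a :: "real \<Rightarrow> complex" assume K: "finite K"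
      have KL: "(\<lambda>x. \<Sum>s\<in>K. a s * cis (s * x)) \<in> L2 R" by (intro L2_sum L2_scale L)
      have "(\<Sum>s\<in>K. a s * char R (v n + s)) = (CLINT x|R. cis (v n * x) * (\<Sum>s\<in>K. a s * cis (s * x)))" for n
      proof -
        have "cis (v n * x) * (a s * cis (s * x)) = a s * cis ((v n + s) * x)" for x s
          by (simp add: cis_mult[symmetric] distrib_right)
        then have "(\<lambda>x. cis (v n * x) * (\<Sum>s\<in>K. a s * cis (s * x))) = (\<lambda>x. \<Sum>s\<in>K. a s * cis ((v n + s) * x))"
          unfolding sum_distrib_left by (simp only:)
        then show ?thesis
          unfolding R.char_eq_cis by (simp add: Bochner_Integration.integral_sum R.integrable_cis)
      qed
      then have "(cmod (\<Sum>s\<in>K. a s * char R (v n + s)))\<^sup>2 \<le> (\<integral>x. (cmod (\<Sum>s\<in>K. a s * cis (s * x)))\<^sup>2 \<partial>R)" for n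
        using L2_cauchy_schwarz_norm[OF L[of "v n"] KL] R.prob_space by simp
      moreover have "(\<lambda>n. (cmod (\<Sum>s\<in>K. a s * char R (v n + s)))\<^sup>2) \<longlonglongrightarrow> (cmod (\<Sum>s\<in>K. a s * \<psi> s))\<^sup>2"
        by (intro tendsto_intros \<psi>)
      ultimately show "(cmod (\<Sum>s\<in>K. a s * \<psi> s))\<^sup>2 \<le> (\<integral>x. (cmod (\<Sum>s\<in>K. a s * cis (s * x)))\<^sup>2 \<partial>R)"
        by (intro LIMSEQ_le_const2) auto
    qed auto
    then show ?thesis by blast
  qed
  obtain \<rho>1 \<psi>1 where \<rho>1: "strict_mono (\<rho>1 :: nat \<Rightarrow> nat)" "\<And>s. (\<lambda>n. char M (u (\<rho>1 n) + s)) \<longlonglongrightarrow> \<psi>1 s"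
    using M.char_convergent_subsequence[of u] by metis
  \<comment> \<open>The second subsequence is taken inside the first, so that both marginals
    converge along the same times.\<close>
  obtain \<rho>2 \<psi>2 where \<rho>2: "strict_mono (\<rho>2 :: nat \<Rightarrow> nat)" "\<And>s. (\<lambda>n. char N (u (\<rho>1 (\<rho>2 n)) + s)) \<longlonglongrightarrow> \<psi>2 s"
    using N.char_convergent_subsequence[of "\<lambda>n. u (\<rho>1 n)"] by metis
  define v where "v n = u (\<rho>1 (\<rho>2 n))" for n
  have v1: "(\<lambda>n. char M (v n + s)) \<longlonglongrightarrow> \<psi>1 s" for s
    using LIMSEQ_subseq_LIMSEQ[OF \<rho>1(2) \<rho>2(1), of s] unfolding v_def comp_def .
  have v2: "(\<lambda>n. char N (v n + s)) \<longlonglongrightarrow> \<psi>2 s" for s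
    using \<rho>2(2)[of s] unfolding v_def .
  obtain \<phi>1 where \<phi>1: "\<phi>1 \<in> L2 M" "\<And>s. (CLINT x|M. \<phi>1 x * cis (s * x)) = \<psi>1 s"
    using weak[OF M(1) v1] by blast
  obtain \<phi>2 where \<phi>2: "\<phi>2 \<in> L2 N" "\<And>s. (CLINT x|N. \<phi>2 x * cis (s * x)) = \<psi>2 s"
    using weak[OF N(1) v2] by blast
  note [measurable] = L2_measurable[OF \<phi>1(1)] L2_measurable[OF \<phi>2(1)]
  define \<phi> where "\<phi> w = \<phi>1 (fst w) * \<phi>2 (snd w)" for w
  have \<phi>: "\<phi> \<in> L2 (M \<Otimes>\<^sub>M N)" unfolding \<phi>_def
    by (rule L2_pair_mult[OF M.prob_space_axioms N.prob_space_axioms \<phi>1(1) \<phi>2(1)])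
  have \<phi>e: "(\<lambda>w. \<phi> w * e k w) \<in> L2 (M \<Otimes>\<^sub>M N)" for k
    using \<phi> unfolding L2_def by (auto simp: norm_mult e_def)
  have e_int: "(\<integral>w. e (s, r) w \<partial>(M \<Otimes>\<^sub>M N)) = char M s * char N r" for s r
    using pair_integral_mult(2)[OF M.prob_space_axioms N.prob_space_axioms, of "\<lambda>x. cis (s * x)" "\<lambda>x. cis (r * x)"]
    by (simp add: e_def cis_mult M.char_eq_cis N.char_eq_cis M.integrable_cis N.integrable_cis)
  have \<phi>_int: "(\<integral>w. \<phi> w * e (s, r) w \<partial>(M \<Otimes>\<^sub>M N)) = \<psi>1 s * \<psi>2 r" for s r
  proof -
    have L: "(\<lambda>x. cis (s * x)) \<in> L2 M" "(\<lambda>x. cis (r * x)) \<in> L2 N"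
      by (rule M.L2_bounded[of _ 1] N.L2_bounded[of _ 1]; simp)+
    have "(\<integral>w. \<phi> w * e (s, r) w \<partial>(M \<Otimes>\<^sub>M N))
      = (\<integral>w. (\<phi>1 (fst w) * cis (s * fst w)) * (\<phi>2 (snd w) * cis (r * snd w)) \<partial>(M \<Otimes>\<^sub>M N))"
      by (simp add: \<phi>_def e_def cis_mult[symmetric] mult_ac)
    also have "\<dots> = \<psi>1 s * \<psi>2 r"
      using pair_integral_mult(2)[OF M.prob_space_axioms N.prob_space_axioms
          L2_integrable_mult[OF \<phi>1(1) L(1)] L2_integrable_mult[OF \<phi>2(1) L(2)]] \<phi>1(2) \<phi>2(2) by simp
    finally show ?thesis .
  qed
  \<comment> \<open>Against finite combinations of characters the integrals over the product measure
    split into products of values of \<open>char M\<close> and \<open>char N\<close>, each with a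
    known limit; \<open>Fapprox\<close> carries the convergence over to \<open>F\<close>.\<close>
  have lim1: "(\<lambda>n. \<integral>w. F w * e (v n + s, v n + r) w \<partial>(M \<Otimes>\<^sub>M N)) \<longlonglongrightarrow> (\<integral>w. F w * (\<phi> w * e (s, r) w) \<partial>(M \<Otimes>\<^sub>M N))" for s r
  proof (rule L2_weak_limit_extend[OF eL2 \<phi>e F, where B="max 1 (\<integral>w. (cmod (\<phi> w * e (s, r) w))\<^sup>2 \<partial>(M \<Otimes>\<^sub>M N))"])
    show "(\<integral>w. (cmod (e (v n + s, v n + r) w))\<^sup>2 \<partial>(M \<Otimes>\<^sub>M N)) \<le> max 1 (\<integral>w. (cmod (\<phi> w * e (s, r) w))\<^sup>2 \<partial>(M \<Otimes>\<^sub>M N))" for n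
      using MN.P.prob_space by (simp add: e_def)
    fix \<epsilon> :: real assume "\<epsilon> > 0"
    from Fapprox[OF this] obtain K a where K: "finite K"
      "(\<integral>w. (cmod (F w - cnj (\<Sum>k\<in>K. a k * e k w)))\<^sup>2 \<partial>(M \<Otimes>\<^sub>M N)) < \<epsilon>" by blast
    define Q where "Q w = cnj (\<Sum>k\<in>K. a k * e k w)" for w
    have Q: "Q \<in> L2 (M \<Otimes>\<^sub>M N)" unfolding Q_def by (intro L2_cnj L2_sum L2_scale eL2)
    have Q_sum: "Q w * h = (\<Sum>k\<in>K. cnj (a k) * (h * e (- fst k, - snd k) w))" for w h
      unfolding Q_def
      by (simp add: sum_distrib_right sum_distrib_left cnj_e[symmetric] mult_ac)
    have *: "(\<integral>w. Q w * (h w * e (s, r) w) \<partial>(M \<Otimes>\<^sub>M N))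
        = (\<Sum>k\<in>K. cnj (a k) * (\<integral>w. h w * e (s - fst k, r - snd k) w \<partial>(M \<Otimes>\<^sub>M N)))"
      if h: "h \<in> L2 (M \<Otimes>\<^sub>M N)" for h s r
    proof -
      have ek: "e (s - fst k, r - snd k) w = e (s, r) w * e (- fst k, - snd k) w" for k w
        using e_add[of s "- fst k" r "- snd k" w] by simp
      have "Q w * (h w * e (s, r) w) = (\<Sum>k\<in>K. cnj (a k) * (h w * e (s - fst k, r - snd k) w))" for w
        unfolding Q_sum ek by (simp add: mult_ac)
      then show ?thesis
        using L2_integrable_mult[OF h eL2] by (simp add: Bochner_Integration.integral_sum)
    qed
    have "(\<lambda>w. 1) \<in> L2 (M \<Otimes>\<^sub>M N)" by (rule MN.P.L2_bounded[of _ 1]) auto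
    from *[OF this] have Q1: "(\<integral>w. Q w * e (s, r) w \<partial>(M \<Otimes>\<^sub>M N))
        = (\<Sum>k\<in>K. cnj (a k) * (char M (s - fst k) * char N (r - snd k)))" for s r
      by (simp add: e_int)
    have "(\<lambda>n. \<integral>w. Q w * e (v n + s, v n + r) w \<partial>(M \<Otimes>\<^sub>M N)) \<longlonglongrightarrow> (\<integral>w. Q w * (\<phi> w * e (s, r) w) \<partial>(M \<Otimes>\<^sub>M N))"
      unfolding Q1 *[OF \<phi>] \<phi>_int
      using v1[of "s - fst _"] v2[of "r - snd _"] by (intro tendsto_intros) (simp_all add: add_diff_eq)
    then show "\<exists>Q\<in>L2 (M \<Otimes>\<^sub>M N). (\<integral>w. (cmod (F w - Q w))\<^sup>2 \<partial>(M \<Otimes>\<^sub>M N)) < \<epsilon> \<and>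
      (\<lambda>n. \<integral>w. Q w * e (v n + s, v n + r) w \<partial>(M \<Otimes>\<^sub>M N)) \<longlonglongrightarrow> (\<integral>w. Q w * (\<phi> w * e (s, r) w) \<partial>(M \<Otimes>\<^sub>M N))"
      using Q K(2) unfolding Q_def[symmetric] by blast
  qed simp
  have F1: "integrable (M \<Otimes>\<^sub>M N) F"
    using L2_integrable_mult[OF F eL2[of "(0, 0)"]] by (simp add: e_def)
  define G where "G w = char P (fst w + snd w)" for w
  have [measurable]: "G \<in> borel_measurable (M \<Otimes>\<^sub>M N)" unfolding G_def by measurable
  \<comment> \<open>Under the common shift \<open>t\<close> the character gains the factor
    \<open>cis ((fst w + snd w) * t)\<close>, and by Fubini its integral over \<open>t\<close> is
    \<open>G w\<close>.\<close>
  have lim2: "(CLINT t|P. l (t + s) (t + r)) = (\<integral>w. F w * (G w * e (s, r) w) \<partial>(M \<Otimes>\<^sub>M N))" for s r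
  proof -
    have "integrable (P \<Otimes>\<^sub>M (M \<Otimes>\<^sub>M N)) (\<lambda>z. 1 * F (snd z))"
      by (rule pair_integral_mult(1)[OF P.prob_space_axioms MN.P.prob_space_axioms _ F1]) simp
    then have int: "integrable (P \<Otimes>\<^sub>M (M \<Otimes>\<^sub>M N)) (\<lambda>z. F (snd z) * e (fst z + s, fst z + r) (snd z))"
      by (rule Bochner_Integration.integrable_bound) (auto simp: norm_mult e_def)
    have "(CLINT t|P. l (t + s) (t + r)) = (\<integral>t. \<integral>w. F w * e (t + s, t + r) w \<partial>(M \<Otimes>\<^sub>M N) \<partial>P)"
      using Fl[of "(_ + s, _ + r)"] by simp
    also have "\<dots> = (\<integral>w. \<integral>t. F w * e (t + s, t + r) w \<partial>P \<partial>(M \<Otimes>\<^sub>M N))"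
      using int by (subst PMN.Fubini_integral) (auto simp: case_prod_beta')
    also have "\<dots> = (\<integral>w. F w * (G w * e (s, r) w) \<partial>(M \<Otimes>\<^sub>M N))"
    proof (rule Bochner_Integration.integral_cong[OF refl])
      fix w
      have "e (t + s, t + r) w = e (s, r) w * cis ((fst w + snd w) * t)" for t
        by (simp add: e_def cis_mult algebra_simps)
      then show "(\<integral>t. F w * e (t + s, t + r) w \<partial>P) = F w * (G w * e (s, r) w)"
        by (simp only: G_def P.char_eq_cis Bochner_Integration.integral_mult_right_zero) (simp add: mult_ac)
    qed
    finally show ?thesis .
  qed
  have eq: "(\<integral>w. F w * (\<phi> w * e (s, r) w) \<partial>(M \<Otimes>\<^sub>M N)) = c * (\<integral>w. F w * (G w * e (s, r) w) \<partial>(M \<Otimes>\<^sub>M N))" for s r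
  proof (rule LIMSEQ_unique[OF lim1])
    have "(\<lambda>n. l (v n + s) (v n + r)) \<longlonglongrightarrow> c * (CLINT t|P. l (t + s) (t + r))"
      using LIMSEQ_subseq_LIMSEQ[OF LIMSEQ_subseq_LIMSEQ[OF lim \<rho>1(1)] \<rho>2(1)] unfolding v_def comp_def .
    then show "(\<lambda>n. \<integral>w. F w * e (v n + s, v n + r) w \<partial>(M \<Otimes>\<^sub>M N)) \<longlonglongrightarrow> c * (\<integral>w. F w * (G w * e (s, r) w) \<partial>(M \<Otimes>\<^sub>M N))"
      unfolding Fl lim2 by simp
  qed
  have GL2: "G \<in> L2 (M \<Otimes>\<^sub>M N)"
    by (rule MN.P.L2_bounded[of _ 1]) (auto simp: G_def P.cmod_char_le_1)
  have Ge: "(\<lambda>w. G w * e k w) \<in> L2 (M \<Otimes>\<^sub>M N)" for k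
    using GL2 unfolding L2_def by (auto simp: norm_mult e_def)
  have ae1: "AE w in M \<Otimes>\<^sub>M N. F w * (\<phi> w - c * G w) = 0"
  proof (rule complex_density_zero_pair[OF M(1) N(1)])
    show "integrable (M \<Otimes>\<^sub>M N) (\<lambda>w. F w * (\<phi> w - c * G w))"
      by (intro L2_integrable_mult F L2_diff L2_scale \<phi> GL2)
    fix s r
    have "(\<integral>w. F w * (\<phi> w - c * G w) * cis (s * fst w + r * snd w) \<partial>(M \<Otimes>\<^sub>M N))
       = (\<integral>w. F w * (\<phi> w * e (s, r) w) - c * (F w * (G w * e (s, r) w)) \<partial>(M \<Otimes>\<^sub>M N))"
      by (simp add: e_def algebra_simps)
    also have "\<dots> = 0"
      using L2_integrable_mult[OF F \<phi>e] L2_integrable_mult[OF F Ge] eq[of s r] by simp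
    finally show "(\<integral>w. F w * (\<phi> w - c * G w) * cis (s * fst w + r * snd w) \<partial>(M \<Otimes>\<^sub>M N)) = 0" .
  qed
  \<comment> \<open>On \<open>E\<close> the separated function \<open>\<phi>\<close> coincides with
    a function of \<open>x + y\<close>; outside \<open>E\<close> the density \<open>F\<close> is
    zero almost everywhere.\<close>
  define E where "E = {w \<in> space (M \<Otimes>\<^sub>M N). F w \<noteq> 0 \<and> \<phi> w = c * G w}"
  have ae2: "AE w in M \<Otimes>\<^sub>M N. w \<notin> E"
  proof (rule separated_char_impossible[OF M N P c, where f=\<phi>1 and g=\<phi>2])
    have [measurable]: "\<phi> \<in> borel_measurable (M \<Otimes>\<^sub>M N)" using \<phi> by (rule L2_measurable)
    show "E \<in> sets (M \<Otimes>\<^sub>M N)" unfolding E_def by measurable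
  qed (auto simp: E_def \<phi>_def G_def)
  have "AE w in M \<Otimes>\<^sub>M N. F w = 0"
    using ae1 ae2 AE_space by eventually_elim (auto simp: E_def)
  then have "(\<integral>w. F w * e (0, 0) w \<partial>(M \<Otimes>\<^sub>M N)) = (\<integral>w. 0 \<partial>(M \<Otimes>\<^sub>M N))"
    by (intro integral_cong_AE) auto
  then show ?thesis using Fl[of "(0, 0)"] by simp
qed

section \<open>Convex averages over translates\<close>

text \<open>Finitely supported probability measures on the time axis as lists of pairs (weight,
  time). Times may repeat, so mixing, shifting and convolving are plain list operations.\<close>

definition convex_weights :: "(real \<times> real) list \<Rightarrow> bool" where
  "convex_weights ws \<longleftrightarrow> (\<forall>p\<in>set ws. 0 \<le> fst p) \<and> (\<Sum>p\<leftarrow>ws. fst p) = 1"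

definition average :: "(real \<times> real) list \<Rightarrow> (real \<Rightarrow> 'b::real_vector) \<Rightarrow> 'b" where
  "average ws f = (\<Sum>p\<leftarrow>ws. fst p *\<^sub>R f (snd p))"

text \<open>Convex combinations of translates replace time averages: no measurability in time is needed,
  and the uniformity in the shift \<open>s\<close> allows averages for two functions to be combined.\<close>

definition averages_to_zero :: "(real \<Rightarrow> real) \<Rightarrow> bool" where
  "averages_to_zero a \<longleftrightarrow> (\<forall>\<epsilon>>0. \<exists>ws. convex_weights ws \<and> (\<forall>s. average ws (\<lambda>t. a (t + s)) < \<epsilon>))"

lemma average_simps [simp]:
  "average [] f = 0" "average (p # ws) f = fst p *\<^sub>R f (snd p) + average ws f"
  "average (ws @ vs) f = average ws f + average vs f"
  by (simp_all add: average_def)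

lemma average_const: "convex_weights ws \<Longrightarrow> average ws (\<lambda>_. c) = c"
proof -
  have "average ws (\<lambda>_. c) = (\<Sum>p\<leftarrow>ws. fst p) *\<^sub>R c"
    by (induction ws) (auto simp: scaleR_add_left)
  then show "convex_weights ws \<Longrightarrow> average ws (\<lambda>_. c) = c" by (simp add: convex_weights_def)
qed

lemma average_mult_right: "average ws (\<lambda>t. c * f t) = c * average ws f"
  for f :: "real \<Rightarrow> 'b::real_algebra"
  by (induction ws) (auto simp: distrib_left)

lemma average_mult_left: "average ws (\<lambda>t. f t * c) = average ws f * c"
  for f :: "real \<Rightarrow> 'b::real_algebra"
  by (induction ws) (auto simp: distrib_right)

lemma average_add: "average ws (\<lambda>t. f t + g t) = average ws f + average ws g"
  by (induction ws) (auto simp: scaleR_add_right)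

lemma average_cnj: "average ws (\<lambda>t. cnj (f t)) = cnj (average ws f)"
  by (induction ws) (auto simp: scaleR_conv_of_real)

lemma convex_weights_nonneg: "convex_weights ws \<Longrightarrow> p \<in> set ws \<Longrightarrow> 0 \<le> fst p"
  by (simp add: convex_weights_def)

lemma average_mono_aux:
  fixes f g :: "real \<Rightarrow> real"
  assumes "\<And>p. p \<in> set ws \<Longrightarrow> 0 \<le> fst p" "\<And>t. f t \<le> g t"
  shows "average ws f \<le> average ws g"
  using assms(1) by (induction ws) (auto intro!: add_mono mult_left_mono assms(2))

lemma average_mono:
  fixes f g :: "real \<Rightarrow> real"
  assumes "convex_weights ws" "\<And>t. f t \<le> g t"
  shows "average ws f \<le> average ws g"
  by (rule average_mono_aux[OF convex_weights_nonneg[OF assms(1)] assms(2)])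

lemma average_le_const:
  fixes f :: "real \<Rightarrow> real"
  assumes "convex_weights ws" "\<And>t. f t \<le> c"
  shows "average ws f \<le> c"
  using average_mono[OF assms] average_const[OF assms(1), of c] by simp

lemma norm_average_le:
  fixes f :: "real \<Rightarrow> 'b::real_normed_vector"
  assumes "convex_weights ws"
  shows "norm (average ws f) \<le> average ws (\<lambda>t. norm (f t))"
proof -
  have "\<forall>p\<in>set ws. 0 \<le> fst p" using assms by (simp add: convex_weights_def)
  then show ?thesis
    by (induction ws) (auto intro!: order_trans[OF norm_triangle_ineq])
qed

lemma average_integrable:
  fixes f :: "real \<Rightarrow> 'a \<Rightarrow> 'b::{banach, second_countable_topology}"
  assumes "\<And>t. integrable M (f t)"
  shows "integrable M (\<lambda>x. average ws (\<lambda>t. f t x))"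
  using assms by (induction ws) auto

lemma average_integral:
  fixes f :: "real \<Rightarrow> 'a \<Rightarrow> 'b::{banach, second_countable_topology}"
  assumes "\<And>t. integrable M (f t)"
  shows "(\<integral>x. average ws (\<lambda>t. f t x) \<partial>M) = average ws (\<lambda>t. \<integral>x. f t x \<partial>M)"
  using assms by (induction ws) (auto simp: average_integrable)

lemma average_measurable [measurable]:
  fixes f :: "real \<Rightarrow> 'a \<Rightarrow> 'b::{banach, second_countable_topology}"
  assumes "\<And>t. f t \<in> borel_measurable M"
  shows "(\<lambda>x. average ws (\<lambda>t. f t x)) \<in> borel_measurable M"
  using assms by (induction ws) auto

text \<open>Half of each measure. It makes the set of averages closed under midpoints, as
  \<open>L2_minimizer\<close> requires.\<close>

definition midpoint_weights :: "(real \<times> real) list \<Rightarrow> (real \<times> real) list \<Rightarrow> (real \<times> real) list" where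
  "midpoint_weights ws vs = map (map_prod (\<lambda>w. w / 2) id) (ws @ vs)"

lemma average_midpoint: "average (midpoint_weights ws vs) f = (1/2) *\<^sub>R (average ws f + average vs f)"
proof -
  have "average (map (map_prod (\<lambda>w. w / 2) id) ws) f = (1/2) *\<^sub>R average ws f" for ws
    by (induction ws) (auto simp: scaleR_add_right)
  then show ?thesis unfolding midpoint_weights_def by (simp add: scaleR_add_right)
qed

lemma convex_weights_average: "convex_weights ws \<longleftrightarrow> (\<forall>p\<in>set ws. 0 \<le> fst p) \<and> average ws (\<lambda>_. 1 :: real) = 1"
  by (simp add: convex_weights_def average_def)

lemma convex_weights_midpoint:
  "convex_weights ws \<Longrightarrow> convex_weights vs \<Longrightarrow> convex_weights (midpoint_weights ws vs)"
  unfolding convex_weights_average average_midpoint by (auto simp: midpoint_weights_def)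

definition shift_weights :: "real \<Rightarrow> (real \<times> real) list \<Rightarrow> (real \<times> real) list" where
  "shift_weights s ws = map (\<lambda>p. (fst p, snd p + s)) ws"

lemma average_shift: "average (shift_weights s ws) f = average ws (\<lambda>t. f (t + s))"
  unfolding shift_weights_def by (induction ws) auto

lemma convex_weights_shift: "convex_weights ws \<Longrightarrow> convex_weights (shift_weights s ws)"
  unfolding convex_weights_average average_shift by (auto simp: shift_weights_def)

text \<open>The law of the sum of two independent times, one distributed by \<open>ws\<close>, the
  other by \<open>vs\<close>.\<close>

definition convolve_weights :: "(real \<times> real) list \<Rightarrow> (real \<times> real) list \<Rightarrow> (real \<times> real) list" where
  "convolve_weights ws vs = concat (map (\<lambda>p. map (\<lambda>q. (fst p * fst q, snd p + snd q)) vs) ws)"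

lemma average_convolve: "average (convolve_weights ws vs) f = average ws (\<lambda>t. average vs (\<lambda>u. f (t + u)))"
proof -
  have inner: "average (map (\<lambda>q. (w * fst q, t + snd q)) vs) f = w *\<^sub>R average vs (\<lambda>u. f (t + u))" for w t
    by (induction vs) (auto simp: scaleR_add_right)
  show ?thesis unfolding convolve_weights_def by (induction ws) (auto simp: inner)
qed

lemma convex_weights_convolve:
  assumes "convex_weights ws" "convex_weights vs"
  shows "convex_weights (convolve_weights ws vs)"
  using assms average_const[OF assms(1), of "1 :: real"] average_const[OF assms(2), of "1 :: real"]
  unfolding convex_weights_average average_convolve by (auto simp: convolve_weights_def)

lemma averages_to_zero_le:
  assumes "averages_to_zero a" "\<And>t. b t \<le> a t"
  shows "averages_to_zero b"
  unfolding averages_to_zero_def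
  using assms(1)[unfolded averages_to_zero_def] average_mono[of _ "\<lambda>t. b (t + _)" "\<lambda>t. a (t + _)"] assms(2)
  by (meson order.strict_trans1)

text \<open>Convolved weights average with \<open>ws\<close> and with \<open>vs\<close> in either
  order. Because smallness is uniform in the shift, the inner average can be chosen small for
  \<open>a\<close> or for \<open>b\<close>, and the outer one preserves the bound.\<close>

lemma averages_to_zero_add:
  assumes a: "averages_to_zero a" and b: "averages_to_zero b"
  shows "averages_to_zero (\<lambda>t. a t + b t)"
  unfolding averages_to_zero_def
proof (intro allI impI)
  fix \<epsilon> :: real assume "\<epsilon> > 0"
  then have "\<epsilon> / 2 > 0" by simp
  then obtain ws vs where ws: "convex_weights ws" "\<And>s. average ws (\<lambda>t. a (t + s)) < \<epsilon> / 2"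
    and vs: "convex_weights vs" "\<And>s. average vs (\<lambda>t. b (t + s)) < \<epsilon> / 2"
    using a b unfolding averages_to_zero_def by meson
  have "average (convolve_weights ws vs) (\<lambda>t. a (t + s) + b (t + s)) < \<epsilon>" for s
  proof -
    have "average (convolve_weights vs ws) (\<lambda>t. a (t + s)) \<le> \<epsilon> / 2"
      unfolding average_convolve
    proof (rule average_le_const[OF vs(1)])
      show "average ws (\<lambda>u. a (t + u + s)) \<le> \<epsilon> / 2" for t
        using ws(2)[of "t + s"] by (simp add: add_ac less_imp_le)
    qed
    moreover have "average (convolve_weights ws vs) f = average (convolve_weights vs ws) f" for f :: "real \<Rightarrow> real"
    proof -
      have swap: "average ws (\<lambda>t. average vs (\<lambda>u. g t u)) = average vs (\<lambda>u. average ws (\<lambda>t. g t u))" for g :: "real \<Rightarrow> real \<Rightarrow> real"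
      proof (induction ws)
        case Nil then show ?case by (induction vs) auto
      next
        case (Cons p ws)
        then show ?case by (simp add: average_add flip: average_mult_right)
      qed
      show ?thesis unfolding average_convolve by (subst swap) (simp add: add.commute)
    qed
    moreover have "average (convolve_weights ws vs) (\<lambda>t. b (t + s)) < \<epsilon> / 2"
    proof -
      \<comment> \<open>A maximum over the finitely many times of \<open>ws\<close> keeps the
        inequality strict; the other summand is bounded by \<open>\<epsilon> / 2\<close>
        non-strictly.\<close>
      define m where "m = Max ((\<lambda>p. average vs (\<lambda>u. b (snd p + u + s))) ` set ws)"
      have ne: "set ws \<noteq> {}" using ws(1) by (auto simp: convex_weights_def)
      have "m < \<epsilon> / 2" unfolding m_def
        using ne vs(2)[of "_ + s"] by (subst Max_less_iff) (auto simp: add_ac)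
      have "average ws f \<le> average ws (\<lambda>_. m)" if "\<And>p. p \<in> set ws \<Longrightarrow> f (snd p) \<le> m" for f
        using ws(1)[unfolded convex_weights_def, THEN conjunct1] that
        by (induction ws) (auto intro!: add_mono mult_left_mono)
      from this[of "\<lambda>t. average vs (\<lambda>u. b (t + u + s))"]
      have "average (convolve_weights ws vs) (\<lambda>t. b (t + s)) \<le> m"
        unfolding average_convolve average_const[OF ws(1)] m_def by auto
      then show ?thesis using \<open>m < \<epsilon> / 2\<close> by simp
    qed
    ultimately show ?thesis unfolding average_add by (metis add_le_less_mono field_sum_of_halves)
  qed
  then show "\<exists>ws. convex_weights ws \<and> (\<forall>s. average ws (\<lambda>t. a (t + s) + b (t + s)) < \<epsilon>)"
    using convex_weights_convolve[OF ws(1) vs(1)] by blast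
qed

text \<open>A form of Wiener's lemma. The averaged character \<open>A\<close> has value 1 at
  \<open>x0\<close>, so an atom is at most the integral of \<open>(cmod (A x))\<^sup>2\<close>,
  which is in modulus a double average of \<open>char M\<close> at \<open>t - u\<close>. For each
  \<open>u\<close> the inner average is small, by uniformity in the shift
  \<open>- u\<close>.\<close>

lemma char_averages_to_zero_imp_atomless:
  assumes M: "real_distribution M" and a: "averages_to_zero (\<lambda>t. cmod (char M t))"
  shows "measure M {x0} = 0"
proof -
  interpret M: real_distribution M by fact
  have "measure M {x0} \<le> \<epsilon>" if eps: "\<epsilon> > 0" for \<epsilon>
  proof -
    obtain ws where ws: "convex_weights ws" "\<And>s. average ws (\<lambda>t. cmod (char M (t + s))) < \<epsilon>"
      using a eps unfolding averages_to_zero_def by blast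
    define A where "A x = average ws (\<lambda>t. cis (t * (x - x0)))" for x
    have A2: "complex_of_real ((cmod (A x))\<^sup>2) = average ws (\<lambda>u. average ws (\<lambda>t. cis ((t - u) * (x - x0))))" for x
    proof -
      have "complex_of_real ((cmod (A x))\<^sup>2) = A x * cnj (A x)" by (rule complex_norm_square)
      also have "cnj (A x) = average ws (\<lambda>u. cis (- (u * (x - x0))))"
        unfolding A_def by (simp add: average_cnj[symmetric] cis_cnj)
      also have "A x * \<dots> = average ws (\<lambda>u. average ws (\<lambda>t. cis (t * (x - x0)) * cis (- (u * (x - x0)))))"
        unfolding average_mult_right[symmetric] average_mult_left[symmetric] A_def ..
      finally show ?thesis by (simp add: cis_mult algebra_simps)
    qed
    have int: "integrable M (\<lambda>x. cis (t * (x - x0)))" for t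
      by (intro M.integrable_cis) simp
    have val: "cmod (CLINT x|M. cis (t * (x - x0))) = cmod (char M t)" for t
    proof -
      have "(CLINT x|M. cis (t * (x - x0))) = (CLINT x|M. cis (t * x) * cis (- (t * x0)))"
        by (simp add: cis_mult algebra_simps)
      then show ?thesis by (simp add: M.char_eq_cis norm_mult)
    qed
    have [measurable]: "A \<in> borel_measurable borel" unfolding A_def by measurable
    have A1: "cmod (A x) \<le> 1" for x
      using norm_average_le[OF ws(1), of "\<lambda>t. cis (t * (x - x0))"] unfolding A_def
      by (simp add: average_const[OF ws(1)])
    have iA: "integrable M (\<lambda>x. (cmod (A x))\<^sup>2)"
      by (rule M.integrable_const_bound[of _ 1]) (auto simp: power_le_one A1)
    have "A x0 = 1" unfolding A_def by (simp add: average_const[OF ws(1)])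
    then have "measure M {x0} \<le> (\<integral>x. (cmod (A x))\<^sup>2 \<partial>M)"
      using integral_mono[of M "indicator {x0}" "\<lambda>x. (cmod (A x))\<^sup>2"] iA
      by (simp add: indicator_def M.emeasure_eq_measure)
    also have "\<dots> = cmod (\<integral>x. complex_of_real ((cmod (A x))\<^sup>2) \<partial>M)"
      by (subst integral_complex_of_real) (simp only: norm_of_real, simp)
    also have "(\<integral>x. complex_of_real ((cmod (A x))\<^sup>2) \<partial>M)
        = average ws (\<lambda>u. average ws (\<lambda>t. CLINT x|M. cis ((t - u) * (x - x0))))"
      unfolding A2 by (simp add: average_integral average_integrable int)
    also have "cmod \<dots> \<le> average ws (\<lambda>u. cmod (average ws (\<lambda>t. CLINT x|M. cis ((t - u) * (x - x0)))))"
      by (rule norm_average_le[OF ws(1)])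
    also have "\<dots> \<le> \<epsilon>"
    proof (rule average_le_const[OF ws(1)])
      fix u
      have "cmod (average ws (\<lambda>t. CLINT x|M. cis ((t - u) * (x - x0)))) \<le> average ws (\<lambda>t. cmod (char M (t + - u)))"
        using norm_average_le[OF ws(1), of "\<lambda>t. CLINT x|M. cis ((t - u) * (x - x0))"] by (simp add: val)
      also have "\<dots> \<le> \<epsilon>" using ws(2)[of "- u"] by (rule less_imp_le)
      finally show "cmod (average ws (\<lambda>t. CLINT x|M. cis ((t - u) * (x - x0)))) \<le> \<epsilon>" .
    qed
    finally show ?thesis .
  qed
  then have "measure M {x0} \<le> 0" by (rule field_le_epsilon[of _ 0, simplified])
  then show ?thesis by (simp add: measure_le_0_iff)
qed

section \<open>Bochner's theorem\<close>

text \<open>Normalized Lebesgue measure of the circle, placed on an interval of the line so that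
  densities against it are distributions on the reals and can be rescaled.\<close>

definition circle_measure :: "real measure" where
  "circle_measure = density lborel (\<lambda>x. ennreal (indicator {- pi..pi} x / (2 * pi)))"

lemma real_distribution_circle_measure: "real_distribution circle_measure"
proof -
  have "emeasure circle_measure (space circle_measure)
      = (\<integral>\<^sup>+x. ennreal (1 / (2 * pi)) * indicator {- pi..pi} x \<partial>lborel)"
    unfolding circle_measure_def
    by (subst emeasure_density) (auto intro!: nn_integral_cong simp: indicator_def)
  also have "\<dots> = ennreal (1 / (2 * pi)) * ennreal (2 * pi)"
    by (subst nn_integral_cmult_indicator) auto
  also have "\<dots> = 1" by (subst ennreal_mult[symmetric]) auto
  finally show ?thesis
    unfolding real_distribution_def real_distribution_axioms_def
    by (intro conjI prob_spaceI) (auto simp: circle_measure_def)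
qed

lemma circle_measure_AE: "AE x in circle_measure. \<bar>x\<bar> \<le> pi"
  unfolding circle_measure_def by (subst AE_density) (auto simp: indicator_def)

lemma circle_measure_cis:
  "(CLINT x|circle_measure. cis (of_int m * x)) = (if m = 0 then 1 else 0)"
proof (cases "m = 0")
  case True
  interpret real_distribution circle_measure by (rule real_distribution_circle_measure)
  show ?thesis using True prob_space by simp
next
  case False
  define F where "F x = cis (of_int m * x) / (\<i> * of_int m)" for x :: real
  have "(CLINT x|circle_measure. cis (of_int m * x))
      = (CLINT x|lborel. (indicator {- pi..pi} x / (2 * pi)) *\<^sub>R cis (of_int m * x))"
    unfolding circle_measure_def by (subst integral_density) auto
  also have "\<dots> = (CLINT x|lborel. (1 / (2 * pi)) *\<^sub>R (indicator {- pi..pi} x *\<^sub>R cis (of_int m * x)))"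
    by simp
  also have "\<dots> = (1 / (2 * pi)) *\<^sub>R (CLINT x|lborel. indicator {- pi..pi} x *\<^sub>R cis (of_int m * x))"
    by (rule integral_scaleR_right)
  also have "(CLINT x|lborel. indicator {- pi..pi} x *\<^sub>R cis (of_int m * x)) = F pi - F (- pi)"
  proof (rule integral_FTC_Icc)
    show "(F has_vector_derivative cis (of_int m * x)) (at x within {- pi..pi})" for x
    proof -
      have "((\<lambda>z. exp (\<i> * of_int m * z) / (\<i> * of_int m)) has_field_derivative exp (\<i> * of_int m * of_real x)) (at (of_real x))"
        using False by (auto intro!: derivative_eq_intros)
      from has_vector_derivative_real_field[OF this] show ?thesis
        unfolding F_def by (simp add: cis_conv_exp mult_ac)
    qed
    show "continuous_on {- pi..pi} (\<lambda>x. cis (of_int m * x))" by (intro continuous_intros)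
  qed simp
  also have "F pi - F (- pi) = 0"
  proof -
    have "sin (of_int m * pi) = 0" using sin_npi_int[of m] by (simp add: mult.commute)
    then have "cis (of_int m * pi) = cis (- (of_int m * pi))" by (simp add: complex_eq_iff)
    then show ?thesis unfolding F_def by simp
  qed
  finally show ?thesis using False by simp
qed

text \<open>Herglotz: Fejer averages of a positive definite sequence are densities.\<close>

lemma positive_definite_fejer:
  fixes a :: "int \<Rightarrow> complex"
  assumes pd: "\<And>x. \<exists>u\<ge>0. (\<Sum>k<N. \<Sum>l<N. a (int k - int l) * cis (- of_int (int k - int l) * x)) = of_real u"
    and a0: "a 0 = 1" and N: "N > 0"
  obtains \<mu> where "real_distribution \<mu>" "AE x in \<mu>. \<bar>x\<bar> \<le> pi"
    "\<And>j. j \<le> N \<Longrightarrow> (CLINT x|\<mu>. cis (of_nat j * x)) = of_real (1 - j / N) * a (int j)"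
proof -
  interpret U: real_distribution circle_measure by (rule real_distribution_circle_measure)
  define S where "S x = (\<Sum>k<N. \<Sum>l<N. a (int k - int l) * cis (- of_int (int k - int l) * x))" for x
  define g where "g x = Re (S x) / N" for x
  have S: "S x = of_real (N * g x)" "g x \<ge> 0" for x
    using pd[of x] N unfolding g_def S_def[symmetric] by auto
  have [measurable]: "S \<in> borel_measurable borel" unfolding S_def by measurable
  have [measurable]: "g \<in> borel_measurable borel" unfolding g_def by measurable
  have int: "(CLINT x|circle_measure. S x * cis (of_nat j * x))
      = (\<Sum>k<N. \<Sum>l<N. a (int k - int l) * (if k = l + j then 1 else 0))" for j
  proof -
    have "S x * cis (of_nat j * x)
        = (\<Sum>k<N. \<Sum>l<N. a (int k - int l) * cis (of_int (int j - (int k - int l)) * x))" for x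
      unfolding S_def sum_distrib_right
      by (intro sum.cong refl) (simp add: mult.assoc cis_mult algebra_simps)
    then have "(CLINT x|circle_measure. S x * cis (of_nat j * x))
        = (\<Sum>k<N. \<Sum>l<N. a (int k - int l) * (CLINT x|circle_measure. cis (of_int (int j - (int k - int l)) * x)))"
      by (simp add: Bochner_Integration.integral_sum U.integrable_cis del: of_int_diff)
    also have "\<dots> = (\<Sum>k<N. \<Sum>l<N. a (int k - int l) * (if k = l + j then 1 else 0))"
      unfolding circle_measure_cis by (intro sum.cong refl arg_cong2[where f="(*)"]) auto
    finally show ?thesis .
  qed
  \<comment> \<open>Of the \<open>N * N\<close> pairs of indices exactly \<open>N - j\<close> have
    difference \<open>j\<close>; this is the origin of the triangular factor
    \<open>1 - j / N\<close>.\<close>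
  have val: "(CLINT x|circle_measure. S x * cis (of_nat j * x)) = of_nat (N - j) * a (int j)" for j
  proof -
    have "(\<Sum>k<N. \<Sum>l<N. a (int k - int l) * (if k = l + j then 1 else 0))
        = (\<Sum>l<N. \<Sum>k<N. if k = l + j then a (int j) else 0)"
      by (subst sum.swap) (intro sum.cong refl, auto)
    also have "\<dots> = (\<Sum>l<N. if l + j < N then a (int j) else 0)"
      by (intro sum.cong refl) (simp add: sum.delta)
    also have "\<dots> = (\<Sum>l\<in>{l\<in>{..<N}. l + j < N}. a (int j))"
      by (subst sum.inter_filter) auto
    also have "{l\<in>{..<N}. l + j < N} = {..<N - j}" by auto
    finally show ?thesis unfolding int by simp
  qed
  define \<mu> where "\<mu> = density circle_measure (\<lambda>x. ennreal (g x))"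
  have g_int: "complex_of_real (\<integral>x. g x \<partial>circle_measure) = 1"
  proof -
    have "of_nat N * complex_of_real (\<integral>x. g x \<partial>circle_measure) = (CLINT x|circle_measure. S x)"
      unfolding S(1) by simp
    also have "\<dots> = of_nat N" using val[of 0] a0 by simp
    finally show ?thesis using N by simp
  qed
  \<comment> \<open>A function that is not integrable has Bochner integral 0, whereas the integral
    of \<open>g\<close> is 1.\<close>
  have g_integrable: "integrable circle_measure g"
  proof (rule ccontr)
    assume "\<not> integrable circle_measure g"
    then show False using g_int by (simp add: not_integrable_integral_eq)
  qed
  have "(\<integral>\<^sup>+x. ennreal (g x) \<partial>circle_measure) = 1"
    using nn_integral_eq_integral[OF g_integrable] S(2) g_int by (simp add: of_real_eq_1_iff)
  then have "prob_space \<mu>" unfolding \<mu>_def by (intro prob_spaceI) (simp add: emeasure_density)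
  then have \<mu>: "real_distribution \<mu>"
    unfolding real_distribution_def real_distribution_axioms_def \<mu>_def by simp
  show thesis
  proof (rule that[OF \<mu>])
    show "AE x in \<mu>. \<bar>x\<bar> \<le> pi"
      unfolding \<mu>_def by (subst AE_density) (use circle_measure_AE in auto)
    fix j assume j: "j \<le> N"
    have "(CLINT x|\<mu>. cis (of_nat j * x)) = (CLINT x|circle_measure. g x *\<^sub>R cis (of_nat j * x))"
      unfolding \<mu>_def by (subst integral_density) (auto simp: S(2))
    also have "\<dots> = (CLINT x|circle_measure. S x * cis (of_nat j * x) / of_nat N)"
      unfolding S(1) using N by (simp add: scaleR_conv_of_real)
    also have "\<dots> = of_nat (N - j) * a (int j) / of_nat N" by (simp add: val)
    also have "\<dots> = of_real (1 - j / N) * a (int j)"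
      using N j by (simp add: of_nat_diff field_simps)
    finally show "(CLINT x|\<mu>. cis (of_nat j * x)) = of_real (1 - j / N) * a (int j)" .
  qed
qed

text \<open>The modulus is twice the sine of \<open>t = \<bar>\<theta>\<bar> / 2\<close>. The bound
  1.6 exceeds \<open>pi / 2\<close>, and as its square is below 3, the cubic Taylor error is at most
  \<open>t / 2\<close>, so \<open>sin t\<close> is at least \<open>t / 2\<close>.\<close>

lemma cmod_one_minus_cis_ge:
  assumes "\<bar>\<theta>\<bar> \<le> pi"
  shows "\<bar>\<theta>\<bar> / 2 \<le> cmod (1 - cis \<theta>)"
proof -
  define t where "t = \<bar>\<theta>\<bar> / 2"
  have t: "0 \<le> t" "t \<le> 1.6" unfolding t_def using assms pi_less_4 pi_approx by auto
  have "\<bar>sin t - t\<bar> \<le> t ^ 3 / 6"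
    using Maclaurin_sin_bound[of t 3] t by (simp add: sin_coeff_def eval_nat_numeral fact_numeral field_simps)
  moreover have "t ^ 3 / 6 \<le> t / 2"
  proof -
    have "t * t \<le> 1.6 * 1.6" using t by (intro mult_mono) auto
    then have "t * (t * t) \<le> t * 3" using t by (intro mult_left_mono) auto
    then show ?thesis by (simp add: power3_eq_cube)
  qed
  ultimately have "t / 2 \<le> sin t" by linarith
  moreover have "(cmod (1 - cis \<theta>))\<^sup>2 = (2 * sin t)\<^sup>2"
  proof -
    have "cos \<theta> = cos (2 * t)" unfolding t_def by (simp add: abs_if)
    then have "cos \<theta> = 1 - 2 * (sin t)\<^sup>2" by (simp add: cos_double_sin)
    moreover have "(cmod (1 - cis \<theta>))\<^sup>2 = 2 - 2 * cos \<theta>"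
      unfolding cmod_power2 using sin_cos_squared_add[of \<theta>] by (simp add: power2_eq_square algebra_simps)
    ultimately show ?thesis by (simp add: power_mult_distrib)
  qed
  then have "2 * sin t \<le> cmod (1 - cis \<theta>)"
    by (metis abs_ge_self abs_norm_cancel power2_eq_iff abs_of_nonneg norm_ge_zero abs_minus_cancel)
  ultimately show ?thesis unfolding t_def by linarith
qed

text \<open>The geometric sum has modulus at most
  \<open>2 / cmod (1 - cis \<theta>) \<le> 4 / \<bar>\<theta>\<bar>\<close>, and the threshold 8
  makes this at most \<open>m / 2\<close>.\<close>

lemma average_cos_le_half:
  fixes m :: nat and \<theta> :: real
  assumes \<theta>: "\<bar>\<theta>\<bar> \<le> pi" and m: "8 \<le> m * \<bar>\<theta>\<bar>"
  shows "(\<Sum>j=1..m. cos (j * \<theta>)) / m \<le> 1 / 2"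
proof -
  have "(\<Sum>j=1..m. cis (j * \<theta>)) * (1 - cis \<theta>) = cis \<theta> - cis ((m + 1) * \<theta>)"
  proof (induction m)
    case (Suc m)
    have "(\<Sum>j=1..Suc m. cis (j * \<theta>)) * (1 - cis \<theta>)
        = (\<Sum>j=1..m. cis (j * \<theta>)) * (1 - cis \<theta>) + cis (Suc m * \<theta>) * (1 - cis \<theta>)"
      by (simp add: distrib_right)
    also have "\<dots> = cis \<theta> - cis ((m + 1) * \<theta>) + (cis ((m + 1) * \<theta>) - cis ((Suc m + 1) * \<theta>))"
      unfolding Suc by (simp add: right_diff_distrib cis_mult algebra_simps)
    finally show ?case by simp
  qed simp
  then have "cmod (\<Sum>j=1..m. cis (j * \<theta>)) * cmod (1 - cis \<theta>) = cmod (cis \<theta> - cis ((m + 1) * \<theta>))"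
    by (metis norm_mult)
  also have "\<dots> \<le> 2" by (rule order_trans[OF norm_triangle_ineq4]) simp
  finally have le2: "cmod (\<Sum>j=1..m. cis (j * \<theta>)) * cmod (1 - cis \<theta>) \<le> 2" .
  define A where "A = cmod (\<Sum>j=1..m. cis (j * \<theta>))"
  have "A * (\<bar>\<theta>\<bar> / 2) \<le> A * cmod (1 - cis \<theta>)"
    unfolding A_def using cmod_one_minus_cis_ge[OF \<theta>] by (intro mult_left_mono) auto
  then have "A * \<bar>\<theta>\<bar> \<le> 4" using le2 unfolding A_def[symmetric] by simp
  then have "(2 * A) * \<bar>\<theta>\<bar> \<le> m * \<bar>\<theta>\<bar>" using m by linarith
  moreover have "\<bar>\<theta>\<bar> > 0" using m by (cases "\<theta> = 0") auto
  ultimately have "2 * A \<le> m" by simp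
  moreover have "(\<Sum>j=1..m. cos (j * \<theta>)) \<le> A"
    using complex_Re_le_cmod[of "\<Sum>j=1..m. cis (j * \<theta>)"] unfolding A_def by simp
  ultimately have "2 * (\<Sum>j=1..m. cos (j * \<theta>)) \<le> m" by linarith
  moreover have "m > 0" using m by (cases m) auto
  ultimately show ?thesis by (simp add: field_simps)
qed

text \<open>The classical bound of tails by a characteristic function near 0, with the integral over
  frequencies replaced by a mean over the grid points \<open>j * \<delta>\<close>, where the values
  are known. The support condition keeps \<open>\<delta> * y\<close> within
  \<open>[- pi, pi]\<close>, and where \<open>\<bar>y\<bar>\<close> exceeds \<open>K\<close> the
  mean of the cosines is at most one half.\<close>

lemma tail_le_char:
  fixes m :: nat and \<delta> K \<epsilon> :: real
  assumes \<mu>: "real_distribution \<mu>" and supp: "AE y in \<mu>. \<bar>y\<bar> \<le> pi / \<delta>"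
    and \<delta>: "\<delta> > 0" and m: "m > 0" and K: "8 \<le> m * \<delta> * K"
    and close: "\<And>j. j \<le> m \<Longrightarrow> 1 - \<epsilon> \<le> Re (char \<mu> (j * \<delta>))"
  shows "measure \<mu> {y. K < \<bar>y\<bar>} \<le> 2 * \<epsilon>"
proof -
  interpret real_distribution \<mu> by fact
  have sets: "{y. K < \<bar>y\<bar>} \<in> sets \<mu>" by simp
  have cosint: "integrable \<mu> (\<lambda>y. cos (j * (\<delta> * y)))" for j :: nat
    by (rule integrable_const_bound[of _ 1]) auto
  have "AE y in \<mu>. indicator {y. K < \<bar>y\<bar>} y \<le> 2 * (1 - (\<Sum>j=1..m. cos (j * (\<delta> * y))) / m)"
    using supp
  proof eventually_elim
    case (elim y)
    show ?case
    proof (cases "K < \<bar>y\<bar>")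
      case True
      have "\<bar>\<delta> * y\<bar> \<le> pi" using elim \<delta> by (simp add: abs_mult field_simps)
      moreover have "8 \<le> m * \<bar>\<delta> * y\<bar>"
      proof -
        have "m * \<delta> * K \<le> m * \<delta> * \<bar>y\<bar>" using True \<delta> by (intro mult_left_mono) auto
        then show ?thesis using K \<delta> by (simp add: abs_mult mult.assoc)
      qed
      ultimately have "(\<Sum>j=1..m. cos (j * (\<delta> * y))) / m \<le> 1 / 2" by (rule average_cos_le_half)
      then have "1 \<le> 2 * (1 - (\<Sum>j=1..m. cos (j * (\<delta> * y))) / m)" by argo
      moreover have "indicator {y. K < \<bar>y\<bar>} y = (1 :: real)" using True by simp
      ultimately show ?thesis by (simp only:)
    next
      case False
      have "(\<Sum>j=1..m. cos (j * (\<delta> * y))) \<le> (\<Sum>j=1..m. 1)" by (intro sum_mono) simp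
      then have "(\<Sum>j=1..m. cos (j * (\<delta> * y))) / m \<le> 1" using m by simp
      then have "0 \<le> 2 * (1 - (\<Sum>j=1..m. cos (j * (\<delta> * y))) / m)" by argo
      moreover have "indicator {y. K < \<bar>y\<bar>} y = (0 :: real)" using False by simp
      ultimately show ?thesis by (simp only:)
    qed
  qed
  then have "(\<integral>y. indicator {y. K < \<bar>y\<bar>} y \<partial>\<mu>) \<le> (\<integral>y. 2 * (1 - (\<Sum>j=1..m. cos (j * (\<delta> * y))) / m) \<partial>\<mu>)"
    using sets cosint by (intro integral_mono_AE) (auto simp: emeasure_eq_measure)
  also have "\<dots> = 2 * (1 - (\<Sum>j=1..m. \<integral>y. cos (j * (\<delta> * y)) \<partial>\<mu>) / m)"
    using cosint prob_space by (simp add: Bochner_Integration.integral_sum)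
  also have "\<dots> \<le> 2 * \<epsilon>"
  proof -
    have "(\<integral>y. cos (j * (\<delta> * y)) \<partial>\<mu>) = Re (char \<mu> (j * \<delta>))" for j :: nat
      unfolding char_eq_cis by (subst integral_Re[symmetric]) (auto simp: integrable_cis mult.assoc)
    then have "(\<Sum>j=1..m. 1 - \<epsilon>) \<le> (\<Sum>j=1..m. \<integral>y. cos (j * (\<delta> * y)) \<partial>\<mu>)"
      using close by (intro sum_mono) auto
    then show ?thesis using m by (simp add: field_simps)
  qed
  finally show ?thesis using sets by simp
qed

text \<open>Restricted to the grid of mesh \<open>1 / 2 ^ n\<close>, \<open>\<phi>\<close> is a
  positive definite sequence, and \<open>4 ^ n\<close> terms of it give a distribution by the Fejer
  construction. Mesh and number of terms are balanced: the grid reaches up to \<open>2 ^ n\<close>,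
  and at a fixed dyadic \<open>u\<close> the Fejer factor \<open>1 - u / 2 ^ n\<close> tends to 1.
  Continuity at 0 gives tightness; a limit distribution agrees with \<open>\<phi>\<close> at
  nonnegative dyadic points, hence by continuity and symmetry everywhere.\<close>

theorem bochner:
  fixes \<phi> :: "real \<Rightarrow> complex"
  assumes pd: "\<And>N (t :: nat \<Rightarrow> real) c. \<exists>u\<ge>0. (\<Sum>k<N. \<Sum>l<N. c k * cnj (c l) * \<phi> (t k - t l)) = of_real u"
    and zero: "\<phi> 0 = 1" and cont: "continuous_on UNIV \<phi>" and herm: "\<And>t. \<phi> (- t) = cnj (\<phi> t)"
  obtains M where "real_distribution M" "char M = \<phi>"
proof -
  have "\<exists>\<mu>. real_distribution \<mu> \<and> (AE y in \<mu>. \<bar>y\<bar> \<le> pi / (1 / 2 ^ n)) \<and>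
      (\<forall>j\<le>4 ^ n. char \<mu> (of_nat j * (1 / 2 ^ n)) = of_real (1 - j / 4 ^ n) * \<phi> (of_nat j * (1 / 2 ^ n)))" for n :: nat
  proof -
    define \<delta> :: real where "\<delta> = 1 / 2 ^ n"
    have \<delta>: "\<delta> > 0" unfolding \<delta>_def by simp
    define a where "a m = \<phi> (of_int m * \<delta>)" for m :: int
    have "\<exists>u\<ge>0. (\<Sum>k<(4 ^ n :: nat). \<Sum>l<4 ^ n. a (int k - int l) * cis (- of_int (int k - int l) * x)) = of_real u" for x
    proof -
      have "a (int k - int l) * cis (- of_int (int k - int l) * x)
          = cis (- (of_nat k * x)) * cnj (cis (- (of_nat l * x))) * \<phi> (of_nat k * \<delta> - of_nat l * \<delta>)" for k l
        unfolding a_def by (simp add: cis_cnj cis_mult algebra_simps)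
      then show ?thesis
        using pd[where N="4 ^ n" and t="\<lambda>k. of_nat k * \<delta>" and c="\<lambda>k. cis (- (of_nat k * x))"] by simp
    qed
    then obtain \<mu> where \<mu>: "real_distribution \<mu>" "AE x in \<mu>. \<bar>x\<bar> \<le> pi"
      "\<And>j. j \<le> 4 ^ n \<Longrightarrow> (CLINT x|\<mu>. cis (of_nat j * x)) = of_real (1 - j / (4 ^ n :: nat)) * a (int j)"
      by (rule positive_definite_fejer[of a "4 ^ n"]) (use zero in \<open>auto simp: a_def\<close>)
    interpret \<mu>: real_distribution \<mu> by fact
    \<comment> \<open>Dividing by \<open>\<delta>\<close> turns the Fourier coefficient of index
      \<open>j\<close> into the value of the characteristic function at
      \<open>j * \<delta>\<close>.\<close>
    define \<nu> where "\<nu> = distr \<mu> borel (\<lambda>x. x / \<delta>)"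
    have \<nu>: "real_distribution \<nu>" unfolding \<nu>_def by (intro \<mu>.real_distribution_distr) simp
    interpret \<nu>: real_distribution \<nu> by fact
    have "AE y in \<nu>. \<bar>y\<bar> \<le> pi / \<delta>"
      unfolding \<nu>_def by (subst AE_distr_iff) (use \<mu>(2) \<delta> in \<open>auto simp: field_simps\<close>)
    moreover have "char \<nu> (of_nat j * \<delta>) = of_real (1 - j / 4 ^ n) * \<phi> (of_nat j * \<delta>)" if "j \<le> 4 ^ n" for j
      unfolding \<nu>.char_eq_cis unfolding \<nu>_def
      by (subst integral_distr) (use \<mu>(3)[OF that] \<delta> in \<open>auto simp: a_def\<close>)
    ultimately show ?thesis using \<nu> unfolding \<delta>_def[symmetric] by blast
  qed
  then obtain \<mu> where \<mu>: "\<And>n. real_distribution (\<mu> n)"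
    and supp: "\<And>n. AE y in \<mu> n. \<bar>y\<bar> \<le> pi / (1 / 2 ^ n)"
    and ch: "\<And>n j. j \<le> 4 ^ n \<Longrightarrow> char (\<mu> n) (of_nat j * (1 / 2 ^ n)) = of_real (1 - j / 4 ^ n) * \<phi> (of_nat j * (1 / 2 ^ n))"
    by metis
  have tail: "\<exists>K. \<forall>n. measure (\<mu> n) {y. K < \<bar>y\<bar>} < \<epsilon>" if \<epsilon>: "\<epsilon> > 0" "\<epsilon> \<le> 1" for \<epsilon> :: real
  proof -
    have "isCont \<phi> 0" using cont by (simp add: continuous_on_eq_continuous_at)
    then have "\<exists>\<eta>>0. \<forall>u. dist u 0 < \<eta> \<longrightarrow> dist (\<phi> u) (\<phi> 0) < \<epsilon> / 8"
      using \<epsilon> unfolding continuous_at by (metis LIM_def dist_self divide_pos_pos zero_less_numeral)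
    then obtain \<eta> where \<eta>: "\<eta> > 0" "\<And>u. \<bar>u\<bar> < \<eta> \<Longrightarrow> cmod (\<phi> u - 1) < \<epsilon> / 8"
      unfolding dist_norm zero by auto
    \<comment> \<open>\<open>(1 / 2) ^ p\<close> is the length of the frequency window: the bound
      \<open>\<eta>\<close> keeps \<open>\<phi>\<close> close to 1 on it, the bound
      \<open>\<epsilon> / 16\<close> controls the Fejer factor. The matching \<open>K\<close> is 8
      divided by this length, 8 being the threshold of \<open>tail_le_char\<close>.\<close>
    obtain p where p: "(1 / 2) ^ p < min \<eta> (\<epsilon> / 16)"
      using real_arch_pow_inv[of "min \<eta> (\<epsilon> / 16)" "1 / 2"] \<eta>(1) \<epsilon>(1) by auto
    define K :: real where "K = 8 * 2 ^ p"
    have "measure (\<mu> n) {y. K < \<bar>y\<bar>} < \<epsilon>" for n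
    proof (cases "p \<le> n")
      case True
      interpret real_distribution "\<mu> n" by (rule \<mu>)
      have pn: "(2 :: real) ^ n = 2 ^ (n - p) * 2 ^ p" using True by (simp flip: power_add)
      \<comment> \<open>Error budget: \<open>\<epsilon> / 8\<close> from continuity and
        \<open>2 * (\<epsilon> / 16)\<close> from the Fejer factor, with
        \<open>cmod z \<le> 2\<close>, make \<open>\<epsilon> / 4\<close>;
        \<open>tail_le_char\<close> doubles it.\<close>
      have "measure (\<mu> n) {y. K < \<bar>y\<bar>} \<le> 2 * (\<epsilon> / 4)"
      proof (rule tail_le_char[OF \<mu> supp, where m="2 ^ (n - p)"])
        show "8 \<le> real (2 ^ (n - p)) * (1 / 2 ^ n) * K"
          unfolding K_def pn by simp
        fix j :: nat assume j: "j \<le> 2 ^ (n - p)"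
        have j2: "real j \<le> 2 ^ (n - p)" using j by (metis of_nat_le_iff of_nat_numeral of_nat_power)
        have "(2 :: nat) ^ (n - p) \<le> 2 ^ n" by (intro power_increasing) auto
        also have "(2 :: nat) ^ n \<le> 4 ^ n" by (intro power_mono) auto
        finally have j4: "j \<le> 4 ^ n" using j by linarith
        have "real j * (1 / 2 ^ n) \<le> 2 ^ (n - p) * (1 / 2 ^ n)" using j2 by (intro mult_right_mono) auto
        also have "\<dots> = (1 / 2) ^ p" unfolding pn by (simp add: power_one_over)
        finally have u: "real j * (1 / 2 ^ n) \<le> (1 / 2) ^ p" .
        then have cl: "cmod (\<phi> (real j * (1 / 2 ^ n)) - 1) < \<epsilon> / 8"
          using p by (intro \<eta>(2)) auto
        define r where "r = real j / 4 ^ n"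
        have "r = real j * (1 / 2 ^ n) * (1 / 2 ^ n)"
          unfolding r_def by (simp add: power_mult_distrib[symmetric])
        also have "\<dots> \<le> (1 / 2) ^ p * 1" using u by (intro mult_mono) auto
        finally have "r \<le> (1 / 2) ^ p" by simp
        moreover have "(1 / 2) ^ p < \<epsilon> / 16" using p by simp
        ultimately have r: "0 \<le> r" "r \<le> \<epsilon> / 16" unfolding r_def by (simp, linarith)
        define z where "z = \<phi> (real j * (1 / 2 ^ n))"
        have z: "cmod (z - 1) < \<epsilon> / 8" using cl unfolding z_def .
        have "cmod z \<le> 2" using norm_triangle_sub[of z 1] z \<epsilon>(2) by simp
        have "cmod (1 - of_real (1 - r) * z) = cmod ((1 - z) + of_real r * z)" by (simp add: algebra_simps)
        also have "\<dots> \<le> cmod (1 - z) + r * cmod z"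
          using norm_triangle_ineq[of "1 - z" "of_real r * z"] r(1) by (simp add: norm_mult)
        also have "\<dots> \<le> \<epsilon> / 8 + \<epsilon> / 16 * 2"
          using z r \<open>cmod z \<le> 2\<close> \<epsilon>(1) by (intro add_mono mult_mono) (auto simp: norm_minus_commute)
        finally have "cmod (1 - of_real (1 - r) * z) \<le> \<epsilon> / 4" by simp
        moreover have "Re (1 - of_real (1 - r) * z) \<le> cmod (1 - of_real (1 - r) * z)" by (rule complex_Re_le_cmod)
        ultimately have "1 - \<epsilon> / 4 \<le> Re (of_real (1 - r) * z)" by simp
        then show "1 - \<epsilon> / 4 \<le> Re (char (\<mu> n) (real j * (1 / 2 ^ n)))"
          unfolding ch[OF j4] r_def z_def .
      qed auto
      then show ?thesis using \<epsilon>(1) by simp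
    next
      case False
      interpret real_distribution "\<mu> n" by (rule \<mu>)
      \<comment> \<open>For \<open>n < p\<close> the support bound \<open>pi * 2 ^ n\<close> is
        already below \<open>K\<close>.\<close>
      have "AE y in \<mu> n. y \<notin> {y. K < \<bar>y\<bar>}"
        using supp[of n]
      proof eventually_elim
        case (elim y)
        have "pi * 2 ^ n \<le> 8 * 2 ^ p" using pi_less_4 False by (intro mult_mono power_increasing) auto
        then show ?case using elim unfolding K_def by simp
      qed
      then have "measure (\<mu> n) {y. K < \<bar>y\<bar>} = 0"
        by (subst prob_eq_0) auto
      then show ?thesis using \<epsilon>(1) by simp
    qed
    then show ?thesis by blast
  qed
  have "tight \<mu>"
    unfolding tight_def
  proof (intro conjI allI impI \<mu>)
    fix \<epsilon> :: real assume "\<epsilon> > 0"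
    then obtain K where K: "\<And>n. measure (\<mu> n) {y. K < \<bar>y\<bar>} < min \<epsilon> 1" using tail[of "min \<epsilon> 1"] by auto
    \<comment> \<open>The interval excludes its left end, hence the \<open>- 1\<close>; the absolute
      values keep it nonempty whatever the sign of \<open>K\<close>.\<close>
    have "1 - \<epsilon> < measure (\<mu> n) {- \<bar>K\<bar> - 1<..\<bar>K\<bar>}" for n
    proof -
      interpret real_distribution "\<mu> n" by (rule \<mu>)
      have "1 - measure (\<mu> n) {y. K < \<bar>y\<bar>} = measure (\<mu> n) (space (\<mu> n) - {y. K < \<bar>y\<bar>})"
        by (subst prob_compl) auto
      also have "\<dots> \<le> measure (\<mu> n) {- \<bar>K\<bar> - 1<..\<bar>K\<bar>}" by (intro finite_measure_mono) auto
      finally show ?thesis using K[of n] by simp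
    qed
    then show "\<exists>a b. a < b \<and> (\<forall>n. 1 - \<epsilon> < measure (\<mu> n) {a<..b})"
      by (intro exI[of _ "- \<bar>K\<bar> - 1"] exI[of _ "\<bar>K\<bar>"]) auto
  qed
  then obtain \<rho> M where \<rho>: "strict_mono (\<rho> :: nat \<Rightarrow> nat)" and M: "real_distribution M" "weak_conv_m (\<mu> \<circ> id \<circ> \<rho>) M"
    using tight_imp_convergent_subsubsequence[of \<mu> id] strict_mono_id by blast
  interpret M: real_distribution M by fact
  have dyadic: "char M (real k / 2 ^ p) = \<phi> (real k / 2 ^ p)" for k p :: nat
  proof (rule LIMSEQ_unique)
    show "(\<lambda>n. char (\<mu> (\<rho> n)) (real k / 2 ^ p)) \<longlonglongrightarrow> char M (real k / 2 ^ p)"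
      using levy_continuity1[OF _ M] \<mu> by (simp add: comp_def)
    have "(\<lambda>n. char (\<mu> n) (real k / 2 ^ p)) \<longlonglongrightarrow> \<phi> (real k / 2 ^ p)"
    proof (rule Lim_transform_eventually)
      have "(\<lambda>n. real k / 2 ^ p * (1 / 2) ^ n) \<longlonglongrightarrow> real k / 2 ^ p * 0"
        by (intro tendsto_mult tendsto_const LIMSEQ_power_zero) simp
      then have "(\<lambda>n. of_real (1 - real k / 2 ^ p * (1 / 2) ^ n) * \<phi> (real k / 2 ^ p)) \<longlonglongrightarrow> of_real (1 - 0) * \<phi> (real k / 2 ^ p)"
        by (intro tendsto_intros) simp
      then show "(\<lambda>n. of_real (1 - real k / 2 ^ p * (1 / 2) ^ n) * \<phi> (real k / 2 ^ p)) \<longlonglongrightarrow> \<phi> (real k / 2 ^ p)"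
        by simp
      show "\<forall>\<^sub>F n in sequentially. of_real (1 - real k / 2 ^ p * (1 / 2) ^ n) * \<phi> (real k / 2 ^ p) = char (\<mu> n) (real k / 2 ^ p)"
        using eventually_ge_at_top[of "max p k"]
      proof eventually_elim
        case (elim n)
        \<comment> \<open>The index of \<open>k / 2 ^ p\<close> in the grid of mesh
          \<open>1 / 2 ^ n\<close>; \<open>n \<ge> k\<close> makes \<open>k \<le> 2 ^ n\<close> and
          keeps the index within the \<open>4 ^ n\<close> terms.\<close>
        define j where "j = k * 2 ^ (n - p)"
        have pn: "(2 :: real) ^ n = 2 ^ (n - p) * 2 ^ p" using elim by (simp flip: power_add)
        have "k \<le> 2 ^ n" using elim less_exp[of n] by linarith
        then have "j \<le> 2 ^ n * 2 ^ n" unfolding j_def by (intro mult_mono power_increasing) auto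
        then have j4: "j \<le> 4 ^ n" by (simp flip: power_mult_distrib)
        have u: "real j * (1 / 2 ^ n) = real k / 2 ^ p" unfolding j_def pn by simp
        have "real j / 4 ^ n = real j * (1 / 2 ^ n) * (1 / 2) ^ n"
          by (simp add: power_one_over power_mult_distrib[symmetric])
        then show ?case using ch[OF j4] unfolding u by simp
      qed
    qed
    from LIMSEQ_subseq_LIMSEQ[OF this \<rho>] show "(\<lambda>n. char (\<mu> (\<rho> n)) (real k / 2 ^ p)) \<longlonglongrightarrow> \<phi> (real k / 2 ^ p)"
      by (simp add: comp_def)
  qed
  have nonneg: "char M u = \<phi> u" if u: "u \<ge> 0" for u
  proof -
    define q where "q n = real (nat \<lfloor>u * 2 ^ n\<rfloor>) / 2 ^ n" for n :: nat
    have "q \<longlonglongrightarrow> u"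
    proof (rule tendsto_sandwich[OF _ _ _ tendsto_const])
      have b: "u - (1 / 2) ^ n \<le> q n \<and> q n \<le> u" for n
      proof -
        have "real (nat \<lfloor>u * 2 ^ n\<rfloor>) = of_int \<lfloor>u * 2 ^ n\<rfloor>" using u by simp
        moreover have "of_int \<lfloor>u * 2 ^ n\<rfloor> \<le> u * 2 ^ n" "u * 2 ^ n - 1 \<le> of_int \<lfloor>u * 2 ^ n\<rfloor>" by linarith+
        ultimately have "(u * 2 ^ n - 1) / 2 ^ n \<le> q n" "q n \<le> u * 2 ^ n / 2 ^ n"
          unfolding q_def by (simp_all only: divide_right_mono zero_le_power zero_le_numeral)
        moreover have "(u * 2 ^ n - 1) / 2 ^ n = u - (1 / 2) ^ n"
          by (simp add: diff_divide_distrib power_one_over)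
        ultimately show ?thesis by simp
      qed
      show "\<forall>\<^sub>F n in sequentially. u - (1 / 2) ^ n \<le> q n" "\<forall>\<^sub>F n in sequentially. q n \<le> u" using b by auto
      have "(\<lambda>n. u - (1 / 2) ^ n) \<longlonglongrightarrow> u - 0" by (intro tendsto_intros LIMSEQ_power_zero) simp
      then show "(\<lambda>n. u - (1 / 2) ^ n) \<longlonglongrightarrow> u" by simp
    qed
    then have "(\<lambda>n. char M (q n)) \<longlonglongrightarrow> char M u" "(\<lambda>n. \<phi> (q n)) \<longlonglongrightarrow> \<phi> u"
      using M.isCont_char cont by (auto intro: isCont_tendsto_compose simp: continuous_on_eq_continuous_at)
    moreover have "char M (q n) = \<phi> (q n)" for n unfolding q_def by (rule dyadic)
    ultimately show ?thesis by (metis (no_types, lifting) LIMSEQ_unique ext)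
  qed
  have "char M u = \<phi> u" for u
  proof (cases "u \<ge> 0")
    case False
    then show ?thesis using nonneg[of "- u"] M.char_uminus[of u] herm[of u] by simp
  qed (rule nonneg)
  then show thesis using that[OF M(1)] by blast
qed

section \<open>Weak mixing and correlations\<close>

lemma measure_preserving_measurable: "measure_preserving M N f \<Longrightarrow> f \<in> measurable M N"
  unfolding measure_preserving_def by simp

lemma measure_preserving_AE:
  assumes "measure_preserving M N f" "AE y in N. P y"
  shows "AE x in M. P (f x)"
  using assms AE_distrD unfolding measure_preserving_def by metis

lemma measure_preserving_integral:
  fixes g :: "'b \<Rightarrow> 'c::{banach, second_countable_topology}"
  assumes "measure_preserving M N f" "g \<in> borel_measurable N"
  shows "(\<integral>x. g (f x) \<partial>M) = (\<integral>y. g y \<partial>N)"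
  using assms integral_distr[of f M N g] unfolding measure_preserving_def by simp

lemma measure_preserving_measure:
  assumes "measure_preserving M N f" "A \<in> sets N"
  shows "measure M {x \<in> space M. f x \<in> A} = measure N A"
proof -
  have "measure M (f -` A \<inter> space M) = measure (distr M N f) A"
    using assms by (subst measure_distr) (auto simp: measure_preserving_def)
  moreover have "f -` A \<inter> space M = {x \<in> space M. f x \<in> A}" by auto
  ultimately show ?thesis using assms unfolding measure_preserving_def by simp
qed

text \<open>The purely measure-theoretic part of a flow. It has to cover products over
  \<open>I - {j}\<close>, which for a single coordinate are one-point spaces and so not
  flows.\<close>

locale mp_action = prob_space M for M :: "'a measure" and T :: "real \<Rightarrow> 'a \<Rightarrow> 'a" +
  assumes T_mp: "\<And>t. measure_preserving M M (T t)"
    and T_zero: "\<And>x. x \<in> space M \<Longrightarrow> T 0 x = x"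
    and T_add: "\<And>s t x. x \<in> space M \<Longrightarrow> T (s + t) x = T s (T t x)"
begin

lemma T_measurable [measurable]: "T t \<in> measurable M M"
  by (rule measure_preserving_measurable[OF T_mp])

lemma T_space: "x \<in> space M \<Longrightarrow> T t x \<in> space M"
  using T_measurable by (rule measurable_space)

end

lemma (in flow) mp_action: "mp_action M T"
  by unfold_locales (auto simp: preserving act_zero act_add)

lemma mp_action_pair:
  assumes "mp_action M T" "mp_action N S"
  shows "mp_action (M \<Otimes>\<^sub>M N) (\<lambda>t. map_prod (T t) (S t))"
proof -
  interpret M: mp_action M T by fact
  interpret N: mp_action N S by fact
  interpret MN: pair_prob_space M N ..
  show ?thesis
  proof
    fix t
    have "distr (M \<Otimes>\<^sub>M N) (M \<Otimes>\<^sub>M N) (\<lambda>(x, y). (T t x, S t y)) = distr M M (T t) \<Otimes>\<^sub>M distr N N (S t)"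
      by (rule pair_measure_distr[symmetric])
        (use M.T_mp N.T_mp N.sigma_finite_measure_axioms in \<open>auto simp: measure_preserving_def\<close>)
    also have "\<dots> = M \<Otimes>\<^sub>M N" using M.T_mp N.T_mp by (simp add: measure_preserving_def)
    finally show "measure_preserving (M \<Otimes>\<^sub>M N) (M \<Otimes>\<^sub>M N) (map_prod (T t) (S t))"
      unfolding measure_preserving_def map_prod_def by simp
  qed (auto simp: space_pair_measure M.T_zero M.T_add N.T_zero N.T_add)
qed

text \<open>If \<open>g\<close> were positive almost everywhere, its integral could not vanish; so
  the set of positivity is null. Invariance enters later, as the source of the dichotomy, for
  \<open>g\<close> and for \<open>- g\<close>.\<close>

lemma integrable_AE_nonneg_pos:
  fixes g :: "'a \<Rightarrow> real"
  assumes M: "prob_space M" and g: "integrable M g" "(\<integral>x. g x \<partial>M) = 0"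
    and dich: "measure M {x \<in> space M. 0 < g x} = 0 \<or> measure M {x \<in> space M. 0 < g x} = 1"
  shows "AE x in M. g x \<le> 0"
proof -
  interpret prob_space M by fact
  have [measurable]: "g \<in> borel_measurable M" using g by auto
  have "measure M {x \<in> space M. 0 < g x} \<noteq> 1"
  proof
    assume 1: "measure M {x \<in> space M. 0 < g x} = 1"
    then have pos: "AE x in M. 0 < g x" by (subst (asm) prob_Collect_eq_1) auto
    then have "AE x in M. 0 \<le> g x" by eventually_elim simp
    then have "AE x in M. g x = 0" using integral_nonneg_eq_0_iff_AE[OF g(1)] g(2) by simp
    with pos have "AE x in M. False" by eventually_elim simp
    then show False by simp
  qed
  then have "measure M {x \<in> space M. 0 < g x} = 0" using dich by simp
  then have "AE x in M. \<not> 0 < g x" by (subst (asm) prob_Collect_eq_0) auto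
  then show ?thesis by eventually_elim simp
qed

lemma ergodic_integral_zero:
  fixes g :: "'a \<Rightarrow> real"
  assumes M: "prob_space M" and erg: "ergodic M S" and g: "integrable M g" "(\<integral>x. g x \<partial>M) = 0"
    and inv: "\<And>t. AE x in M. g (S t x) = g x" and sp: "\<And>t x. x \<in> space M \<Longrightarrow> S t x \<in> space M"
  shows "AE x in M. g x = 0"
proof -
  have [measurable]: "g \<in> borel_measurable M" using g by auto
  have "AE x in M. g x \<le> 0"
  proof (rule integrable_AE_nonneg_pos[OF M g])
    have "{x \<in> space M. 0 < g x} \<in> sets M" by measurable
    moreover have "AE x in M. S t x \<in> {x \<in> space M. 0 < g x} \<longleftrightarrow> x \<in> {x \<in> space M. 0 < g x}" for t
      using inv[of t] AE_space by eventually_elim (auto simp: sp)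
    ultimately show "measure M {x \<in> space M. 0 < g x} = 0 \<or> measure M {x \<in> space M. 0 < g x} = 1"
      using erg unfolding ergodic_def by blast
  qed
  moreover have "AE x in M. - g x \<le> 0"
  proof (rule integrable_AE_nonneg_pos[OF M])
    have "{x \<in> space M. 0 < - g x} \<in> sets M" by measurable
    moreover have "AE x in M. S t x \<in> {x \<in> space M. 0 < - g x} \<longleftrightarrow> x \<in> {x \<in> space M. 0 < - g x}" for t
      using inv[of t] AE_space by eventually_elim (auto simp: sp)
    ultimately show "measure M {x \<in> space M. 0 < - g x} = 0 \<or> measure M {x \<in> space M. 0 < - g x} = 1"
      using erg unfolding ergodic_def by blast
  qed (use g in auto)
  ultimately show ?thesis by eventually_elim simp
qed

text \<open>The minimal-norm element of the closed convex hull of an orbit is invariant, hence zero.\<close>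

lemma (in mp_action) ergodic_convex_averages:
  fixes F :: "'a \<Rightarrow> real"
  assumes erg: "ergodic M T" and F [measurable]: "F \<in> borel_measurable M"
    and bdd: "\<And>x. x \<in> space M \<Longrightarrow> \<bar>F x\<bar> \<le> 1" and mean: "(\<integral>x. F x \<partial>M) = 0" and eps: "\<epsilon> > 0"
  shows "\<exists>ws. convex_weights ws \<and> (\<integral>x. (average ws (\<lambda>t. F (T t x)))\<^sup>2 \<partial>M) < \<epsilon>"
proof -
  define Q where "Q ws x = complex_of_real (average ws (\<lambda>t. F (T t x)))" for ws x
  \<comment> \<open>With linear part 0 the functional \<open>J\<close> is the squared norm
    itself.\<close>
  define D where "D = {(Q ws, 0 :: complex) |ws. convex_weights ws}"
  define J where "J q r = (\<integral>x. (cmod (q x))\<^sup>2 \<partial>M) - 2 * Re r" for q :: "'a \<Rightarrow> complex" and r :: complex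
  have [measurable]: "Q ws \<in> borel_measurable M" for ws unfolding Q_def by measurable
  have Q_bdd: "cmod (Q ws x) \<le> 1" if "convex_weights ws" "x \<in> space M" for ws x
  proof -
    have "\<bar>average ws (\<lambda>t. F (T t x))\<bar> \<le> average ws (\<lambda>t. \<bar>F (T t x)\<bar>)"
      using norm_average_le[OF that(1), of "\<lambda>t. F (T t x)"] by simp
    also have "\<dots> \<le> 1" by (rule average_le_const[OF that(1)]) (simp add: bdd T_space that(2))
    finally show ?thesis unfolding Q_def by simp
  qed
  have Q_L2: "Q ws \<in> L2 M" if "convex_weights ws" for ws
    by (rule L2_bounded[of _ 1]) (use Q_bdd[OF that] in auto)
  have L2D: "q \<in> L2 M" if "(q, r) \<in> D" for q r
    using that unfolding D_def by (auto intro: Q_L2)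
  have "([(1, 0)], 0 :: real) \<in> {(ws, r). convex_weights ws}" by (simp add: convex_weights_def)
  then have ne: "D \<noteq> {}" unfolding D_def by blast
  have mid: "(\<lambda>x. (q x + q' x) / 2, (r + r') / 2) \<in> D" if D: "(q, r) \<in> D" "(q', r') \<in> D" for q r q' r'
  proof -
    obtain ws vs where "q = Q ws" "q' = Q vs" "r = 0" "r' = 0" "convex_weights ws" "convex_weights vs"
      using D unfolding D_def by blast
    moreover have "(\<lambda>x. (Q ws x + Q vs x) / 2) = Q (midpoint_weights ws vs)" for ws vs
      unfolding Q_def average_midpoint by (auto simp: scaleR_conv_of_real)
    ultimately show ?thesis unfolding D_def using convex_weights_midpoint by auto
  qed
  have lower: "0 \<le> J q r" if "(q, r) \<in> D" for q r
    using that unfolding D_def J_def by auto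
  obtain G m where G: "G \<in> L2 M" and near: "\<And>\<delta>. \<delta> > 0 \<Longrightarrow> \<exists>q r. (q, r) \<in> D \<and> J q r < m + \<delta>"
    and close: "\<And>q r. (q, r) \<in> D \<Longrightarrow> (\<integral>x. (cmod (q x - G x))\<^sup>2 \<partial>M) \<le> 4 * (J q r - m)"
    by (rule L2_minimizer[of D M J 0, OF ne L2D mid J_def lower]) blast+
  have [measurable]: "G \<in> borel_measurable M" by (rule L2_measurable[OF G])
  have approx: "\<exists>ws. convex_weights ws \<and> J (Q ws) 0 < m + \<delta> \<and> (\<integral>x. (cmod (Q ws x - G x))\<^sup>2 \<partial>M) \<le> 4 * \<delta>"
    if del: "\<delta> > 0" for \<delta>
  proof -
    obtain ws where ws: "convex_weights ws" "J (Q ws) 0 < m + \<delta>"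
      using near[OF del] unfolding D_def by blast
    then have "(\<integral>x. (cmod (Q ws x - G x))\<^sup>2 \<partial>M) \<le> 4 * (J (Q ws) 0 - m)"
      by (intro close) (auto simp: D_def)
    then show ?thesis using ws by (intro exI[of _ ws]) auto
  qed
  have GT_L2: "(\<lambda>x. G (T s x)) \<in> L2 M" for s
  proof -
    have "integrable (distr M M (T s)) (\<lambda>x. (cmod (G x))\<^sup>2)"
      using T_mp[of s] L2_integrable_power2[OF G] unfolding measure_preserving_def by simp
    then show ?thesis unfolding L2_def by (subst (asm) integrable_distr_eq) auto
  qed
  \<comment> \<open>Shifting the weights by \<open>s\<close> composes the average with
    \<open>T s\<close>, which preserves the norm, so a shifted near-minimizer is again one. It is
    close both to \<open>G\<close> and to the shift of \<open>G\<close>, since near-minimizers are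
    unique up to a small error.\<close>
  have inv: "AE x in M. G (T s x) = G x" for s
  proof -
    have "(\<integral>x. (cmod (G x - G (T s x)))\<^sup>2 \<partial>M) \<le> \<eta>" if eta: "\<eta> > 0" for \<eta>
    proof -
      have "\<eta> / 16 > 0" using eta by simp
      from approx[OF this] obtain ws where ws: "convex_weights ws" "J (Q ws) 0 < m + \<eta> / 16"
        "(\<integral>x. (cmod (Q ws x - G x))\<^sup>2 \<partial>M) \<le> \<eta> / 4" by auto
      define vs where "vs = shift_weights s ws"
      have vs: "convex_weights vs" unfolding vs_def by (rule convex_weights_shift[OF ws(1)])
      have QT: "Q vs x = Q ws (T s x)" if "x \<in> space M" for x
        unfolding Q_def vs_def average_shift using that by (simp add: T_add)
      have "J (Q vs) 0 = (\<integral>x. (cmod (Q ws (T s x)))\<^sup>2 \<partial>M)"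
        unfolding J_def using QT by (auto intro!: Bochner_Integration.integral_cong)
      also have "\<dots> = J (Q ws) 0"
        unfolding J_def by (subst measure_preserving_integral[OF T_mp]) auto
      finally have "J (Q vs) 0 < m + \<eta> / 16" using ws(2) by simp
      moreover have "(\<integral>x. (cmod (Q vs x - G x))\<^sup>2 \<partial>M) \<le> 4 * (J (Q vs) 0 - m)"
        by (rule close) (use vs in \<open>auto simp: D_def\<close>)
      ultimately have 1: "(\<integral>x. (cmod (G x - Q vs x))\<^sup>2 \<partial>M) \<le> \<eta> / 4" by (simp add: norm_minus_commute)
      have "(\<integral>x. (cmod (Q vs x - G (T s x)))\<^sup>2 \<partial>M) = (\<integral>x. (cmod (Q ws (T s x) - G (T s x)))\<^sup>2 \<partial>M)"
        using QT by (auto intro!: Bochner_Integration.integral_cong)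
      also have "\<dots> = (\<integral>x. (cmod (Q ws x - G x))\<^sup>2 \<partial>M)"
        by (subst measure_preserving_integral[OF T_mp, where g="\<lambda>x. (cmod (Q ws x - G x))\<^sup>2"]) auto
      finally have 2: "(\<integral>x. (cmod (Q vs x - G (T s x)))\<^sup>2 \<partial>M) \<le> \<eta> / 4" using ws(3) by simp
      show ?thesis using L2_triangle[OF G Q_L2[OF vs] GT_L2[of s]] 1 2 by argo
    qed
    then have "(\<integral>x. (cmod (G x - G (T s x)))\<^sup>2 \<partial>M) \<le> 0" by (rule field_le_epsilon[of _ 0, simplified])
    moreover have "0 \<le> (\<integral>x. (cmod (G x - G (T s x)))\<^sup>2 \<partial>M)" by simp
    ultimately have "(\<integral>x. (cmod (G x - G (T s x)))\<^sup>2 \<partial>M) = 0" by linarith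
    then have "AE x in M. (cmod (G x - G (T s x)))\<^sup>2 = 0"
      using integral_nonneg_eq_0_iff_AE[OF L2_integrable_power2[OF L2_diff[OF G GT_L2]]] by simp
    then show ?thesis by eventually_elim simp
  qed
  have one: "(\<lambda>_. 1) \<in> L2 M" by (rule L2_bounded[of _ 1]) auto
  have G1: "integrable M G" using L2_integrable_mult[OF G one] by simp
  have G_mean: "(\<integral>x. G x \<partial>M) = 0"
  proof -
    have "(cmod (\<integral>x. G x \<partial>M))\<^sup>2 \<le> \<eta>" if eta: "\<eta> > 0" for \<eta>
    proof -
      have "\<eta> / 4 > 0" using eta by simp
      from approx[OF this] obtain ws where ws: "convex_weights ws"
        "(\<integral>x. (cmod (Q ws x - G x))\<^sup>2 \<partial>M) \<le> \<eta>" by auto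
      have iF: "integrable M (\<lambda>x. F (T t x))" for t
        by (rule integrable_const_bound[of _ 1]) (auto simp: bdd T_space)
      have "(\<integral>x. Q ws x \<partial>M) = of_real (\<integral>x. average ws (\<lambda>t. F (T t x)) \<partial>M)"
        unfolding Q_def by simp
      also have "(\<integral>x. average ws (\<lambda>t. F (T t x)) \<partial>M) = average ws (\<lambda>t. \<integral>x. F (T t x) \<partial>M)"
        by (rule average_integral[OF iF])
      also have "\<dots> = average ws (\<lambda>t. 0)"
        using measure_preserving_integral[OF T_mp F] mean by simp
      also have "\<dots> = 0" by (rule average_const[OF ws(1)])
      finally have Q0: "(\<integral>x. Q ws x \<partial>M) = 0" by simp
      have "integrable M (Q ws)" using L2_integrable_mult[OF Q_L2[OF ws(1)] one] by simp
      then have "(\<integral>x. (Q ws x - G x) * 1 \<partial>M) = - (\<integral>x. G x \<partial>M)" using G1 Q0 by simp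
      then show ?thesis
        using L2_cauchy_schwarz_norm[OF L2_diff[OF Q_L2[OF ws(1)] G] one] ws(2) prob_space by simp
    qed
    then have "(cmod (\<integral>x. G x \<partial>M))\<^sup>2 \<le> 0" by (rule field_le_epsilon[of _ 0, simplified])
    then show ?thesis by simp
  qed
  have "AE x in M. Re (G x) = 0"
  proof (rule ergodic_integral_zero[OF prob_space_axioms erg])
    show "integrable M (\<lambda>x. Re (G x))" using G1 by simp
    show "(\<integral>x. Re (G x) \<partial>M) = 0" using integral_Re[OF G1] G_mean by simp
    show "AE x in M. Re (G (T t x)) = Re (G x)" for t using inv[of t] by eventually_elim simp
  qed (rule T_space)
  moreover have "AE x in M. Im (G x) = 0"
  proof (rule ergodic_integral_zero[OF prob_space_axioms erg])
    show "integrable M (\<lambda>x. Im (G x))" using G1 by simp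
    show "(\<integral>x. Im (G x) \<partial>M) = 0" using integral_Im[OF G1] G_mean by simp
    show "AE x in M. Im (G (T t x)) = Im (G x)" for t using inv[of t] by eventually_elim simp
  qed (rule T_space)
  ultimately have G0: "AE x in M. G x = 0" by eventually_elim (simp add: complex_eq_iff)
  \<comment> \<open>\<open>approx\<close> multiplies the excess by 4, and
    \<open>4 * (\<epsilon> / 5)\<close> stays strictly below \<open>\<epsilon>\<close>.\<close>
  have "\<epsilon> / 5 > 0" using eps by simp
  from approx[OF this] obtain ws where ws: "convex_weights ws"
    "(\<integral>x. (cmod (Q ws x - G x))\<^sup>2 \<partial>M) \<le> 4 * (\<epsilon> / 5)" by blast
  have "(\<integral>x. (cmod (Q ws x - G x))\<^sup>2 \<partial>M) = (\<integral>x. (average ws (\<lambda>t. F (T t x)))\<^sup>2 \<partial>M)"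
    using G0 by (intro integral_cong_AE) (auto simp: Q_def)
  then show ?thesis using ws eps by (intro exI[of _ ws]) auto
qed

section \<open>Covariances of sets\<close>

definition corr :: "'a measure \<Rightarrow> (real \<Rightarrow> 'a \<Rightarrow> 'a) \<Rightarrow> 'a set \<Rightarrow> 'a set \<Rightarrow> real \<Rightarrow> real" where
  "corr M T C D t = measure M {x \<in> space M. T t x \<in> C \<and> x \<in> D}"

definition cov :: "'a measure \<Rightarrow> (real \<Rightarrow> 'a \<Rightarrow> 'a) \<Rightarrow> 'a set \<Rightarrow> 'a set \<Rightarrow> real \<Rightarrow> real" where
  "cov M T C D t = corr M T C D t - measure M C * measure M D"

text \<open>The version of weak mixing that is transported: it is inherited by factors and by finite
  products, and it makes spectral measures atomless.\<close>

definition mixing_sets :: "'a measure \<Rightarrow> (real \<Rightarrow> 'a \<Rightarrow> 'a) \<Rightarrow> bool" where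
  "mixing_sets M T \<longleftrightarrow> (\<forall>C\<in>sets M. \<forall>D\<in>sets M. averages_to_zero (\<lambda>t. \<bar>cov M T C D t\<bar>))"

text \<open>The square of a covariance is a correlation on the product space, of the tensor square
  \<open>F\<close> of the centered indicator of \<open>C\<close> with the indicator of
  \<open>D \<times> D\<close>. Ergodicity of the product action makes some convex average of
  translates of \<open>F\<close> small, hence averages of the squared covariances, hence averages of
  their absolute values.\<close>

lemma (in mp_action) weakly_mixing_imp_mixing_sets:
  assumes wm: "weakly_mixing M T"
  shows "mixing_sets M T"
  unfolding mixing_sets_def
proof (intro ballI)
  fix C D assume [measurable]: "C \<in> sets M" "D \<in> sets M"
  interpret MM: pair_prob_space M M ..
  interpret W: mp_action "M \<Otimes>\<^sub>M M" "\<lambda>t. map_prod (T t) (T t)"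
    by (rule mp_action_pair) unfold_locales
  define f where "f x = indicator C x - measure M C" for x
  define d where "d x = (indicator D x :: real)" for x
  have [measurable]: "f \<in> borel_measurable M" "d \<in> borel_measurable M" unfolding f_def d_def by measurable
  have f1: "\<bar>f x\<bar> \<le> 1" for x
    unfolding f_def using measure_nonneg[of M C] prob_le_1[of C] by (simp add: indicator_def)
  have d1: "0 \<le> d x" "d x \<le> 1" for x unfolding d_def by (auto simp: indicator_def)
  have intf: "integrable M (\<lambda>x. f (T t x) * d x)" for t
  proof (rule integrable_const_bound[of _ 1])
    have "\<bar>f (T t x)\<bar> * d x \<le> 1 * 1" for x by (intro mult_mono) (auto simp: f1 d1)
    then show "AE x in M. norm (f (T t x) * d x) \<le> 1" using d1 by (simp add: abs_mult)
  qed measurable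
  have cov: "cov M T C D t = (\<integral>x. f (T t x) * d x \<partial>M)" for t
  proof -
    have "(\<integral>x. f (T t x) * d x \<partial>M)
        = (\<integral>x. indicator {x \<in> space M. T t x \<in> C \<and> x \<in> D} x - measure M C * indicator D x \<partial>M)"
      by (intro Bochner_Integration.integral_cong) (auto simp: f_def d_def indicator_def T_space)
    also have "\<dots> = cov M T C D t"
      unfolding cov_def corr_def
      by (subst Bochner_Integration.integral_diff) (auto simp: emeasure_eq_measure)
    finally show ?thesis by simp
  qed
  define F where "F w = f (fst w) * f (snd w)" for w
  have [measurable]: "F \<in> borel_measurable (M \<Otimes>\<^sub>M M)" unfolding F_def by measurable
  have F1: "\<bar>F w\<bar> \<le> 1" for w
    unfolding F_def abs_mult using mult_mono[OF f1[of "fst w"] f1[of "snd w"]] by simp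
  have iF: "integrable (M \<Otimes>\<^sub>M M) F" by (rule MM.P.integrable_const_bound[of _ 1]) (auto simp: F1)
  have sq: "(cov M T C D t)\<^sup>2 = (\<integral>w. F (map_prod (T t) (T t) w) * (d (fst w) * d (snd w)) \<partial>(M \<Otimes>\<^sub>M M))" for t
  proof -
    have int: "integrable (M \<Otimes>\<^sub>M M) (\<lambda>w. (f (T t (fst w)) * d (fst w)) * (f (T t (snd w)) * d (snd w)))"
    proof (rule MM.P.integrable_const_bound[of _ 1])
      have "\<bar>f (T t x) * d x\<bar> \<le> 1" for x
        unfolding abs_mult using mult_mono[OF f1[of "T t x"], of "\<bar>d x\<bar>" 1] d1[of x] by simp
      then have "\<bar>f (T t x) * d x\<bar> * \<bar>f (T t y) * d y\<bar> \<le> 1 * 1" for x y by (intro mult_mono) auto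
      then show "AE w in M \<Otimes>\<^sub>M M. norm ((f (T t (fst w)) * d (fst w)) * (f (T t (snd w)) * d (snd w))) \<le> 1"
        by (simp add: abs_mult)
    qed measurable
    have "(cov M T C D t)\<^sup>2 = (\<integral>x. \<integral>y. (f (T t x) * d x) * (f (T t y) * d y) \<partial>M \<partial>M)"
      unfolding cov power2_eq_square by simp
    also have "\<dots> = (\<integral>w. (f (T t (fst w)) * d (fst w)) * (f (T t (snd w)) * d (snd w)) \<partial>(M \<Otimes>\<^sub>M M))"
      using MM.integral_fst'[OF int] by simp
    finally show ?thesis by (simp add: F_def mult_ac)
  qed
  have F_mean: "(\<integral>w. F w \<partial>(M \<Otimes>\<^sub>M M)) = 0"
  proof -
    have "integrable M f" by (rule integrable_const_bound[of _ 1]) (auto simp: f1)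
    have "(\<integral>x. f x \<partial>M) = 0"
      unfolding f_def by (subst Bochner_Integration.integral_diff) (auto simp: emeasure_eq_measure prob_space)
    then have "(\<integral>x. \<integral>y. F (x, y) \<partial>M \<partial>M) = 0" by (simp add: F_def)
    then show ?thesis using MM.integral_fst'[OF iF] by simp
  qed
  show "averages_to_zero (\<lambda>t. \<bar>cov M T C D t\<bar>)"
    unfolding averages_to_zero_def
  proof (intro allI impI)
    fix \<epsilon> :: real assume eps: "\<epsilon> > 0"
    \<comment> \<open>Two losses of a square root lie ahead: from the L2 to the L1 size of
      \<open>Q\<close>, and from squared covariances to absolute ones.\<close>
    then have "\<epsilon> ^ 4 > 0" by simp
    obtain ws where ws: "convex_weights ws"
      and small: "(\<integral>w. (average ws (\<lambda>t. F (map_prod (T t) (T t) w)))\<^sup>2 \<partial>(M \<Otimes>\<^sub>M M)) < \<epsilon> ^ 4"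
      using W.ergodic_convex_averages[OF wm[unfolded weakly_mixing_def] _ F1 F_mean \<open>\<epsilon> ^ 4 > 0\<close>] by auto
    define Q where "Q w = average ws (\<lambda>t. F (map_prod (T t) (T t) w))" for w
    have [measurable]: "Q \<in> borel_measurable (M \<Otimes>\<^sub>M M)"
      unfolding Q_def by (intro average_measurable) (use W.T_measurable in measurable)
    have Q1: "\<bar>Q w\<bar> \<le> 1" for w
    proof -
      have "average ws (\<lambda>t. norm (F (map_prod (T t) (T t) w))) \<le> 1"
        by (rule average_le_const[OF ws]) (simp add: F1)
      then show ?thesis
        using norm_average_le[OF ws, of "\<lambda>t. F (map_prod (T t) (T t) w)"] unfolding Q_def by simp
    qed
    have iQ: "integrable (M \<Otimes>\<^sub>M M) (\<lambda>w. \<bar>Q w\<bar>)" "integrable (M \<Otimes>\<^sub>M M) (\<lambda>w. (Q w)\<^sup>2)"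
      by (rule MM.P.integrable_const_bound[of _ 1]; auto simp: Q1 abs_square_le_1)+
    \<comment> \<open>AM-GM: \<open>u \<le> (u\<^sup>2 / c + c) / 2\<close>\<close>
    have amgm: "u \<le> (u\<^sup>2 / c + c) / 2" if "c > 0" for u c :: real
    proof -
      have "2 * u * c \<le> u\<^sup>2 + c\<^sup>2" by (rule sum_squares_bound)
      then show ?thesis using that by (simp add: field_simps power2_eq_square)
    qed
    have absQ: "(\<integral>w. \<bar>Q w\<bar> \<partial>(M \<Otimes>\<^sub>M M)) < \<epsilon>\<^sup>2"
    proof -
      have "(\<integral>w. \<bar>Q w\<bar> \<partial>(M \<Otimes>\<^sub>M M)) \<le> (\<integral>w. ((Q w)\<^sup>2 / \<epsilon>\<^sup>2 + \<epsilon>\<^sup>2) / 2 \<partial>(M \<Otimes>\<^sub>M M))"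
        using iQ amgm[of "\<epsilon>\<^sup>2" "\<bar>Q _\<bar>"] eps by (intro integral_mono) auto
      also have "\<dots> = ((\<integral>w. (Q w)\<^sup>2 \<partial>(M \<Otimes>\<^sub>M M)) / \<epsilon>\<^sup>2 + \<epsilon>\<^sup>2) / 2"
        using iQ MM.P.prob_space by simp
      also have "\<dots> < (\<epsilon> ^ 4 / \<epsilon>\<^sup>2 + \<epsilon>\<^sup>2) / 2"
        using small eps unfolding Q_def[symmetric] by (simp add: divide_strict_right_mono)
      also have "\<dots> = \<epsilon>\<^sup>2" using eps by (simp add: power_diff[symmetric] power4_eq_xxxx power2_eq_square)
      finally show ?thesis .
    qed
    have "average ws (\<lambda>t. \<bar>cov M T C D (t + s)\<bar>) < \<epsilon>" for s
    proof -
      have Qs: "average ws (\<lambda>t. F (map_prod (T (t + s)) (T (t + s)) w)) = Q (map_prod (T s) (T s) w)"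
        if "w \<in> space (M \<Otimes>\<^sub>M M)" for w
        unfolding Q_def using W.T_add[OF that] by simp
      have iFs: "integrable (M \<Otimes>\<^sub>M M) (\<lambda>w. F (map_prod (T t) (T t) w) * (d (fst w) * d (snd w)))" for t
      proof (rule MM.P.integrable_const_bound[of _ 1])
        have "\<bar>F w\<bar> * (d x * d y) \<le> 1 * (1 * 1)" for w x y by (intro mult_mono) (auto simp: F1 d1)
        then show "AE w in M \<Otimes>\<^sub>M M. norm (F (map_prod (T t) (T t) w) * (d (fst w) * d (snd w))) \<le> 1"
          using d1 by (simp add: abs_mult)
      qed (use W.T_measurable in measurable)
      have "average ws (\<lambda>t. (cov M T C D (t + s))\<^sup>2)
          = (\<integral>w. average ws (\<lambda>t. F (map_prod (T (t + s)) (T (t + s)) w) * (d (fst w) * d (snd w))) \<partial>(M \<Otimes>\<^sub>M M))"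
        unfolding sq by (rule average_integral[symmetric, OF iFs])
      also have "\<dots> = (\<integral>w. Q (map_prod (T s) (T s) w) * (d (fst w) * d (snd w)) \<partial>(M \<Otimes>\<^sub>M M))"
        unfolding average_mult_left by (intro Bochner_Integration.integral_cong) (auto simp: Qs)
      also have "\<dots> \<le> (\<integral>w. \<bar>Q (map_prod (T s) (T s) w)\<bar> \<partial>(M \<Otimes>\<^sub>M M))"
      proof (rule integral_mono')
        show "integrable (M \<Otimes>\<^sub>M M) (\<lambda>w. \<bar>Q (map_prod (T s) (T s) w)\<bar>)"
          by (rule MM.P.integrable_const_bound[of _ 1]) (use W.T_measurable in \<open>auto simp: Q1\<close>)
        fix w
        have "Q v * (d x * d y) \<le> \<bar>Q v\<bar> * (1 * 1)" for v x y
          by (intro mult_mono) (auto simp: d1)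
        then show "Q (map_prod (T s) (T s) w) * (d (fst w) * d (snd w)) \<le> \<bar>Q (map_prod (T s) (T s) w)\<bar>" by simp
      qed auto
      \<comment> \<open>The shift \<open>s\<close> drops out because the product action preserves
        the measure; this is the source of uniformity in \<open>s\<close>.\<close>
      also have "\<dots> = (\<integral>w. \<bar>Q w\<bar> \<partial>(M \<Otimes>\<^sub>M M))"
        by (rule measure_preserving_integral[OF W.T_mp, where g="\<lambda>w. \<bar>Q w\<bar>"]) measurable
      finally have avg2: "average ws (\<lambda>t. (cov M T C D (t + s))\<^sup>2) < \<epsilon>\<^sup>2" using absQ by simp
      have "average ws (\<lambda>t. \<bar>cov M T C D (t + s)\<bar>) \<le> average ws (\<lambda>t. (cov M T C D (t + s))\<^sup>2 * (1 / (2 * \<epsilon>)) + \<epsilon> / 2)"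
        using amgm[of \<epsilon> "\<bar>cov M T C D (_ + s)\<bar>"] eps by (intro average_mono[OF ws]) (simp add: field_simps)
      also have "\<dots> = average ws (\<lambda>t. (cov M T C D (t + s))\<^sup>2) * (1 / (2 * \<epsilon>)) + \<epsilon> / 2"
        by (simp only: average_add average_mult_left average_const[OF ws])
      also have "\<dots> < \<epsilon>\<^sup>2 * (1 / (2 * \<epsilon>)) + \<epsilon> / 2"
        using avg2 eps by (intro add_strict_right_mono mult_strict_right_mono) auto
      also have "\<dots> = \<epsilon>" using eps by (simp add: power2_eq_square)
      finally show ?thesis .
    qed
    then show "\<exists>ws. convex_weights ws \<and> (\<forall>s. average ws (\<lambda>t. \<bar>cov M T C D (t + s)\<bar>) < \<epsilon>)"
      using ws by blast
  qed
qed

section \<open>Extension from generators to all measurable sets\<close>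

text \<open>The \<open>\<pi>\<close>-\<open>\<lambda>\<close> argument for set functions with values
  in functions of \<open>t\<close>. The bound by the measure makes the values on partial unions
  converge uniformly in \<open>t\<close>, so \<open>P\<close> need only be closed under uniform
  limits. Statements without a time are obtained with a dummy \<open>t\<close>.\<close>

lemma additive_family_induct:
  fixes \<kappa> :: "'a set \<Rightarrow> real \<Rightarrow> real" and P :: "(real \<Rightarrow> real) \<Rightarrow> bool"
  assumes M: "prob_space M" and gen: "sets M = sigma_sets (space M) \<G>" "Int_stable \<G>" "\<G> \<subseteq> Pow (space M)"
    and compl: "\<And>A t. A \<in> sets M \<Longrightarrow> \<kappa> (space M - A) t = - \<kappa> A t"
    and add: "\<And>A B t. A \<in> sets M \<Longrightarrow> B \<in> sets M \<Longrightarrow> A \<inter> B = {} \<Longrightarrow> \<kappa> (A \<union> B) t = \<kappa> A t + \<kappa> B t"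
    and bound: "\<And>A t. A \<in> sets M \<Longrightarrow> \<bar>\<kappa> A t\<bar> \<le> 2 * measure M A"
    and P0: "P (\<lambda>_. 0)" and Pneg: "\<And>f. P f \<Longrightarrow> P (\<lambda>t. - f t)"
    and Padd: "\<And>f g. P f \<Longrightarrow> P g \<Longrightarrow> P (\<lambda>t. f t + g t)"
    and Plim: "\<And>f. (\<And>\<epsilon>. \<epsilon> > 0 \<Longrightarrow> \<exists>g. P g \<and> (\<forall>t. \<bar>f t - g t\<bar> \<le> \<epsilon>)) \<Longrightarrow> P f"
    and basic: "\<And>A. A \<in> \<G> \<Longrightarrow> P (\<kappa> A)"
    and A: "A \<in> sets M"
  shows "P (\<kappa> A)"
proof -
  interpret prob_space M by fact
  have empty: "\<kappa> {} = (\<lambda>_. 0)" using add[of "{}" "{}"] by auto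
  have "A \<in> sigma_sets (space M) \<G>" using A gen(1) by simp
  with gen(2,3) show ?thesis
  proof (induction rule: sigma_sets_induct_disjoint)
    case (basic A)
    then show ?case by (rule assms(12))
  next
    case empty
    then show ?case using \<open>\<kappa> {} = (\<lambda>_. 0)\<close> P0 by simp
  next
    case (compl A)
    then have "A \<in> sets M" using gen(1) by simp
    then have "\<kappa> (space M - A) = (\<lambda>t. - \<kappa> A t)" using assms(5) by auto
    then show ?case using compl.IH Pneg by simp
  next
    case (union A)
    have sA [measurable]: "A i \<in> sets M" for i using union(2) gen(1) by auto
    define B where "B n = (\<Union>i<n. A i)" for n :: nat
    define U where "U = (\<Union>i. A i)"
    have [measurable]: "B n \<in> sets M" "U \<in> sets M" for n unfolding B_def U_def by measurable
    have BU: "B n \<subseteq> U" for n unfolding B_def U_def by auto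
    have PB: "P (\<kappa> (B n))" for n
    proof (induction n)
      case 0
      then show ?case unfolding B_def using empty P0 by simp
    next
      case (Suc n)
      have "A i \<inter> A n = {}" if "i < n" for i
        using union(1) that by (intro disjoint_family_onD[of A UNIV]) auto
      then have "B (Suc n) = B n \<union> A n" "B n \<inter> A n = {}"
        unfolding B_def by (auto simp: lessThan_Suc)
      then have "\<kappa> (B (Suc n)) = (\<lambda>t. \<kappa> (B n) t + \<kappa> (A n) t)" using add[of "B n" "A n"] by auto
      then show ?case using Padd[OF Suc union(3)[of n]] by simp
    qed
    have "incseq B" unfolding incseq_def B_def by (intro allI impI UN_mono) auto
    then have "(\<lambda>n. measure M (B n)) \<longlonglongrightarrow> measure M (\<Union>n. B n)"
      by (intro finite_Lim_measure_incseq) auto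
    moreover have "(\<Union>n. B n) = U" unfolding B_def U_def by blast
    ultimately have lim: "(\<lambda>n. measure M (B n)) \<longlonglongrightarrow> measure M U" by simp
    have "P (\<kappa> U)"
    proof (rule Plim)
      fix \<epsilon> :: real assume "\<epsilon> > 0"
      then have "\<epsilon> / 2 > 0" by simp
      from metric_LIMSEQ_D[OF lim this] obtain n where n: "dist (measure M (B n)) (measure M U) < \<epsilon> / 2" by blast
      have "\<bar>\<kappa> U t - \<kappa> (B n) t\<bar> \<le> \<epsilon>" for t
      proof -
        have "B n \<union> (U - B n) = U" using BU by auto
        then have "\<kappa> U t = \<kappa> (B n) t + \<kappa> (U - B n) t" using add[of "B n" "U - B n" t] by auto
        then have "\<bar>\<kappa> U t - \<kappa> (B n) t\<bar> \<le> 2 * measure M (U - B n)" using bound[of "U - B n" t] by auto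
        also have "measure M (U - B n) = measure M U - measure M (B n)"
          by (rule finite_measure_Diff) (auto intro: subsetD[OF BU])
        finally show ?thesis using n by (simp add: dist_real_def)
      qed
      then show "\<exists>g. P g \<and> (\<forall>t. \<bar>\<kappa> U t - g t\<bar> \<le> \<epsilon>)" using PB by blast
    qed
    then show ?case unfolding U_def .
  qed
qed

lemma averages_to_zero_const: "averages_to_zero (\<lambda>_. 0)"
  unfolding averages_to_zero_def
  by (auto intro!: exI[of _ "[(1, 0)]"] simp: convex_weights_def)

lemma averages_to_zero_sum:
  assumes "\<And>i. i \<in> I \<Longrightarrow> averages_to_zero (a i)"
  shows "averages_to_zero (\<lambda>t. \<Sum>i\<in>I. a i t)"
  using assms
proof (induction I rule: infinite_finite_induct)
  case (insert i I)
  then show ?case using averages_to_zero_add[of "a i" "\<lambda>t. \<Sum>i\<in>I. a i t"] by simp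
qed (simp_all add: averages_to_zero_const)

lemma averages_to_zero_limit:
  assumes "\<And>\<epsilon>. \<epsilon> > 0 \<Longrightarrow> \<exists>b. averages_to_zero b \<and> (\<forall>t. a t \<le> b t + \<epsilon>)"
  shows "averages_to_zero a"
  unfolding averages_to_zero_def
proof (intro allI impI)
  fix \<epsilon> :: real assume "\<epsilon> > 0"
  then have e: "\<epsilon> / 2 > 0" by simp
  from assms[OF this] obtain b where b: "averages_to_zero b" "\<And>t. a t \<le> b t + \<epsilon> / 2" by blast
  then obtain ws where ws: "convex_weights ws" "\<And>s. average ws (\<lambda>t. b (t + s)) < \<epsilon> / 2"
    using e unfolding averages_to_zero_def by blast
  have "average ws (\<lambda>t. a (t + s)) < \<epsilon>" for s
  proof -
    have "average ws (\<lambda>t. a (t + s)) \<le> average ws (\<lambda>t. b (t + s) + \<epsilon> / 2)" by (rule average_mono[OF ws(1) b(2)])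
    also have "\<dots> = average ws (\<lambda>t. b (t + s)) + \<epsilon> / 2" by (simp add: average_add average_const[OF ws(1)])
    finally show ?thesis using ws(2)[of s] by simp
  qed
  then show "\<exists>ws. convex_weights ws \<and> (\<forall>s. average ws (\<lambda>t. a (t + s)) < \<epsilon>)" using ws(1) by blast
qed

context mp_action
begin

lemma corr_le:
  assumes [measurable]: "C \<in> sets M" "D \<in> sets M"
  shows "corr M T C D t \<le> measure M C" "corr M T C D t \<le> measure M D"
proof -
  have "corr M T C D t \<le> measure M {x \<in> space M. T t x \<in> C}"
    unfolding corr_def by (rule finite_measure_mono) auto
  then show "corr M T C D t \<le> measure M C" by (simp add: measure_preserving_measure[OF T_mp])
  show "corr M T C D t \<le> measure M D"
    unfolding corr_def by (rule finite_measure_mono) auto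
qed

lemma cov_bound:
  assumes "C \<in> sets M" "D \<in> sets M"
  shows "\<bar>cov M T C D t\<bar> \<le> 2 * measure M C" "\<bar>cov M T C D t\<bar> \<le> 2 * measure M D"
proof -
  have "0 \<le> corr M T C D t" unfolding corr_def by simp
  moreover have "measure M C * measure M D \<le> measure M C * 1" "measure M C * measure M D \<le> 1 * measure M D"
    by (intro mult_mono; simp)+
  moreover have "0 \<le> measure M C * measure M D" by simp
  ultimately show "\<bar>cov M T C D t\<bar> \<le> 2 * measure M C" "\<bar>cov M T C D t\<bar> \<le> 2 * measure M D"
    using corr_le[OF assms, of t] measure_nonneg[of M C] measure_nonneg[of M D] unfolding cov_def abs_le_iff by linarith+
qed

lemma cov_compl:
  assumes [measurable]: "C \<in> sets M" "D \<in> sets M"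
  shows "cov M T (space M - C) D t = - cov M T C D t" "cov M T C (space M - D) t = - cov M T C D t"
proof -
  have D: "D \<subseteq> space M" by (rule sets.sets_into_space) fact
  have "{x \<in> space M. T t x \<in> space M - C \<and> x \<in> D} = D - {x \<in> space M. T t x \<in> C \<and> x \<in> D}"
    using D T_space by auto
  moreover have "measure M (D - {x \<in> space M. T t x \<in> C \<and> x \<in> D}) = measure M D - corr M T C D t"
    unfolding corr_def by (rule finite_measure_Diff) auto
  ultimately have "corr M T (space M - C) D t = measure M D - corr M T C D t"
    unfolding corr_def by simp
  then show "cov M T (space M - C) D t = - cov M T C D t"
    unfolding cov_def by (simp add: prob_compl algebra_simps)
  have "{x \<in> space M. T t x \<in> C \<and> x \<in> space M - D} = {x \<in> space M. T t x \<in> C} - {x \<in> space M. T t x \<in> C \<and> x \<in> D}"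
    by auto
  moreover have "measure M ({x \<in> space M. T t x \<in> C} - {x \<in> space M. T t x \<in> C \<and> x \<in> D}) = measure M C - corr M T C D t"
    unfolding corr_def by (subst finite_measure_Diff) (auto simp: measure_preserving_measure[OF T_mp])
  ultimately have "corr M T C (space M - D) t = measure M C - corr M T C D t"
    unfolding corr_def by simp
  then show "cov M T C (space M - D) t = - cov M T C D t"
    unfolding cov_def by (simp add: prob_compl algebra_simps)
qed

lemma cov_add:
  assumes [measurable]: "C \<in> sets M" "C' \<in> sets M" "D \<in> sets M" and disj: "C \<inter> C' = {}"
  shows "cov M T (C \<union> C') D t = cov M T C D t + cov M T C' D t"
    and "cov M T D (C \<union> C') t = cov M T D C t + cov M T D C' t"
proof -
  have m: "measure M (C \<union> C') = measure M C + measure M C'"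
    by (rule finite_measure_Union) (use disj in auto)
  have "{x \<in> space M. T t x \<in> C \<union> C' \<and> x \<in> D} = {x \<in> space M. T t x \<in> C \<and> x \<in> D} \<union> {x \<in> space M. T t x \<in> C' \<and> x \<in> D}"
    by auto
  then have "corr M T (C \<union> C') D t = corr M T C D t + corr M T C' D t"
    unfolding corr_def by (simp, subst finite_measure_Union) (use disj in auto)
  then show "cov M T (C \<union> C') D t = cov M T C D t + cov M T C' D t"
    unfolding cov_def m by (simp add: algebra_simps)
  have "{x \<in> space M. T t x \<in> D \<and> x \<in> C \<union> C'} = {x \<in> space M. T t x \<in> D \<and> x \<in> C} \<union> {x \<in> space M. T t x \<in> D \<and> x \<in> C'}"
    by auto
  then have "corr M T D (C \<union> C') t = corr M T D C t + corr M T D C' t"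
    unfolding corr_def by (simp, subst finite_measure_Union) (use disj in auto)
  then show "cov M T D (C \<union> C') t = cov M T D C t + cov M T D C' t"
    unfolding cov_def m by (simp add: algebra_simps)
qed

text \<open>The induction runs in one argument at a time: in \<open>C\<close> with \<open>D\<close>
  a generator, after that in \<open>D\<close> with \<open>C\<close> an arbitrary measurable
  set.\<close>

lemma cov_induct:
  fixes P :: "(real \<Rightarrow> real) \<Rightarrow> bool"
  assumes gen: "sets M = sigma_sets (space M) \<G>" "Int_stable \<G>" "\<G> \<subseteq> Pow (space M)"
    and P0: "P (\<lambda>_. 0)" and Pneg: "\<And>f. P f \<Longrightarrow> P (\<lambda>t. - f t)"
    and Padd: "\<And>f g. P f \<Longrightarrow> P g \<Longrightarrow> P (\<lambda>t. f t + g t)"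
    and Plim: "\<And>f. (\<And>\<epsilon>. \<epsilon> > 0 \<Longrightarrow> \<exists>g. P g \<and> (\<forall>t. \<bar>f t - g t\<bar> \<le> \<epsilon>)) \<Longrightarrow> P f"
    and basic: "\<And>C D. C \<in> \<G> \<Longrightarrow> D \<in> \<G> \<Longrightarrow> P (cov M T C D)"
    and C: "C \<in> sets M" and D: "D \<in> sets M"
  shows "P (cov M T C D)"
proof -
  have sub: "\<G> \<subseteq> sets M" using gen(1) by auto
  have *: "P (cov M T C D)" if D: "D \<in> \<G>" for D
  proof (rule additive_family_induct[OF prob_space_axioms gen, where \<kappa>="\<lambda>C. cov M T C D" and P=P, OF _ _ _ P0 Pneg Padd Plim _ C])
    have [simp]: "D \<in> sets M" using D sub by auto
    show "cov M T (space M - A) D t = - cov M T A D t" if "A \<in> sets M" for A t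
      by (rule cov_compl(1)) (use that in auto)
    show "cov M T (A \<union> B) D t = cov M T A D t + cov M T B D t" if "A \<in> sets M" "B \<in> sets M" "A \<inter> B = {}" for A B t
      by (rule cov_add(1)) (use that in auto)
    show "\<bar>cov M T A D t\<bar> \<le> 2 * measure M A" if "A \<in> sets M" for A t
      by (rule cov_bound(1)) (use that in auto)
    show "P (cov M T A D)" if "A \<in> \<G>" for A using basic that D by blast
  qed
  show ?thesis
  proof (rule additive_family_induct[OF prob_space_axioms gen, where \<kappa>="\<lambda>D. cov M T C D" and P=P, OF _ _ _ P0 Pneg Padd Plim _ D])
    show "cov M T C (space M - A) t = - cov M T C A t" if "A \<in> sets M" for A t
      by (rule cov_compl(2)) (use that C in auto)
    show "cov M T C (A \<union> B) t = cov M T C A t + cov M T C B t" if "A \<in> sets M" "B \<in> sets M" "A \<inter> B = {}" for A B t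
      by (rule cov_add(2)) (use that C in auto)
    show "\<bar>cov M T C A t\<bar> \<le> 2 * measure M A" if "A \<in> sets M" for A t
      by (rule cov_bound(2)) (use that C in auto)
    show "P (cov M T C A)" if "A \<in> \<G>" for A using * that by blast
  qed
qed

end

text \<open>The covariance of two sets in the factor is the covariance of their preimages.\<close>

lemma mixing_sets_factor:
  assumes Y: "mp_action Y S" and A: "mp_action A R" and q: "measure_preserving Y A q"
    and eq: "\<And>t. AE y in Y. q (S t y) = R t (q y)" and mix: "mixing_sets Y S"
  shows "mixing_sets A R"
  unfolding mixing_sets_def
proof (intro ballI)
  fix C D assume [measurable]: "C \<in> sets A" "D \<in> sets A"
  interpret Y: mp_action Y S by fact
  interpret A: mp_action A R by fact
  note [measurable] = measure_preserving_measurable[OF q]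
  define C' D' where "C' = {y \<in> space Y. q y \<in> C}" and "D' = {y \<in> space Y. q y \<in> D}"
  have [measurable]: "C' \<in> sets Y" "D' \<in> sets Y" unfolding C'_def D'_def by measurable
  have "corr A R C D t = corr Y S C' D' t" for t
  proof -
    have "corr A R C D t = measure Y {y \<in> space Y. q y \<in> {a \<in> space A. R t a \<in> C \<and> a \<in> D}}"
      unfolding corr_def by (rule measure_preserving_measure[OF q, symmetric]) measurable
    also have "\<dots> = corr Y S C' D' t"
      unfolding corr_def
    proof (rule Y.finite_measure_eq_AE)
      show "AE y in Y. y \<in> {y \<in> space Y. q y \<in> {a \<in> space A. R t a \<in> C \<and> a \<in> D}} \<longleftrightarrow>
          y \<in> {y \<in> space Y. S t y \<in> C' \<and> y \<in> D'}"
        using eq[of t] AE_space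
      proof eventually_elim
        case (elim y)
        then show ?case using measurable_space[of q Y A y] Y.T_space[of y t]
          by (auto simp: C'_def D'_def)
      qed
    qed measurable
    finally show ?thesis .
  qed
  moreover have "measure A C = measure Y C'" "measure A D = measure Y D'"
    unfolding C'_def D'_def by (auto simp: measure_preserving_measure[OF q])
  ultimately have "cov A R C D = cov Y S C' D'" unfolding cov_def by auto
  then show "averages_to_zero (\<lambda>t. \<bar>cov A R C D t\<bar>)"
    using mix unfolding mixing_sets_def by simp
qed

lemma (in flow) continuous_cov:
  assumes [measurable]: "C \<in> sets M" "D \<in> sets M"
  shows "continuous_on UNIV (cov M T C D)"
proof -
  interpret mp_action M T by (rule mp_action)
  have L: "indicator C \<in> L2 M" "indicator D \<in> L2 M"
    by (rule L2_bounded[of _ 1]; auto simp: indicator_def)+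
  have "l2_inner M (koopman T t (indicator C)) (indicator D) = of_real (corr M T C D t)" for t
  proof -
    have "l2_inner M (koopman T t (indicator C)) (indicator D)
        = (CLINT x|M. of_real (indicator {x \<in> space M. T t x \<in> C \<and> x \<in> D} x))"
      unfolding l2_inner_def koopman_def by (intro Bochner_Integration.integral_cong) (auto simp: indicator_def)
    then show ?thesis unfolding corr_def by simp
  qed
  then have "continuous_on UNIV (\<lambda>t. complex_of_real (corr M T C D t))"
    using weakly_continuous[OF L] by simp
  from continuous_on_Re[OF this] have "continuous_on UNIV (\<lambda>t. corr M T C D t)" by simp
  then show ?thesis unfolding cov_def by (intro continuous_intros)
qed

section \<open>Actions on finite products\<close>

lemma mp_action_product_prob_space:
  assumes "\<And>i. mp_action (M i) (T i)"
  shows "product_prob_space M"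
proof -
  interpret M: mp_action "M i" "T i" for i by (rule assms)
  show ?thesis by unfold_locales
qed

lemma measure_PiM_rectangle:
  assumes M: "product_prob_space M" and I: "finite I" and A: "\<And>i. i \<in> I \<Longrightarrow> A i \<in> sets (M i)"
  shows "measure (PiM I M) (Pi\<^sub>E I A) = (\<Prod>i\<in>I. measure (M i) (A i))"
proof -
  interpret product_prob_space M by fact
  interpret finite_product_prob_space M I by unfold_locales (rule I)
  show ?thesis by (rule finite_measure_PiM_emb[OF A])
qed

lemma product_flow_measurable:
  assumes "\<And>i. mp_action (M i) (T i)"
  shows "product_flow I T t \<in> measurable (PiM I M) (PiM I M)"
proof -
  interpret M: mp_action "M i" "T i" for i by (rule assms)
  show ?thesis
    unfolding product_flow_def[abs_def]
  proof (rule measurable_restrict)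
    fix i assume "i \<in> I"
    show "(\<lambda>x. T i t (x i)) \<in> measurable (PiM I M) (M i)"
      by (rule measurable_compose[OF measurable_component_singleton[OF \<open>i \<in> I\<close>] M.T_measurable])
  qed
qed

lemma product_flow_in_PiE: "product_flow I T t x \<in> Pi\<^sub>E I A \<longleftrightarrow> (\<forall>i\<in>I. T i t (x i) \<in> A i)"
  by (auto simp: product_flow_def PiE_iff)

lemma product_flow_vimage:
  shows "{x \<in> space (PiM I M). product_flow I T t x \<in> Pi\<^sub>E I C \<and> x \<in> Pi\<^sub>E I D}
    = Pi\<^sub>E I (\<lambda>i. {x \<in> space (M i). T i t x \<in> C i \<and> x \<in> D i})"
  unfolding product_flow_in_PiE by (auto simp: space_PiM PiE_iff extensional_def)

lemma mp_action_PiM: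
  assumes M: "\<And>i. mp_action (M i) (T i)" and I: "finite I"
  shows "mp_action (PiM I M) (product_flow I T)"
proof -
  interpret M: mp_action "M i" "T i" for i by (rule M)
  interpret product_prob_space M by unfold_locales
  interpret P: prob_space "PiM I M" by (rule prob_space_PiM) unfold_locales
  have [measurable]: "product_flow I T t \<in> measurable (PiM I M) (PiM I M)" for t
    by (rule product_flow_measurable[OF M])
  show ?thesis
  proof
    fix t
    have "distr (PiM I M) (PiM I M) (product_flow I T t) = PiM I M"
    proof (rule PiM_eqI[OF I])
      fix A assume A: "\<And>i. i \<in> I \<Longrightarrow> A i \<in> sets (M i)"
      have [measurable]: "Pi\<^sub>E I A \<in> sets (PiM I M)" by (intro sets_PiM_I_finite I A)
      have "product_flow I T t -` Pi\<^sub>E I A \<inter> space (PiM I M) = Pi\<^sub>E I (\<lambda>i. T i t -` A i \<inter> space (M i))"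
        unfolding vimage_def product_flow_in_PiE by (auto simp: space_PiM PiE_iff extensional_def)
      then have "emeasure (distr (PiM I M) (PiM I M) (product_flow I T t)) (Pi\<^sub>E I A)
          = emeasure (PiM I M) (Pi\<^sub>E I (\<lambda>i. T i t -` A i \<inter> space (M i)))"
        by (simp add: emeasure_distr)
      also have "\<dots> = (\<Prod>i\<in>I. emeasure (M i) (T i t -` A i \<inter> space (M i)))"
        by (rule emeasure_PiM[OF I]) (use A in measurable)
      also have "\<dots> = (\<Prod>i\<in>I. emeasure (distr (M i) (M i) (T i t)) (A i))"
        using A by (intro prod.cong refl) (simp add: emeasure_distr)
      also have "\<dots> = (\<Prod>i\<in>I. emeasure (M i) (A i))"
        using M.T_mp unfolding measure_preserving_def by simp
      finally show "emeasure (distr (PiM I M) (PiM I M) (product_flow I T t)) (Pi\<^sub>E I A) = (\<Prod>i\<in>I. emeasure (M i) (A i))" .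
    qed simp
    then show "measure_preserving (PiM I M) (PiM I M) (product_flow I T t)"
      unfolding measure_preserving_def by simp
  next
    fix x assume x: "x \<in> space (PiM I M)"
    then show "product_flow I T 0 x = x"
      by (auto simp: product_flow_def space_PiM PiE_iff extensional_def M.T_zero restrict_def)
    show "product_flow I T (s + t) x = product_flow I T s (product_flow I T t x)" for s t
      using x by (auto simp: product_flow_def space_PiM PiE_iff M.T_add restrict_def)
  qed
qed

text \<open>On rectangles the correlation splits into the product of the coordinate correlations,
  which leaves a statement about coordinates only.\<close>

lemma cov_PiM_induct:
  fixes P :: "(real \<Rightarrow> real) \<Rightarrow> bool"
  assumes M: "\<And>i. mp_action (M i) (T i)" and I: "finite I"
    and P0: "P (\<lambda>_. 0)" and Pneg: "\<And>f. P f \<Longrightarrow> P (\<lambda>t. - f t)"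
    and Padd: "\<And>f g. P f \<Longrightarrow> P g \<Longrightarrow> P (\<lambda>t. f t + g t)"
    and Plim: "\<And>f. (\<And>\<epsilon>. \<epsilon> > 0 \<Longrightarrow> \<exists>g. P g \<and> (\<forall>t. \<bar>f t - g t\<bar> \<le> \<epsilon>)) \<Longrightarrow> P f"
    and rect: "\<And>A B. (\<And>i. i \<in> I \<Longrightarrow> A i \<in> sets (M i)) \<Longrightarrow> (\<And>i. i \<in> I \<Longrightarrow> B i \<in> sets (M i)) \<Longrightarrow>
       P (\<lambda>t. (\<Prod>i\<in>I. corr (M i) (T i) (A i) (B i) t) - (\<Prod>i\<in>I. measure (M i) (A i) * measure (M i) (B i)))"
    and C: "C \<in> sets (PiM I M)" and D: "D \<in> sets (PiM I M)"
  shows "P (cov (PiM I M) (product_flow I T) C D)"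
proof -
  interpret M: mp_action "M i" "T i" for i by (rule M)
  have pM: "product_prob_space M" by (rule mp_action_product_prob_space[OF M])
  interpret W: mp_action "PiM I M" "product_flow I T" by (rule mp_action_PiM[OF M I])
  show ?thesis
  proof (rule W.cov_induct[of "prod_algebra I M", OF _ _ _ P0 Pneg Padd Plim _ C D])
    show "sets (PiM I M) = sigma_sets (space (PiM I M)) (prod_algebra I M)"
      by (simp add: sets_PiM space_PiM)
    show "Int_stable (prod_algebra I M)" by (rule Int_stable_prod_algebra)
    show "prod_algebra I M \<subseteq> Pow (space (PiM I M))"
      using prod_algebra_sets_into_space by (simp add: space_PiM)
    fix C D assume "C \<in> prod_algebra I M" "D \<in> prod_algebra I M"
    then obtain A B where AB: "C = Pi\<^sub>E I A" "D = Pi\<^sub>E I B" "\<And>i. i \<in> I \<Longrightarrow> A i \<in> sets (M i)" "\<And>i. i \<in> I \<Longrightarrow> B i \<in> sets (M i)"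
      unfolding prod_algebra_eq_finite[OF I] by auto
    have "corr (PiM I M) (product_flow I T) C D t = (\<Prod>i\<in>I. corr (M i) (T i) (A i) (B i) t)" for t
      unfolding corr_def AB(1,2) product_flow_vimage
      by (rule measure_PiM_rectangle[OF pM I]) (use AB in measurable)
    moreover have "measure (PiM I M) C * measure (PiM I M) D = (\<Prod>i\<in>I. measure (M i) (A i) * measure (M i) (B i))"
      unfolding AB(1,2) using AB(3,4) by (simp add: measure_PiM_rectangle[OF pM I] prod.distrib)
    ultimately have "cov (PiM I M) (product_flow I T) C D
        = (\<lambda>t. (\<Prod>i\<in>I. corr (M i) (T i) (A i) (B i) t) - (\<Prod>i\<in>I. measure (M i) (A i) * measure (M i) (B i)))"
      unfolding cov_def by auto
    then show "P (cov (PiM I M) (product_flow I T) C D)" using rect[OF AB(3,4)] by simp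
  qed
qed

text \<open>All factors lie in \<open>[0, 1]\<close>, so the difference of the two products is at
  most the sum of the absolute coordinate covariances, and each of these averages to zero.\<close>

lemma mixing_sets_PiM:
  assumes M: "\<And>i. mp_action (M i) (T i)" and I: "finite I" and mix: "\<And>i. i \<in> I \<Longrightarrow> mixing_sets (M i) (T i)"
  shows "mixing_sets (PiM I M) (product_flow I T)"
  unfolding mixing_sets_def
proof (intro ballI)
  fix C D assume C: "C \<in> sets (PiM I M)" and D: "D \<in> sets (PiM I M)"
  interpret M: mp_action "M i" "T i" for i by (rule M)
  show "averages_to_zero (\<lambda>t. \<bar>cov (PiM I M) (product_flow I T) C D t\<bar>)"
  proof (rule cov_PiM_induct[where P="\<lambda>f. averages_to_zero (\<lambda>t. \<bar>f t\<bar>)", OF M I _ _ _ _ _ C D])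
    show "averages_to_zero (\<lambda>t. \<bar>f t + g t\<bar>)" if "averages_to_zero (\<lambda>t. \<bar>f t\<bar>)" "averages_to_zero (\<lambda>t. \<bar>g t\<bar>)" for f g
      by (rule averages_to_zero_le[OF averages_to_zero_add[OF that]]) auto
    show "averages_to_zero (\<lambda>t. \<bar>f t\<bar>)"
      if "\<And>\<epsilon>. \<epsilon> > 0 \<Longrightarrow> \<exists>g. averages_to_zero (\<lambda>t. \<bar>g t\<bar>) \<and> (\<forall>t. \<bar>f t - g t\<bar> \<le> \<epsilon>)" for f
    proof (rule averages_to_zero_limit)
      fix \<epsilon> :: real assume "\<epsilon> > 0"
      from that[OF this] obtain g where g: "averages_to_zero (\<lambda>t. \<bar>g t\<bar>)" "\<And>t. \<bar>f t - g t\<bar> \<le> \<epsilon>" by blast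
      have "\<bar>f t\<bar> \<le> \<bar>g t\<bar> + \<epsilon>" for t using g(2)[of t] by linarith
      then show "\<exists>b. averages_to_zero b \<and> (\<forall>t. \<bar>f t\<bar> \<le> b t + \<epsilon>)" using g(1) by blast
    qed
    fix A B assume AB: "\<And>i. i \<in> I \<Longrightarrow> A i \<in> sets (M i)" "\<And>i. i \<in> I \<Longrightarrow> B i \<in> sets (M i)"
    have "averages_to_zero (\<lambda>t. \<Sum>i\<in>I. \<bar>cov (M i) (T i) (A i) (B i) t\<bar>)"
      using mix AB unfolding mixing_sets_def by (intro averages_to_zero_sum) auto
    moreover have "\<bar>(\<Prod>i\<in>I. corr (M i) (T i) (A i) (B i) t) - (\<Prod>i\<in>I. measure (M i) (A i) * measure (M i) (B i))\<bar>
        \<le> (\<Sum>i\<in>I. \<bar>cov (M i) (T i) (A i) (B i) t\<bar>)" for t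
      using norm_prod_diff[of I "\<lambda>i. corr (M i) (T i) (A i) (B i) t" "\<lambda>i. measure (M i) (A i) * measure (M i) (B i)"]
      unfolding cov_def by (simp add: corr_def mult_le_one)
    ultimately show "averages_to_zero (\<lambda>t. \<bar>(\<Prod>i\<in>I. corr (M i) (T i) (A i) (B i) t)
        - (\<Prod>i\<in>I. measure (M i) (A i) * measure (M i) (B i))\<bar>)"
      by (rule averages_to_zero_le)
  qed (simp_all add: averages_to_zero_const)
qed

text \<open>Continuity is closed under uniform limits, so rectangles suffice. It provides the
  continuity hypothesis of Bochner's theorem on the complementary products.\<close>

lemma continuous_cov_PiM:
  assumes M: "\<And>i. flow (M i) (T i)" and I: "finite I" and C: "C \<in> sets (PiM I M)" and D: "D \<in> sets (PiM I M)"
  shows "continuous_on UNIV (cov (PiM I M) (product_flow I T) C D)"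
proof -
  have mp: "mp_action (M i) (T i)" for i by (rule flow.mp_action[OF M])
  show ?thesis
  proof (rule cov_PiM_induct[where P="continuous_on UNIV", OF mp I _ _ _ _ _ C D])
    show "continuous_on UNIV f" if "\<And>\<epsilon>. \<epsilon> > 0 \<Longrightarrow> \<exists>g. continuous_on UNIV g \<and> (\<forall>t. \<bar>f t - g t\<bar> \<le> \<epsilon>)" for f :: "real \<Rightarrow> real"
    proof -
      have "\<forall>n. \<exists>g. continuous_on UNIV g \<and> (\<forall>t. \<bar>f t - g t\<bar> \<le> 1 / real (Suc n))" using that by simp
      then obtain g where g: "\<And>n. continuous_on UNIV (g n)" "\<And>n t. \<bar>f t - g n t\<bar> \<le> 1 / real (Suc n)" by metis
      have "uniform_limit UNIV g f sequentially"
        unfolding uniform_limit_iff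
      proof (intro allI impI)
        fix e :: real assume "e > 0"
        then have "\<forall>\<^sub>F n in sequentially. 1 / real (Suc n) < e"
          using LIMSEQ_inverse_real_of_nat by (intro order_tendstoD(2)[of _ 0]) (auto simp: inverse_eq_divide)
        then show "\<forall>\<^sub>F n in sequentially. \<forall>x\<in>UNIV. dist (g n x) (f x) < e"
        proof eventually_elim
          case (elim n)
          show ?case
          proof
            fix x show "dist (g n x) (f x) < e" using g(2)[of x n] elim by (simp add: dist_real_def)
          qed
        qed
      qed
      then show ?thesis by (rule uniform_limit_theorem[rotated]) (auto simp: g)
    qed
    fix A B assume AB: "\<And>i. i \<in> I \<Longrightarrow> A i \<in> sets (M i)" "\<And>i. i \<in> I \<Longrightarrow> B i \<in> sets (M i)"
    have "continuous_on UNIV (corr (M i) (T i) (A i) (B i))" if "i \<in> I" for i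
    proof -
      have "continuous_on UNIV (\<lambda>t. cov (M i) (T i) (A i) (B i) t + measure (M i) (A i) * measure (M i) (B i))"
        using flow.continuous_cov[OF M AB(1)[OF that] AB(2)[OF that]] by (intro continuous_intros)
      then show ?thesis unfolding cov_def by simp
    qed
    then show "continuous_on UNIV (\<lambda>t. (\<Prod>i\<in>I. corr (M i) (T i) (A i) (B i) t) - (\<Prod>i\<in>I. measure (M i) (A i) * measure (M i) (B i)))"
      by (intro continuous_intros) auto
  qed (auto intro!: continuous_intros)
qed

section \<open>Orthogonality of factors to product functions\<close>

lemma averages_to_zero_cmult:
  assumes a: "averages_to_zero a" and c: "c \<ge> 0"
  shows "averages_to_zero (\<lambda>t. c * a t)"
proof (cases "c = 0")
  case True
  then show ?thesis by (simp add: averages_to_zero_const)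
next
  case False
  with c have c: "c > 0" by simp
  show ?thesis
    unfolding averages_to_zero_def
  proof (intro allI impI)
    fix \<epsilon> :: real assume "\<epsilon> > 0"
    then have "\<epsilon> / c > 0" using c by simp
    then obtain ws where ws: "convex_weights ws" "\<And>s. average ws (\<lambda>t. a (t + s)) < \<epsilon> / c"
      using a unfolding averages_to_zero_def by blast
    have "average ws (\<lambda>t. c * a (t + s)) < \<epsilon>" for s
      using ws(2)[of s] c by (simp add: average_mult_right field_simps)
    then show "\<exists>ws. convex_weights ws \<and> (\<forall>s. average ws (\<lambda>t. c * a (t + s)) < \<epsilon>)" using ws(1) by blast
  qed
qed

section \<open>Centered indicators and their spectral measures\<close>

definition centered :: "'a measure \<Rightarrow> 'a set \<Rightarrow> 'a \<Rightarrow> real" where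
  "centered M C x = indicator C x - measure M C"

lemma cmod_sum_power2:
  "complex_of_real ((cmod (\<Sum>k\<in>K. z k))\<^sup>2) = (\<Sum>k\<in>K. \<Sum>l\<in>K. z k * cnj (z l))"
  unfolding complex_norm_square by (simp add: sum_product)

context prob_space
begin

lemma centered_measurable [measurable]:
  assumes [measurable]: "C \<in> sets M"
  shows "centered M C \<in> borel_measurable M"
  unfolding centered_def[abs_def] by measurable

lemma abs_centered_le: "\<bar>centered M C x\<bar> \<le> 1"
  unfolding centered_def using measure_nonneg[of M C] prob_le_1[of C] by (simp add: indicator_def)

lemma centered_mean: "C \<in> sets M \<Longrightarrow> (\<integral>x. centered M C x \<partial>M) = 0"
  unfolding centered_def by (subst Bochner_Integration.integral_diff) (auto simp: emeasure_eq_measure prob_space)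

lemma centered_trivial:
  assumes [measurable]: "C \<in> sets M" and v: "measure M C * (1 - measure M C) = 0"
  shows "AE x in M. centered M C x = 0"
proof -
  have "measure M C = 0 \<or> measure M C = 1" using v by auto
  then show ?thesis
  proof
    assume 0: "measure M C = 0"
    then have "AE x in M. x \<notin> C" by (subst (asm) prob_eq_0) auto
    then show ?thesis by eventually_elim (simp add: centered_def 0)
  next
    assume 1: "measure M C = 1"
    then have "AE x in M. x \<in> C" by (subst (asm) prob_eq_1) auto
    then show ?thesis by eventually_elim (simp add: centered_def 1)
  qed
qed

end

context mp_action
begin

lemma cov_eq_integral:
  assumes [measurable]: "C \<in> sets M"
  shows "(\<integral>x. centered M C (T s x) * centered M C (T t x) \<partial>M) = cov M T C C (s - t)"
proof -
  have "(\<integral>x. centered M C (T s x) * centered M C (T t x) \<partial>M)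
      = (\<integral>x. centered M C (T (s - t) (T t x)) * centered M C (T t x) \<partial>M)"
    using T_add[of _ "s - t" t] by (intro Bochner_Integration.integral_cong) auto
  also have "\<dots> = (\<integral>x. centered M C (T (s - t) x) * centered M C x \<partial>M)"
    by (rule measure_preserving_integral[OF T_mp, where g="\<lambda>x. centered M C (T (s - t) x) * centered M C x"]) measurable
  also have "\<dots> = (\<integral>x. indicator {x \<in> space M. T (s - t) x \<in> C \<and> x \<in> C} x - measure M C * indicator {x \<in> space M. T (s - t) x \<in> C} x
      - measure M C * indicator C x + measure M C * measure M C \<partial>M)"
    by (intro Bochner_Integration.integral_cong) (auto simp: centered_def indicator_def algebra_simps)
  also have "\<dots> = corr M T C C (s - t) - measure M C * measure M {x \<in> space M. T (s - t) x \<in> C}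
      - measure M C * measure M C + measure M C * measure M C"
    unfolding corr_def by (simp add: emeasure_eq_measure prob_space)
  also have "\<dots> = cov M T C C (s - t)"
    unfolding cov_def by (simp add: measure_preserving_measure[OF T_mp])
  finally show ?thesis .
qed

lemma cov_uminus: "C \<in> sets M \<Longrightarrow> cov M T C C (- t) = cov M T C C t"
  using cov_eq_integral[of C 0 t] cov_eq_integral[of C t 0] by (simp add: mult.commute)

lemma cov_zero:
  assumes "C \<in> sets M"
  shows "cov M T C C 0 = measure M C * (1 - measure M C)"
proof -
  have "{x \<in> space M. T 0 x \<in> C \<and> x \<in> C} = C"
    using sets.sets_into_space[OF assms] by (auto simp: T_zero)
  then show ?thesis unfolding cov_def corr_def by (simp add: algebra_simps)
qed

text \<open>The autocovariance divided by the variance \<open>v\<close> is positive definite,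
  because its quadratic form is the squared norm of a combination of translates divided by
  \<open>v\<close>; Bochner's theorem gives the measure, and mixing makes it atomless.\<close>

lemma spectral_distribution:
  assumes C [measurable]: "C \<in> sets M" and v: "measure M C * (1 - measure M C) = v" "v > 0"
    and cont: "continuous_on UNIV (cov M T C C)" and mix: "averages_to_zero (\<lambda>t. \<bar>cov M T C C t\<bar>)"
  obtains \<tau> where "real_distribution \<tau>" "\<And>x. measure \<tau> {x} = 0" "\<And>t. char \<tau> t = of_real (cov M T C C t / v)"
proof -
  define \<phi> where "\<phi> t = complex_of_real (cov M T C C t / v)" for t
  have int: "integrable M (\<lambda>x. complex_of_real (centered M C (T s x) * centered M C (T t x)))" for s t
  proof (rule integrable_const_bound[of _ 1])
    have "\<bar>centered M C (T s x)\<bar> * \<bar>centered M C (T t x)\<bar> \<le> 1 * 1" for x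
      by (intro mult_mono) (auto simp: abs_centered_le)
    then show "AE x in M. norm (complex_of_real (centered M C (T s x) * centered M C (T t x))) \<le> 1"
      by (simp add: norm_mult)
  qed measurable
  obtain \<tau> where \<tau>: "real_distribution \<tau>" "char \<tau> = \<phi>"
  proof (rule bochner[of \<phi>])
    fix N :: nat and t :: "nat \<Rightarrow> real" and c :: "nat \<Rightarrow> complex"
    define z where "z k x = c k * of_real (centered M C (T (t k) x))" for k x
    have zz: "z k x * cnj (z l x) = c k * cnj (c l) * complex_of_real (centered M C (T (t k) x) * centered M C (T (t l) x))" for k l x
      unfolding z_def by simp
    have "complex_of_real (\<integral>x. (cmod (\<Sum>k<N. z k x))\<^sup>2 \<partial>M) = (\<integral>x. (\<Sum>k<N. \<Sum>l<N. z k x * cnj (z l x)) \<partial>M)"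
      unfolding cmod_sum_power2[symmetric] by (rule integral_complex_of_real[symmetric])
    also have "\<dots> = (\<Sum>k<N. \<Sum>l<N. c k * cnj (c l) * (\<integral>x. complex_of_real (centered M C (T (t k) x) * centered M C (T (t l) x)) \<partial>M))"
      unfolding zz using int by (simp add: Bochner_Integration.integral_sum del: of_real_mult)
    also have "\<dots> = (\<Sum>k<N. \<Sum>l<N. c k * cnj (c l) * of_real (cov M T C C (t k - t l)))"
      unfolding integral_complex_of_real cov_eq_integral[OF C] ..
    finally have eq: "complex_of_real (\<integral>x. (cmod (\<Sum>k<N. z k x))\<^sup>2 \<partial>M) = \<dots>" .
    have "(\<Sum>k<N. \<Sum>l<N. c k * cnj (c l) * \<phi> (t k - t l)) = complex_of_real ((\<integral>x. (cmod (\<Sum>k<N. z k x))\<^sup>2 \<partial>M) / v)"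
      unfolding of_real_divide eq \<phi>_def by (simp add: sum_divide_distrib)
    moreover have "0 \<le> (\<integral>x. (cmod (\<Sum>k<N. z k x))\<^sup>2 \<partial>M) / v" using v(2) by simp
    ultimately show "\<exists>u\<ge>0. (\<Sum>k<N. \<Sum>l<N. c k * cnj (c l) * \<phi> (t k - t l)) = of_real u" by blast
  next
    show "\<phi> 0 = 1" using v cov_zero[OF C] unfolding \<phi>_def by simp
    show "continuous_on UNIV \<phi>" unfolding \<phi>_def using v(2) by (intro continuous_intros cont) auto
    show "\<phi> (- t) = cnj (\<phi> t)" for t unfolding \<phi>_def by (simp add: cov_uminus)
  qed auto
  have "averages_to_zero (\<lambda>t. cmod (char \<tau> t))"
    using averages_to_zero_cmult[OF mix, of "1 / v"] v(2) unfolding \<tau>(2) \<phi>_def by (simp add: norm_divide)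
  then have "measure \<tau> {x} = 0" for x by (rule char_averages_to_zero_imp_atomless[OF \<tau>(1)])
  then show thesis using that[OF \<tau>(1)] unfolding \<tau>(2) \<phi>_def by blast
qed

end

section \<open>Restriction to a factor and its weak limits\<close>

text \<open>\<open>F\<close> is the conditional expectation of \<open>g\<close> given the factor map
  \<open>q\<close>, regarded as a function on \<open>X\<close>. It moves an integral over
  \<open>W\<close> to \<open>X\<close>, where the weak limits of the action are given.\<close>

lemma factor_density:
  fixes g :: "'w \<Rightarrow> real" and X :: "'x measure"
  assumes W: "prob_space W" and q: "measure_preserving W X q" and g [measurable]: "g \<in> borel_measurable W"
    and g1: "\<And>w. \<bar>g w\<bar> \<le> 1"
  obtains F where "F \<in> L2 X" "\<And>E. E \<in> sets X \<Longrightarrow> (\<integral>x. F x * indicator E x \<partial>X) = of_real (\<integral>w. indicator E (q w) * g w \<partial>W)"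
proof -
  interpret W: prob_space W by fact
  have [measurable]: "q \<in> measurable W X" by (rule measure_preserving_measurable[OF q])
  have X: "prob_space X"
    using W.prob_space_distr[of q X] q unfolding measure_preserving_def by simp
  interpret X: prob_space X by fact
  \<comment> \<open>\<open>L2_riesz\<close> is indexed by a whole type, so sets outside
    \<open>sets X\<close> receive the zero function.\<close>
  define e where "e E x = (if E \<in> sets X then indicator E x else 0 :: complex)" for E x
  have [measurable]: "e E \<in> borel_measurable X" for E unfolding e_def by (cases "E \<in> sets X") auto
  have e1: "cmod (e E x) \<le> 1" for E x unfolding e_def by (simp add: indicator_def)
  have eL2: "e E \<in> L2 X" for E by (rule X.L2_bounded[of _ 1]) (auto simp: e1)
  define l where "l E = (\<integral>w. e E (q w) * of_real (g w) \<partial>W)" for E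
  have gL2: "(\<lambda>w. complex_of_real (g w)) \<in> L2 W" by (rule W.L2_bounded[of _ 1]) (auto simp: g1)
  obtain F where F: "F \<in> L2 X" "\<And>E. (\<integral>x. F x * e E x \<partial>X) = l E"
  proof (rule L2_riesz[of e X l, OF eL2])
    fix K :: "'x set set" and c :: "'x set \<Rightarrow> complex" assume K: "finite K"
    define h where "h x = (\<Sum>E\<in>K. c E * e E x)" for x
    have [measurable]: "h \<in> borel_measurable X" unfolding h_def by measurable
    have hb: "cmod (h x) \<le> (\<Sum>E\<in>K. cmod (c E))" for x
      unfolding h_def by (rule order_trans[OF norm_sum]) (auto intro!: sum_mono simp: norm_mult mult_left_le e1)
    have hL2: "(\<lambda>w. h (q w)) \<in> L2 W" by (rule W.L2_bounded[OF _ hb]) measurable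
    have "integrable W (\<lambda>w. e E (q w) * of_real (g w))" for E
      by (rule L2_integrable_mult[OF W.L2_bounded[of _ 1] gL2]) (auto simp: e1)
    then have "(\<Sum>E\<in>K. c E * l E) = (\<integral>w. h (q w) * of_real (g w) \<partial>W)"
      unfolding l_def h_def by (simp add: sum_distrib_right Bochner_Integration.integral_sum mult.assoc)
    then have "(cmod (\<Sum>E\<in>K. c E * l E))\<^sup>2 \<le> (\<integral>w. (cmod (h (q w)))\<^sup>2 \<partial>W) * (\<integral>w. (cmod (of_real (g w)))\<^sup>2 \<partial>W)"
      using L2_cauchy_schwarz_norm[OF hL2 gL2] by simp
    also have "\<dots> \<le> (\<integral>w. (cmod (h (q w)))\<^sup>2 \<partial>W) * 1"
    proof (rule mult_left_mono)
      have "(\<integral>w. (cmod (complex_of_real (g w)))\<^sup>2 \<partial>W) \<le> (\<integral>w. 1 \<partial>W)"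
        by (rule integral_mono[OF L2_integrable_power2[OF gL2]]) (auto simp: abs_square_le_1 g1)
      then show "(\<integral>w. (cmod (of_real (g w)))\<^sup>2 \<partial>W) \<le> 1" using W.prob_space by simp
    qed simp
    also have "\<dots> = (\<integral>x. (cmod (h x))\<^sup>2 \<partial>X)"
      using measure_preserving_integral[OF q, of "\<lambda>x. (cmod (h x))\<^sup>2"] by simp
    finally show "(cmod (\<Sum>E\<in>K. c E * l E))\<^sup>2 \<le> (\<integral>x. (cmod (\<Sum>E\<in>K. c E * e E x))\<^sup>2 \<partial>X)"
      unfolding h_def .
  qed auto
  have "(\<integral>x. F x * indicator E x \<partial>X) = of_real (\<integral>w. indicator E (q w) * g w \<partial>W)" if E: "E \<in> sets X" for E
  proof -
    have "(\<integral>x. F x * indicator E x \<partial>X) = l E" using F(2)[of E] E by (simp add: e_def)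
    also have "l E = (\<integral>w. complex_of_real (indicator E (q w) * g w) \<partial>W)"
      unfolding l_def e_def using E by (intro Bochner_Integration.integral_cong) (auto simp: indicator_def)
    finally show ?thesis by (simp only: integral_complex_of_real)
  qed
  then show thesis using that F(1) by blast
qed

lemma measure_preserving_fst: "prob_space N \<Longrightarrow> measure_preserving (M \<Otimes>\<^sub>M N) M fst"
  unfolding measure_preserving_def by (simp add: prob_space.distr_pair_fst)

lemma measure_preserving_snd:
  assumes "prob_space M" "prob_space N"
  shows "measure_preserving (M \<Otimes>\<^sub>M N) N snd"
proof -
  interpret M: prob_space M by fact
  interpret N: prob_space N by fact
  interpret pair_prob_space M N ..
  have "distr (M \<Otimes>\<^sub>M N) N snd = distr (distr (N \<Otimes>\<^sub>M M) (M \<Otimes>\<^sub>M N) (\<lambda>(x, y). (y, x))) N snd"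
    using distr_pair_swap by simp
  also have "\<dots> = distr (N \<Otimes>\<^sub>M M) N fst"
    by (subst distr_distr) (auto simp: comp_def case_prod_beta')
  also have "\<dots> = N" by (rule M.distr_pair_fst)
  finally show ?thesis unfolding measure_preserving_def by simp
qed

text \<open>A centered indicator has mean zero, so the term with \<open>mean_op\<close> disappears.
  The test function is \<open>cnj F\<close> because \<open>l2_inner\<close> conjugates its second
  argument.\<close>

lemma weak_limit_centered:
  assumes X: "prob_space X" and T: "\<And>t. measure_preserving X X (T t)"
    and lim: "weak_limit_along X T \<tau> a P" and D: "D \<in> sets X" and F: "F \<in> L2 X"
  shows "(\<lambda>n. \<integral>x. complex_of_real (centered X D (T (\<tau> n) x)) * F x \<partial>X) \<longlonglongrightarrow>
     of_real (1 - a) * (CLINT t|P. (\<integral>x. complex_of_real (centered X D (T t x)) * F x \<partial>X))"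
proof -
  interpret X: prob_space X by fact
  define f where "f x = complex_of_real (centered X D x)" for x
  have [measurable]: "f \<in> borel_measurable X" unfolding f_def using X.centered_measurable[OF D] by measurable
  have f: "f \<in> L2 X"
    by (rule X.L2_bounded[of _ 1]) (use X.abs_centered_le in \<open>auto simp: f_def\<close>)
  have inner: "l2_inner X (koopman T t f) (\<lambda>x. cnj (F x)) = (\<integral>x. complex_of_real (centered X D (T t x)) * F x \<partial>X)" for t
    unfolding l2_inner_def koopman_def f_def by simp
  have "(\<integral>x. f x \<partial>X) = 0"
    unfolding f_def integral_complex_of_real using X.centered_mean[OF D] by simp
  then have "l2_inner X (mean_op X f) (\<lambda>x. cnj (F x)) = 0" unfolding l2_inner_def mean_op_def by simp
  then show ?thesis
    using lim f L2_cnj[OF F] unfolding weak_limit_along_def flow_integral_coeff_def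
    by (metis (no_types, lifting) inner add_0 mult_zero_right ext)
qed

text \<open>The functional \<open>l\<close> collects the correlations of the lifted function with the translates of
  the product \<open>h1 \<otimes> h2\<close> under the two-parameter action of \<open>R1 \<times> R2\<close>.\<close>

lemma product_orthogonality:
  assumes A: "mp_action A R1" and B: "mp_action B R2" and X: "mp_action X T"
    and q: "measure_preserving (A \<Otimes>\<^sub>M B) X q"
    and eq: "\<And>t. AE w in A \<Otimes>\<^sub>M B. q (map_prod (R1 t) (R2 t) w) = T t (q w)"
    and lim: "weak_limit_along X T \<tau> a P" and a: "a < 1"
    and P: "real_distribution P" "real_analytic (char P)" "\<And>x. P \<noteq> return borel x"
    and D [measurable]: "D \<in> sets X" and C1 [measurable]: "C1 \<in> sets A" and C2 [measurable]: "C2 \<in> sets B"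
    and cont: "continuous_on UNIV (cov A R1 C1 C1)" "continuous_on UNIV (cov B R2 C2 C2)"
    and mix: "averages_to_zero (\<lambda>t. \<bar>cov A R1 C1 C1 t\<bar>)" "averages_to_zero (\<lambda>t. \<bar>cov B R2 C2 C2 t\<bar>)"
  shows "(\<integral>w. centered X D (q w) * (centered A C1 (fst w) * centered B C2 (snd w)) \<partial>(A \<Otimes>\<^sub>M B)) = 0"
proof -
  interpret A: mp_action A R1 by fact
  interpret B: mp_action B R2 by fact
  interpret X: mp_action X T by fact
  interpret AB: pair_prob_space A B ..
  interpret W: mp_action "A \<Otimes>\<^sub>M B" "\<lambda>t. map_prod (R1 t) (R2 t)" by (rule mp_action_pair[OF A B])
  have [measurable]: "q \<in> measurable (A \<Otimes>\<^sub>M B) X" by (rule measure_preserving_measurable[OF q])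
  note fst_mp = measure_preserving_fst[OF B.prob_space_axioms, of A]
  note snd_mp = measure_preserving_snd[OF A.prob_space_axioms B.prob_space_axioms]
  define v1 v2 where "v1 = measure A C1 * (1 - measure A C1)" and "v2 = measure B C2 * (1 - measure B C2)"
  have v: "v1 \<ge> 0" "v2 \<ge> 0" unfolding v1_def v2_def by auto
  show ?thesis
  \<comment> \<open>A spectral measure exists for positive variance; at variance 0 one of the
    centered indicators vanishes almost everywhere.\<close>
  proof (cases "v1 = 0 \<or> v2 = 0")
    case True
    have "AE w in A \<Otimes>\<^sub>M B. centered A C1 (fst w) = 0 \<or> centered B C2 (snd w) = 0"
    proof (cases "v1 = 0")
      case True
      from measure_preserving_AE[OF fst_mp A.centered_trivial[OF C1 True[unfolded v1_def]]]
      show ?thesis by eventually_elim simp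
    next
      case False
      then have "v2 = 0" using True by simp
      from measure_preserving_AE[OF snd_mp B.centered_trivial[OF C2 this[unfolded v2_def]]]
      show ?thesis by eventually_elim simp
    qed
    then have "(\<integral>w. centered X D (q w) * (centered A C1 (fst w) * centered B C2 (snd w)) \<partial>(A \<Otimes>\<^sub>M B)) = (\<integral>w. 0 \<partial>(A \<Otimes>\<^sub>M B))"
      by (intro integral_cong_AE) auto
    then show ?thesis by simp
  next
    case False
    then have vp: "v1 > 0" "v2 > 0" using v by auto
    obtain \<tau>1 where \<tau>1: "real_distribution \<tau>1" "\<And>x. measure \<tau>1 {x} = 0" "\<And>t. char \<tau>1 t = of_real (cov A R1 C1 C1 t / v1)"
      using A.spectral_distribution[OF C1 v1_def[symmetric] vp(1) cont(1) mix(1)] by metis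
    obtain \<tau>2 where \<tau>2: "real_distribution \<tau>2" "\<And>x. measure \<tau>2 {x} = 0" "\<And>t. char \<tau>2 t = of_real (cov B R2 C2 C2 t / v2)"
      using B.spectral_distribution[OF C2 v2_def[symmetric] vp(2) cont(2) mix(2)] by metis
    interpret \<tau>1: real_distribution \<tau>1 by fact
    interpret \<tau>2: real_distribution \<tau>2 by fact
    interpret \<tau>\<tau>: pair_prob_space \<tau>1 \<tau>2 ..
    \<comment> \<open>The times carry a minus sign so that applying the diagonal action at time
      \<open>u\<close> to \<open>f\<close> adds \<open>u\<close> to both arguments of
      \<open>k\<close>.\<close>
    define g where "g s r w = centered A C1 (R1 (- s) (fst w)) * centered B C2 (R2 (- r) (snd w))" for s r w
    define f where "f w = centered X D (q w)" for w
    have [measurable]: "g s r \<in> borel_measurable (A \<Otimes>\<^sub>M B)" for s r unfolding g_def by measurable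
    have [measurable]: "f \<in> borel_measurable (A \<Otimes>\<^sub>M B)" unfolding f_def by measurable
    have g1: "\<bar>g s r w\<bar> \<le> 1" for s r w
    proof -
      have "\<bar>centered A C1 x\<bar> * \<bar>centered B C2 y\<bar> \<le> 1 * 1" for x y
        by (intro mult_mono) (auto simp: A.abs_centered_le B.abs_centered_le)
      then show ?thesis unfolding g_def by (simp add: abs_mult)
    qed
    have f1: "\<bar>f w\<bar> \<le> 1" for w unfolding f_def by (rule X.abs_centered_le)
    have gL2: "(\<lambda>w. complex_of_real (g s r w)) \<in> L2 (A \<Otimes>\<^sub>M B)" for s r
      by (rule AB.P.L2_bounded[of _ 1]) (auto simp: g1)
    have fL2: "(\<lambda>w. complex_of_real (f w)) \<in> L2 (A \<Otimes>\<^sub>M B)"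
      by (rule AB.P.L2_bounded[of _ 1]) (auto simp: f1)
    define k where "k s r = (\<integral>w. f w * g s r w \<partial>(A \<Otimes>\<^sub>M B))" for s r
    have gg: "(\<integral>w. g s r w * g s' r' w \<partial>(A \<Otimes>\<^sub>M B)) = cov A R1 C1 C1 (s - s') * cov B R2 C2 C2 (r - r')" for s r s' r'
    proof -
      define u1 where "u1 x = complex_of_real (centered A C1 (R1 (- s) x) * centered A C1 (R1 (- s') x))" for x
      define u2 where "u2 y = complex_of_real (centered B C2 (R2 (- r) y) * centered B C2 (R2 (- r') y))" for y
      have L: "(\<lambda>x. complex_of_real (centered A C1 (R1 t x))) \<in> L2 A" "(\<lambda>x. complex_of_real (centered B C2 (R2 t x))) \<in> L2 B" for t
        by (rule A.L2_bounded[of _ 1] B.L2_bounded[of _ 1]; simp add: A.abs_centered_le B.abs_centered_le)+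
      have i1: "integrable A u1" unfolding u1_def using L2_integrable_mult[OF L(1) L(1)] by simp
      have i2: "integrable B u2" unfolding u2_def using L2_integrable_mult[OF L(2) L(2)] by simp
      have "complex_of_real (\<integral>w. g s r w * g s' r' w \<partial>(A \<Otimes>\<^sub>M B)) = (\<integral>w. u1 (fst w) * u2 (snd w) \<partial>(A \<Otimes>\<^sub>M B))"
        unfolding u1_def u2_def g_def integral_complex_of_real[symmetric]
        by (intro Bochner_Integration.integral_cong refl) (simp add: mult_ac)
      also have "\<dots> = (\<integral>x. u1 x \<partial>A) * (\<integral>y. u2 y \<partial>B)"
        by (rule pair_integral_mult(2)[OF A.prob_space_axioms B.prob_space_axioms i1 i2])
      also have "\<dots> = of_real (cov A R1 C1 C1 (- s - - s') * cov B R2 C2 C2 (- r - - r'))"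
        unfolding u1_def u2_def integral_complex_of_real A.cov_eq_integral[OF C1] B.cov_eq_integral[OF C2] by simp
      finally have "(\<integral>w. g s r w * g s' r' w \<partial>(A \<Otimes>\<^sub>M B)) = cov A R1 C1 C1 (- (s - s')) * cov B R2 C2 C2 (- (r - r'))"
        unfolding of_real_eq_iff by simp
      then show ?thesis unfolding A.cov_uminus[OF C1] B.cov_uminus[OF C2] .
    qed
    \<comment> \<open>With this normalization the translates \<open>c * g s r\<close> have the same
      Gram matrix as the characters in L2 of
      \<open>\<tau>1 \<Otimes>\<^sub>M \<tau>2\<close>.\<close>
    define c where "c = 1 / sqrt (v1 * v2)"
    have c2: "c\<^sup>2 = 1 / (v1 * v2)" unfolding c_def using v by (simp add: power_divide)
    define l where "l s r = complex_of_real (c * k s r)" for s r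
    \<comment> \<open>Cauchy-Schwarz with \<open>\<bar>f w\<bar> \<le> 1\<close> bounds the
      functional by the norm of a combination of translates, and equal Gram matrices turn this into
      the norm of the same combination of characters.\<close>
    have bound: "(cmod (\<Sum>p\<in>K. b p * l (fst p) (snd p)))\<^sup>2
        \<le> (\<integral>w. (cmod (\<Sum>p\<in>K. b p * cis (fst p * fst w + snd p * snd w)))\<^sup>2 \<partial>(\<tau>1 \<Otimes>\<^sub>M \<tau>2))"
      if K: "finite K" for K and b :: "real \<times> real \<Rightarrow> complex"
    proof -
      define G where "G w = (\<Sum>p\<in>K. b p * complex_of_real (g (fst p) (snd p) w))" for w
      have GL2: "G \<in> L2 (A \<Otimes>\<^sub>M B)" unfolding G_def by (intro L2_sum L2_scale gL2)
      have "(\<Sum>p\<in>K. b p * complex_of_real (k (fst p) (snd p))) = (\<integral>w. complex_of_real (f w) * G w \<partial>(A \<Otimes>\<^sub>M B))"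
      proof -
        have "complex_of_real (f w) * G w = (\<Sum>p\<in>K. b p * complex_of_real (f w * g (fst p) (snd p) w))" for w
          unfolding G_def by (simp add: sum_distrib_left mult_ac)
        moreover have "integrable (A \<Otimes>\<^sub>M B) (\<lambda>w. complex_of_real (f w * g s r w))" for s r
          using L2_integrable_mult[OF fL2 gL2] by simp
        ultimately show ?thesis
          by (simp add: Bochner_Integration.integral_sum k_def del: of_real_mult)
      qed
      then have "(cmod (\<Sum>p\<in>K. b p * complex_of_real (k (fst p) (snd p))))\<^sup>2
          \<le> (\<integral>w. (cmod (complex_of_real (f w)))\<^sup>2 \<partial>(A \<Otimes>\<^sub>M B)) * (\<integral>w. (cmod (G w))\<^sup>2 \<partial>(A \<Otimes>\<^sub>M B))"
        using L2_cauchy_schwarz_norm[OF fL2 GL2] by simp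
      also have "\<dots> \<le> 1 * (\<integral>w. (cmod (G w))\<^sup>2 \<partial>(A \<Otimes>\<^sub>M B))"
      proof (rule mult_right_mono)
        have "(\<integral>w. (cmod (complex_of_real (f w)))\<^sup>2 \<partial>(A \<Otimes>\<^sub>M B)) \<le> (\<integral>w. 1 \<partial>(A \<Otimes>\<^sub>M B))"
          by (rule integral_mono[OF L2_integrable_power2[OF fL2]]) (auto simp: abs_square_le_1 f1)
        then show "(\<integral>w. (cmod (complex_of_real (f w)))\<^sup>2 \<partial>(A \<Otimes>\<^sub>M B)) \<le> 1" using AB.P.prob_space by simp
      qed simp
      finally have kG: "(cmod (\<Sum>p\<in>K. b p * complex_of_real (k (fst p) (snd p))))\<^sup>2 \<le> (\<integral>w. (cmod (G w))\<^sup>2 \<partial>(A \<Otimes>\<^sub>M B))" by simp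
      have G_val: "complex_of_real (\<integral>w. (cmod (G w))\<^sup>2 \<partial>(A \<Otimes>\<^sub>M B))
          = (\<Sum>p\<in>K. \<Sum>p'\<in>K. b p * cnj (b p') * complex_of_real (cov A R1 C1 C1 (fst p - fst p') * cov B R2 C2 C2 (snd p - snd p')))"
      proof -
        have "complex_of_real ((cmod (G w))\<^sup>2)
            = (\<Sum>p\<in>K. \<Sum>p'\<in>K. b p * cnj (b p') * complex_of_real (g (fst p) (snd p) w * g (fst p') (snd p') w))" for w
          unfolding G_def cmod_sum_power2 by (simp add: mult_ac)
        moreover have "integrable (A \<Otimes>\<^sub>M B) (\<lambda>w. complex_of_real (g s r w * g s' r' w))" for s r s' r'
          using L2_integrable_mult[OF gL2 gL2] by simp
        ultimately have "(\<integral>w. complex_of_real ((cmod (G w))\<^sup>2) \<partial>(A \<Otimes>\<^sub>M B))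
            = (\<Sum>p\<in>K. \<Sum>p'\<in>K. b p * cnj (b p') * complex_of_real (\<integral>w. g (fst p) (snd p) w * g (fst p') (snd p') w \<partial>(A \<Otimes>\<^sub>M B)))"
          by (simp add: Bochner_Integration.integral_sum del: of_real_mult of_real_power)
        then show ?thesis unfolding integral_complex_of_real gg .
      qed
      define E where "E w = (\<Sum>p\<in>K. b p * cis (fst p * fst w + snd p * snd w))" for w
      have E_val: "complex_of_real (\<integral>w. (cmod (E w))\<^sup>2 \<partial>(\<tau>1 \<Otimes>\<^sub>M \<tau>2))
          = (\<Sum>p\<in>K. \<Sum>p'\<in>K. b p * cnj (b p') * complex_of_real (cov A R1 C1 C1 (fst p - fst p') / v1 * (cov B R2 C2 C2 (snd p - snd p') / v2)))"
      proof -
        have "complex_of_real ((cmod (E w))\<^sup>2)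
            = (\<Sum>p\<in>K. \<Sum>p'\<in>K. b p * cnj (b p') * (cis ((fst p - fst p') * fst w) * cis ((snd p - snd p') * snd w)))" for w
        proof -
          have "(b p * cis (fst p * fst w + snd p * snd w)) * cnj (b p' * cis (fst p' * fst w + snd p' * snd w))
              = b p * cnj (b p') * (cis ((fst p - fst p') * fst w) * cis ((snd p - snd p') * snd w))" for p p'
          proof -
            have c: "cis (fst p * fst w + snd p * snd w) * cis (- (fst p' * fst w + snd p' * snd w))
                = cis ((fst p - fst p') * fst w) * cis ((snd p - snd p') * snd w)"
              by (simp add: cis_mult algebra_simps)
            show ?thesis unfolding c[symmetric] by (simp add: cis_cnj)
          qed
          then show ?thesis unfolding E_def cmod_sum_power2 by (simp only:)
        qed
        moreover have "integrable (\<tau>1 \<Otimes>\<^sub>M \<tau>2) (\<lambda>w. cis (s * fst w) * cis (r * snd w))"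
            "(\<integral>w. cis (s * fst w) * cis (r * snd w) \<partial>(\<tau>1 \<Otimes>\<^sub>M \<tau>2)) = char \<tau>1 s * char \<tau>2 r" for s r
          using pair_integral_mult[OF \<tau>1.prob_space_axioms \<tau>2.prob_space_axioms, of "\<lambda>x. cis (s * x)" "\<lambda>x. cis (r * x)"]
          by (simp_all add: \<tau>1.integrable_cis \<tau>2.integrable_cis \<tau>1.char_eq_cis \<tau>2.char_eq_cis)
        ultimately have "(\<integral>w. complex_of_real ((cmod (E w))\<^sup>2) \<partial>(\<tau>1 \<Otimes>\<^sub>M \<tau>2))
            = (\<Sum>p\<in>K. \<Sum>p'\<in>K. b p * cnj (b p') * (char \<tau>1 (fst p - fst p') * char \<tau>2 (snd p - snd p')))"
          by (simp add: Bochner_Integration.integral_sum del: of_real_power)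
        then show ?thesis unfolding integral_complex_of_real \<tau>1(3) \<tau>2(3) by simp
      qed
      have "complex_of_real (c\<^sup>2 * (\<integral>w. (cmod (G w))\<^sup>2 \<partial>(A \<Otimes>\<^sub>M B))) = complex_of_real (\<integral>w. (cmod (E w))\<^sup>2 \<partial>(\<tau>1 \<Otimes>\<^sub>M \<tau>2))"
        unfolding of_real_mult G_val E_val c2 sum_distrib_left by (intro sum.cong refl) simp
      then have cG: "c\<^sup>2 * (\<integral>w. (cmod (G w))\<^sup>2 \<partial>(A \<Otimes>\<^sub>M B)) = (\<integral>w. (cmod (E w))\<^sup>2 \<partial>(\<tau>1 \<Otimes>\<^sub>M \<tau>2))"
        unfolding of_real_eq_iff .
      have "(\<Sum>p\<in>K. b p * l (fst p) (snd p)) = of_real c * (\<Sum>p\<in>K. b p * complex_of_real (k (fst p) (snd p)))"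
        unfolding l_def sum_distrib_left by (intro sum.cong refl) simp
      then have "(cmod (\<Sum>p\<in>K. b p * l (fst p) (snd p)))\<^sup>2 = c\<^sup>2 * (cmod (\<Sum>p\<in>K. b p * complex_of_real (k (fst p) (snd p))))\<^sup>2"
        by (simp add: norm_mult power_mult_distrib)
      also have "\<dots> \<le> c\<^sup>2 * (\<integral>w. (cmod (G w))\<^sup>2 \<partial>(A \<Otimes>\<^sub>M B))" using kG by (intro mult_left_mono) auto
      finally show ?thesis unfolding cG E_def .
    qed
    \<comment> \<open>The weak limit of \<open>T\<close> concerns functions on \<open>X\<close>,
      whereas \<open>g s r\<close> lives on the product; it is replaced by its conditional
      expectation \<open>F\<close>.\<close>
    have limit: "(\<lambda>n. l (\<tau> n + s) (\<tau> n + r)) \<longlonglongrightarrow> of_real (1 - a) * (CLINT t|P. l (t + s) (t + r))" for s r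
    proof -
      obtain F where F: "F \<in> L2 X"
        and FE: "\<And>E. E \<in> sets X \<Longrightarrow> (\<integral>x. F x * indicator E x \<partial>X) = of_real (\<integral>w. indicator E (q w) * g s r w \<partial>(A \<Otimes>\<^sub>M B))"
        by (rule factor_density[OF AB.P.prob_space_axioms q, of "g s r"]) (auto simp: g1)
      have kF: "(\<integral>x. complex_of_real (centered X D (T u x)) * F x \<partial>X) = of_real (k (u + s) (u + r))" for u
      proof -
        \<comment> \<open>Translation by \<open>T u\<close> turns the centered indicator of
          \<open>D\<close> into that of the preimage \<open>Du\<close>, which is a set of
          \<open>X\<close> and can be tested against \<open>F\<close> through
          \<open>FE\<close>.\<close>
        define Du where "Du = {x \<in> space X. T u x \<in> D}"
        have Du [measurable]: "Du \<in> sets X" unfolding Du_def by measurable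
        have mD: "measure X Du = measure X D" unfolding Du_def by (rule measure_preserving_measure[OF X.T_mp D])
        have cD: "centered X D (T u x) = centered X Du x" if "x \<in> space X" for x
          unfolding centered_def mD using that by (simp add: Du_def indicator_def)
        have ind: "(\<lambda>x. indicator E x) \<in> L2 X" if "E \<in> sets X" for E
          by (rule X.L2_bounded[of _ 1]) (use that in \<open>auto simp: indicator_def\<close>)
        have space1: "(\<integral>x. F x \<partial>X) = (\<integral>x. F x * indicator (space X) x \<partial>X)"
          by (intro Bochner_Integration.integral_cong) auto
        have sq: "indicator (space X) (q w) = (1 :: real)" if "w \<in> space (A \<Otimes>\<^sub>M B)" for w
          using measurable_space[of q "A \<Otimes>\<^sub>M B" X w] that by simp
        have iq: "integrable (A \<Otimes>\<^sub>M B) (\<lambda>w. indicator E (q w) * g s r w)" if [measurable]: "E \<in> sets X" for E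
        proof (rule AB.P.integrable_const_bound[of _ 1])
          have "indicator E x * \<bar>g s r w\<bar> \<le> 1" for x w using g1 by (simp add: indicator_def)
          then show "AE w in A \<Otimes>\<^sub>M B. norm (indicator E (q w) * g s r w) \<le> 1" by (simp add: abs_mult)
        qed measurable
        have "(\<integral>x. complex_of_real (centered X D (T u x)) * F x \<partial>X)
            = (\<integral>x. F x * indicator Du x - of_real (measure X D) * (F x * indicator (space X) x) \<partial>X)"
        proof (rule Bochner_Integration.integral_cong[OF refl])
          fix x assume x: "x \<in> space X"
          show "complex_of_real (centered X D (T u x)) * F x
              = F x * indicator Du x - of_real (measure X D) * (F x * indicator (space X) x)"
            unfolding cD[OF x] unfolding centered_def mD using x by (simp add: algebra_simps of_real_indicator)
        qed
        also have "\<dots> = (\<integral>x. F x * indicator Du x \<partial>X) - of_real (measure X D) * (\<integral>x. F x * indicator (space X) x \<partial>X)"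
          using L2_integrable_mult[OF F ind[OF Du]] L2_integrable_mult[OF F ind[OF sets.top]] by simp
        also have "\<dots> = complex_of_real ((\<integral>w. indicator Du (q w) * g s r w \<partial>(A \<Otimes>\<^sub>M B))
            - measure X D * (\<integral>w. indicator (space X) (q w) * g s r w \<partial>(A \<Otimes>\<^sub>M B)))"
          by (simp add: FE)
        also have "(\<integral>w. indicator Du (q w) * g s r w \<partial>(A \<Otimes>\<^sub>M B)) - measure X D * (\<integral>w. indicator (space X) (q w) * g s r w \<partial>(A \<Otimes>\<^sub>M B))
            = (\<integral>w. indicator Du (q w) * g s r w - measure X D * (indicator (space X) (q w) * g s r w) \<partial>(A \<Otimes>\<^sub>M B))"
          using iq[OF Du] iq[OF sets.top] by simp
        also have "\<dots> = (\<integral>w. centered X Du (q w) * g s r w \<partial>(A \<Otimes>\<^sub>M B))"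
          by (intro Bochner_Integration.integral_cong) (auto simp: sq centered_def mD algebra_simps)
        also have "\<dots> = (\<integral>w. f (map_prod (R1 u) (R2 u) w) * g (u + s) (u + r) (map_prod (R1 u) (R2 u) w) \<partial>(A \<Otimes>\<^sub>M B))"
        proof (rule integral_cong_AE)
          show "AE w in A \<Otimes>\<^sub>M B. centered X Du (q w) * g s r w
              = f (map_prod (R1 u) (R2 u) w) * g (u + s) (u + r) (map_prod (R1 u) (R2 u) w)"
            using eq[of u] AE_space
          proof eventually_elim
            case (elim w)
            then have w: "fst w \<in> space A" "snd w \<in> space B" "q w \<in> space X"
              using measurable_space[of q "A \<Otimes>\<^sub>M B" X w] by (auto simp: space_pair_measure)
            have "R1 (- (u + s)) (R1 u (fst w)) = R1 (- s) (fst w)"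
              using A.T_add[OF w(1), of "- (u + s)" u] by simp
            moreover have "R2 (- (u + r)) (R2 u (snd w)) = R2 (- r) (snd w)"
              using B.T_add[OF w(2), of "- (u + r)" u] by simp
            ultimately show ?case using elim(1) cD[OF w(3)] unfolding f_def g_def by simp
          qed
        qed (use W.T_measurable in measurable)
        also have "\<dots> = k (u + s) (u + r)"
          unfolding k_def by (rule measure_preserving_integral[OF W.T_mp, where g="\<lambda>w. f w * g (u + s) (u + r) w"]) measurable
        finally show ?thesis .
      qed
      have "(\<lambda>n. complex_of_real c * complex_of_real (k (\<tau> n + s) (\<tau> n + r)))
          \<longlonglongrightarrow> complex_of_real c * (of_real (1 - a) * (CLINT t|P. complex_of_real (k (t + s) (t + r))))"
        using weak_limit_centered[OF X.prob_space_axioms X.T_mp lim D F] unfolding kF by (intro tendsto_intros)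
      then show ?thesis unfolding l_def by (simp add: mult_ac)
    qed
    have "l 0 0 = 0"
      by (rule joint_functional_zero[OF \<tau>1(1,2) \<tau>2(1,2) P _ bound limit]) (use a in auto)
    then have "k 0 0 = 0" unfolding l_def c_def using vp by simp
    moreover have "k 0 0 = (\<integral>w. centered X D (q w) * (centered A C1 (fst w) * centered B C2 (snd w)) \<partial>(A \<Otimes>\<^sub>M B))"
      unfolding k_def f_def g_def
      by (intro Bochner_Integration.integral_cong) (auto simp: space_pair_measure A.T_zero B.T_zero)
    ultimately show ?thesis by simp
  qed
qed

section \<open>Functions of one coordinate\<close>

lemma rectangle_sets_gen:
  "sets (A \<Otimes>\<^sub>M B) = sigma_sets (space (A \<Otimes>\<^sub>M B)) {C \<times> D |C D. C \<in> sets A \<and> D \<in> sets B}"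
  by (simp add: sets_pair_measure space_pair_measure)

text \<open>The integral of \<open>f\<close> over a set is additive and at most twice its measure,
  so vanishing extends from rectangles to all measurable sets. On the sets where \<open>f\<close> or
  \<open>- f\<close> is positive this forces \<open>f\<close> to vanish.\<close>

lemma AE_zero_of_rectangles:
  fixes f :: "'a \<times> 'b \<Rightarrow> real"
  assumes A: "prob_space A" and B: "prob_space B" and f [measurable]: "f \<in> borel_measurable (A \<Otimes>\<^sub>M B)"
    and bdd: "\<And>w. \<bar>f w\<bar> \<le> 2"
    and rect: "\<And>C D. C \<in> sets A \<Longrightarrow> D \<in> sets B \<Longrightarrow> (\<integral>w. f w * (indicator C (fst w) * indicator D (snd w)) \<partial>(A \<Otimes>\<^sub>M B)) = 0"
  shows "AE w in A \<Otimes>\<^sub>M B. f w = 0"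
proof -
  interpret A: prob_space A by fact
  interpret B: prob_space B by fact
  interpret AB: pair_prob_space A B ..
  define \<kappa> where "\<kappa> S t = (\<integral>w. f w * indicator S w \<partial>(A \<Otimes>\<^sub>M B))" for S and t :: real
  have int: "integrable (A \<Otimes>\<^sub>M B) (\<lambda>w. f w * indicator S w)" if [measurable]: "S \<in> sets (A \<Otimes>\<^sub>M B)" for S
    by (rule AB.P.integrable_const_bound[of _ 2]) (auto simp: abs_mult indicator_def bdd)
  have total: "(\<integral>w. f w * indicator (space (A \<Otimes>\<^sub>M B)) w \<partial>(A \<Otimes>\<^sub>M B)) = 0"
    using rect[OF sets.top sets.top] by (subst Bochner_Integration.integral_cong[OF refl]) (auto simp: space_pair_measure indicator_def)
  have zero: "\<forall>t. \<kappa> S t = 0" if S: "S \<in> sets (A \<Otimes>\<^sub>M B)" for S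
  proof (rule additive_family_induct[OF AB.P.prob_space_axioms rectangle_sets_gen, where \<kappa>=\<kappa> and P="\<lambda>f. \<forall>t. f t = 0", OF _ _ _ _ _ _ _ _ _ _ S])
    show "Int_stable {C \<times> D |C D. C \<in> sets A \<and> D \<in> sets B}" by (rule Int_stable_pair_measure_generator)
    show "{C \<times> D |C D. C \<in> sets A \<and> D \<in> sets B} \<subseteq> Pow (space (A \<Otimes>\<^sub>M B))"
      using pair_measure_closed[of A B] by (simp add: space_pair_measure)
    show "\<kappa> (space (A \<Otimes>\<^sub>M B) - S) t = - \<kappa> S t" if S: "S \<in> sets (A \<Otimes>\<^sub>M B)" for S t
    proof -
      have "\<kappa> (space (A \<Otimes>\<^sub>M B) - S) t = (\<integral>w. f w * indicator (space (A \<Otimes>\<^sub>M B)) w - f w * indicator S w \<partial>(A \<Otimes>\<^sub>M B))"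
        unfolding \<kappa>_def by (intro Bochner_Integration.integral_cong) (auto simp: indicator_def)
      also have "\<dots> = - \<kappa> S t" unfolding \<kappa>_def using int[OF S] int[OF sets.top] total by simp
      finally show ?thesis .
    qed
    show "\<kappa> (S \<union> S') t = \<kappa> S t + \<kappa> S' t" if S: "S \<in> sets (A \<Otimes>\<^sub>M B)" "S' \<in> sets (A \<Otimes>\<^sub>M B)" "S \<inter> S' = {}" for S S' t
    proof -
      have "\<kappa> (S \<union> S') t = (\<integral>w. f w * indicator S w + f w * indicator S' w \<partial>(A \<Otimes>\<^sub>M B))"
        unfolding \<kappa>_def using S(3) by (intro Bochner_Integration.integral_cong) (auto simp: indicator_def)
      also have "\<dots> = \<kappa> S t + \<kappa> S' t" unfolding \<kappa>_def using int[OF S(1)] int[OF S(2)] by simp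
      finally show ?thesis .
    qed
    show "\<bar>\<kappa> S t\<bar> \<le> 2 * measure (A \<Otimes>\<^sub>M B) S" if S [measurable]: "S \<in> sets (A \<Otimes>\<^sub>M B)" for S t
    proof -
      have "\<bar>\<kappa> S t\<bar> \<le> (\<integral>w. \<bar>f w * indicator S w\<bar> \<partial>(A \<Otimes>\<^sub>M B))"
        unfolding \<kappa>_def using integral_norm_bound[of "A \<Otimes>\<^sub>M B" "\<lambda>w. f w * indicator S w"] by simp
      also have "\<dots> \<le> (\<integral>w. 2 * indicator S w \<partial>(A \<Otimes>\<^sub>M B))"
      proof (rule integral_mono)
        show "integrable (A \<Otimes>\<^sub>M B) (\<lambda>w. \<bar>f w * indicator S w\<bar>)" using int[OF S] by (rule integrable_abs)
        show "integrable (A \<Otimes>\<^sub>M B) (\<lambda>w. 2 * indicator S w :: real)" by (simp add: AB.P.emeasure_eq_measure)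
      qed (auto simp: abs_mult indicator_def bdd)
      finally show ?thesis by (simp add: AB.P.emeasure_eq_measure)
    qed
    show "\<forall>t. f t = 0" if "\<And>\<epsilon>. \<epsilon> > 0 \<Longrightarrow> \<exists>g. (\<forall>t. g t = 0) \<and> (\<forall>t. \<bar>f t - g t\<bar> \<le> \<epsilon>)" for f :: "real \<Rightarrow> real"
    proof
      fix t
      have "\<bar>f t\<bar> \<le> \<epsilon>" if "\<epsilon> > 0" for \<epsilon>
        using \<open>\<And>\<epsilon>. \<epsilon> > 0 \<Longrightarrow> \<exists>g. (\<forall>t. g t = 0) \<and> (\<forall>t. \<bar>f t - g t\<bar> \<le> \<epsilon>)\<close>[OF that] by force
      then have "\<bar>f t\<bar> \<le> 0" by (rule field_le_epsilon[of _ 0, simplified])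
      then show "f t = 0" by simp
    qed
    show "\<forall>t. \<kappa> S t = 0" if SS: "S \<in> {C \<times> D |C D. C \<in> sets A \<and> D \<in> sets B}" for S
    proof -
      obtain C D where CD: "S = C \<times> D" "C \<in> sets A" "D \<in> sets B" using SS by blast
      have "f w * indicator S w = f w * (indicator C (fst w) * indicator D (snd w))" for w
        unfolding CD(1) by (cases w) (simp add: indicator_times)
      then show ?thesis unfolding \<kappa>_def using rect[OF CD(2,3)] by (simp only:) simp
    qed
  qed auto
  have "AE w in A \<Otimes>\<^sub>M B. s * f w \<le> 0" if s: "\<bar>s\<bar> = 1" for s
  proof -
    define S where "S = {w \<in> space (A \<Otimes>\<^sub>M B). 0 < s * f w}"
    have S [measurable]: "S \<in> sets (A \<Otimes>\<^sub>M B)" unfolding S_def by measurable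
    have "(\<integral>w. s * (f w * indicator S w) \<partial>(A \<Otimes>\<^sub>M B)) = 0" using zero[OF S] unfolding \<kappa>_def by simp
    moreover have "integrable (A \<Otimes>\<^sub>M B) (\<lambda>w. s * (f w * indicator S w))" using int[OF S] by simp
    moreover have "AE w in A \<Otimes>\<^sub>M B. 0 \<le> s * (f w * indicator S w)"
      by (intro AE_I2) (auto simp: S_def indicator_def)
    ultimately have "AE w in A \<Otimes>\<^sub>M B. s * (f w * indicator S w) = 0"
      using integral_nonneg_eq_0_iff_AE by blast
    then show ?thesis
      using AE_space
    proof eventually_elim
      case (elim w)
      then show ?case by (cases "w \<in> S") (auto simp: S_def)
    qed
  qed
  from this[of 1] this[of "-1"] have "AE w in A \<Otimes>\<^sub>M B. f w \<le> 0" "AE w in A \<Otimes>\<^sub>M B. - f w \<le> 0" by auto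
  then show ?thesis by eventually_elim simp
qed

text \<open>Multiply \<open>F\<^sup>2 = F\<close>, where \<open>F = m + u(x) + v(y)\<close>, by \<open>u(x) v(y)\<close> and integrate: only
  \<open>2 (\<integral>u\<^sup>2)(\<integral>v\<^sup>2)\<close> survives.\<close>

lemma idempotent_sum_trivial:
  fixes u :: "'a \<Rightarrow> real" and v :: "'b \<Rightarrow> real"
  assumes A: "prob_space A" and B: "prob_space B"
    and u [measurable]: "u \<in> borel_measurable A" and v [measurable]: "v \<in> borel_measurable B"
    and u1: "\<And>x. \<bar>u x\<bar> \<le> 1" and v1: "\<And>y. \<bar>v y\<bar> \<le> 1"
    and u0: "(\<integral>x. u x \<partial>A) = 0" and v0: "(\<integral>y. v y \<partial>B) = 0"
    and idem: "AE w in A \<Otimes>\<^sub>M B. (m + u (fst w) + v (snd w))\<^sup>2 = m + u (fst w) + v (snd w)"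
  shows "(AE x in A. u x = 0) \<or> (AE y in B. v y = 0)"
proof -
  interpret A: prob_space A by fact
  interpret B: prob_space B by fact
  interpret AB: pair_prob_space A B ..
  have iu: "integrable A (\<lambda>x. u x ^ i)" for i
    by (rule A.integrable_const_bound[of _ 1]) (auto simp: power_abs power_le_one u1)
  have iv: "integrable B (\<lambda>y. v y ^ i)" for i
    by (rule B.integrable_const_bound[of _ 1]) (auto simp: power_abs power_le_one v1)
  define r where "r i j w = u (fst w) ^ i * v (snd w) ^ j" for i j w
  have r_int: "integrable (A \<Otimes>\<^sub>M B) (r i j)" "(\<integral>w. r i j w \<partial>(A \<Otimes>\<^sub>M B)) = (\<integral>x. u x ^ i \<partial>A) * (\<integral>y. v y ^ j \<partial>B)" for i j
    unfolding r_def by (rule pair_integral_mult[OF A B iu iv])+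
  \<comment> \<open>Every monomial on the right except \<open>r 2 2\<close> has exponent 1 in
    \<open>u\<close> or in \<open>v\<close> and so integrates to 0.\<close>
  have ident: "r 1 1 w * ((m + u (fst w) + v (snd w))\<^sup>2 - (m + u (fst w) + v (snd w)))
      = (m * m - m) * r 1 1 w + (2 * m - 1) * r 2 1 w + (2 * m - 1) * r 1 2 w + r 3 1 w + 2 * r 2 2 w + r 1 3 w" for w
    unfolding r_def by (simp add: power2_eq_square power3_eq_cube algebra_simps)
  have "(\<integral>w. (m * m - m) * r 1 1 w + (2 * m - 1) * r 2 1 w + (2 * m - 1) * r 1 2 w + r 3 1 w + 2 * r 2 2 w + r 1 3 w \<partial>(A \<Otimes>\<^sub>M B)) = 0"
  proof -
    have "AE w in A \<Otimes>\<^sub>M B. r 1 1 w * ((m + u (fst w) + v (snd w))\<^sup>2 - (m + u (fst w) + v (snd w))) = 0"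
      using idem by eventually_elim simp
    then have "(\<integral>w. r 1 1 w * ((m + u (fst w) + v (snd w))\<^sup>2 - (m + u (fst w) + v (snd w))) \<partial>(A \<Otimes>\<^sub>M B)) = (\<integral>w. 0 \<partial>(A \<Otimes>\<^sub>M B))"
      unfolding r_def by (intro integral_cong_AE) auto
    then show ?thesis unfolding ident by simp
  qed
  moreover have "(\<integral>w. (m * m - m) * r 1 1 w + (2 * m - 1) * r 2 1 w + (2 * m - 1) * r 1 2 w + r 3 1 w + 2 * r 2 2 w + r 1 3 w \<partial>(A \<Otimes>\<^sub>M B))
      = 2 * ((\<integral>x. (u x)\<^sup>2 \<partial>A) * (\<integral>y. (v y)\<^sup>2 \<partial>B))"
    using u0 v0 by (simp add: r_int)
  ultimately have "(\<integral>x. (u x)\<^sup>2 \<partial>A) = 0 \<or> (\<integral>y. (v y)\<^sup>2 \<partial>B) = 0" by simp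
  then show ?thesis
    using integral_nonneg_eq_0_iff_AE[OF iu[of 2]] integral_nonneg_eq_0_iff_AE[OF iv[of 2]] by simp
qed

text \<open>\<open>u\<close> and \<open>v\<close> are the conditional expectations of
  \<open>f\<close> on the two coordinates. Orthogonality to products of centered indicators says
  that \<open>f - u - v\<close> integrates to 0 over every rectangle, so it vanishes, and
  \<open>idempotent_sum_trivial\<close> removes one of the two summands.\<close>

lemma orthogonal_imp_one_coordinate:
  assumes A: "prob_space A" and B: "prob_space B" and q: "measure_preserving (A \<Otimes>\<^sub>M B) X q"
    and D [measurable]: "D \<in> sets X"
    and orth: "\<And>C1 C2. C1 \<in> sets A \<Longrightarrow> C2 \<in> sets B \<Longrightarrow>
      (\<integral>w. centered X D (q w) * (centered A C1 (fst w) * centered B C2 (snd w)) \<partial>(A \<Otimes>\<^sub>M B)) = 0"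
  shows "(\<exists>g\<in>borel_measurable A. AE w in A \<Otimes>\<^sub>M B. indicator D (q w) = (g (fst w) :: real)) \<or>
    (\<exists>g\<in>borel_measurable B. AE w in A \<Otimes>\<^sub>M B. indicator D (q w) = (g (snd w) :: real))"
proof -
  interpret A: prob_space A by fact
  interpret B: prob_space B by fact
  interpret AB: pair_prob_space A B ..
  have [measurable]: "q \<in> measurable (A \<Otimes>\<^sub>M B) X" by (rule measure_preserving_measurable[OF q])
  interpret X: prob_space X
    using AB.P.prob_space_distr[of q X] q unfolding measure_preserving_def by simp
  define m where "m = measure X D"
  define f where "f w = centered X D (q w)" for w
  have [measurable]: "f \<in> borel_measurable (A \<Otimes>\<^sub>M B)" unfolding f_def by measurable
  have f1: "\<bar>f w\<bar> \<le> 1" for w unfolding f_def by (rule X.abs_centered_le)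
  have if1: "integrable (A \<Otimes>\<^sub>M B) (\<lambda>w. f w * g w)" if "g \<in> borel_measurable (A \<Otimes>\<^sub>M B)" "\<And>w. \<bar>g w\<bar> \<le> 1" for g
  proof (rule AB.P.integrable_const_bound[of _ 1])
    have "\<bar>f w\<bar> * \<bar>g w\<bar> \<le> 1 * 1" for w by (intro mult_mono) (auto simp: f1 that)
    then show "AE w in A \<Otimes>\<^sub>M B. norm (f w * g w) \<le> 1" by (simp add: abs_mult)
  qed (use that in measurable)
  have if0: "integrable (A \<Otimes>\<^sub>M B) f" using if1[of "\<lambda>_. 1"] by simp
  define u where "u x = (\<integral>y. f (x, y) \<partial>B)" for x
  define v where "v y = (\<integral>x. f (x, y) \<partial>A)" for y
  have [measurable]: "u \<in> borel_measurable A" "v \<in> borel_measurable B" unfolding u_def v_def by measurable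
  have avg1: "\<bar>\<integral>y. h y \<partial>N\<bar> \<le> 1" if N: "prob_space N" and h: "\<And>y. \<bar>h y\<bar> \<le> 1" for N :: "'z measure" and h :: "'z \<Rightarrow> real"
  proof -
    interpret N: prob_space N by fact
    have "\<bar>\<integral>y. h y \<partial>N\<bar> \<le> (\<integral>y. \<bar>h y\<bar> \<partial>N)" using integral_norm_bound[of N h] by simp
    also have "\<dots> \<le> (\<integral>y. 1 \<partial>N)" by (rule integral_mono') (auto simp: h)
    finally show ?thesis using N.prob_space by simp
  qed
  have u1: "\<bar>u x\<bar> \<le> 1" for x unfolding u_def by (rule avg1[OF B]) (rule f1)
  have v1: "\<bar>v y\<bar> \<le> 1" for y unfolding v_def by (rule avg1[OF A]) (rule f1)
  have f_mean: "(\<integral>w. f w \<partial>(A \<Otimes>\<^sub>M B)) = 0"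
    unfolding f_def using measure_preserving_integral[OF q X.centered_measurable[OF D]] X.centered_mean[OF D] by simp
  have u0: "(\<integral>x. u x \<partial>A) = 0" unfolding u_def using AB.integral_fst'[OF if0] f_mean by simp
  have v0: "(\<integral>y. v y \<partial>B) = 0"
    unfolding v_def using AB.integral_snd[of "\<lambda>x y. f (x, y)"] if0 f_mean by simp
  have iu: "integrable A u" by (rule A.integrable_const_bound[of _ 1]) (auto simp: u1)
  have iv: "integrable B v" by (rule B.integrable_const_bound[of _ 1]) (auto simp: v1)
  \<comment> \<open>Halving brings the function below the bound 2 of
    \<open>AE_zero_of_rectangles\<close>.\<close>
  define h where "h w = (f w - u (fst w) - v (snd w)) / 2" for w
  have "AE w in A \<Otimes>\<^sub>M B. h w = 0"
  proof (rule AE_zero_of_rectangles[OF A B])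
    show "h \<in> borel_measurable (A \<Otimes>\<^sub>M B)" unfolding h_def by measurable
    show "\<bar>h w\<bar> \<le> 2" for w 
    proof -
      have "\<bar>f w - u (fst w) - v (snd w)\<bar> \<le> 4" using f1[of w] u1[of "fst w"] v1[of "snd w"] by linarith
      then show ?thesis unfolding h_def by simp
    qed
    fix C1 C2 assume [measurable]: "C1 \<in> sets A" "C2 \<in> sets B"
    let ?c = "\<lambda>x. indicator C1 x :: real" and ?d = "\<lambda>y. indicator C2 y :: real"
    have bounds: "\<bar>?c x\<bar> \<le> 1" "\<bar>?d y\<bar> \<le> 1" for x y by (auto simp: indicator_def)
    have i1: "integrable (A \<Otimes>\<^sub>M B) (\<lambda>w. f w * ?c (fst w))" by (rule if1) (auto simp: bounds)
    have i2: "integrable (A \<Otimes>\<^sub>M B) (\<lambda>w. f w * ?d (snd w))" by (rule if1) (auto simp: bounds)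
    have i12: "integrable (A \<Otimes>\<^sub>M B) (\<lambda>w. f w * (?c (fst w) * ?d (snd w)))"
      by (rule if1) (auto simp: indicator_def)
    have c_int: "integrable A ?c" "(\<integral>x. ?c x \<partial>A) = measure A C1" by (auto simp: A.emeasure_eq_measure)
    have d_int: "integrable B ?d" "(\<integral>y. ?d y \<partial>B) = measure B C2" by (auto simp: B.emeasure_eq_measure)
    have iuc: "integrable A (\<lambda>x. u x * ?c x)"
      by (rule A.integrable_const_bound[of _ 1]) (auto simp: u1 indicator_def)
    have ivd: "integrable B (\<lambda>y. v y * ?d y)"
      by (rule B.integrable_const_bound[of _ 1]) (auto simp: v1 indicator_def)
    have fc: "(\<integral>w. f w * ?c (fst w) \<partial>(A \<Otimes>\<^sub>M B)) = (\<integral>x. u x * ?c x \<partial>A)"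
      using AB.integral_fst'[OF i1] unfolding u_def by simp
    have fd: "(\<integral>w. f w * ?d (snd w) \<partial>(A \<Otimes>\<^sub>M B)) = (\<integral>y. v y * ?d y \<partial>B)"
      using AB.integral_snd[of "\<lambda>x y. f (x, y) * ?d y"] i2 unfolding v_def by (simp add: case_prod_beta')
    note uc = pair_integral_mult[OF A B iuc d_int(1)] and vd = pair_integral_mult[OF A B c_int(1) ivd]
    have "0 = (\<integral>w. f w * (?c (fst w) * ?d (snd w)) - measure B C2 * (f w * ?c (fst w)) - measure A C1 * (f w * ?d (snd w))
        + (measure A C1 * measure B C2) * f w \<partial>(A \<Otimes>\<^sub>M B))"
      using orth[of C1 C2] unfolding f_def[symmetric] centered_def[of A] centered_def[of B] by (simp add: algebra_simps)
    also have "\<dots> = (\<integral>w. f w * (?c (fst w) * ?d (snd w)) \<partial>(A \<Otimes>\<^sub>M B)) - measure B C2 * (\<integral>x. u x * ?c x \<partial>A)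
        - measure A C1 * (\<integral>y. v y * ?d y \<partial>B)"
      using i1 i2 i12 if0 by (simp add: fc fd f_mean)
    finally have key: "(\<integral>w. f w * (?c (fst w) * ?d (snd w)) \<partial>(A \<Otimes>\<^sub>M B))
        = (\<integral>x. u x * ?c x \<partial>A) * measure B C2 + measure A C1 * (\<integral>y. v y * ?d y \<partial>B)" by (simp add: mult.commute)
    have "(\<integral>w. h w * (?c (fst w) * ?d (snd w)) \<partial>(A \<Otimes>\<^sub>M B))
        = (\<integral>w. (f w * (?c (fst w) * ?d (snd w)) - (u (fst w) * ?c (fst w)) * ?d (snd w) - ?c (fst w) * (v (snd w) * ?d (snd w))) / 2 \<partial>(A \<Otimes>\<^sub>M B))"
      unfolding h_def by (intro Bochner_Integration.integral_cong) (auto simp: algebra_simps)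
    also have "\<dots> = 0" using i12 uc vd c_int d_int key by simp
    finally show "(\<integral>w. h w * (?c (fst w) * ?d (snd w)) \<partial>(A \<Otimes>\<^sub>M B)) = 0" .
  qed
  then have dec: "AE w in A \<Otimes>\<^sub>M B. indicator D (q w) = m + u (fst w) + v (snd w)"
    by eventually_elim (simp add: h_def f_def centered_def m_def)
  have "AE w in A \<Otimes>\<^sub>M B. (m + u (fst w) + v (snd w))\<^sup>2 = m + u (fst w) + v (snd w)"
    using dec
  proof eventually_elim
    case (elim w)
    show ?case unfolding elim[symmetric] by (simp add: indicator_def)
  qed
  from idempotent_sum_trivial[OF A B _ _ u1 v1 u0 v0 this]
  consider "AE x in A. u x = 0" | "AE y in B. v y = 0" by auto
  then show ?thesis
  proof cases
    case 1
    from measure_preserving_AE[OF measure_preserving_fst[OF B] 1] dec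
    have "AE w in A \<Otimes>\<^sub>M B. indicator D (q w) = m + v (snd w)" by eventually_elim simp
    then show ?thesis by (intro disjI2 bexI[of _ "\<lambda>y. m + v y"]) auto
  next
    case 2
    from measure_preserving_AE[OF measure_preserving_snd[OF A B] 2] dec
    have "AE w in A \<Otimes>\<^sub>M B. indicator D (q w) = m + u (fst w)" by eventually_elim simp
    then show ?thesis by (intro disjI1 bexI[of _ "\<lambda>x. m + u x"]) auto
  qed
qed

section \<open>From single sets to the whole factor\<close>

lemma (in prob_space) AE_witness2:
  assumes "\<not> (AE x in M. P x)" "AE x in M. Q x"
  obtains x where "\<not> P x" "Q x"
proof -
  have "\<exists>x. \<not> P x \<and> Q x"
  proof (rule ccontr)
    assume "\<not> ?thesis"
    then have *: "\<And>x. Q x \<Longrightarrow> P x" by blast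
    have "AE x in M. P x" using assms(2) by eventually_elim (rule *)
    then show False using assms(1) by simp
  qed
  then show thesis using that by blast
qed

text \<open>The coordinate could still vary with the set. If \<open>D1\<close> is not a function of
  the one coordinate and \<open>D2\<close> not of the other, their indicators are nonconstant
  functions of different coordinates; the indicator of \<open>D1 \<inter> D2\<close> is their
  product, and if it depended on one coordinate, freezing that coordinate would make one of the two
  constant.\<close>

lemma one_coordinate_dichotomy:
  fixes A :: "'a measure" and B :: "'b measure"
  assumes A: "prob_space A" and B: "prob_space B" and q [measurable]: "q \<in> measurable (A \<Otimes>\<^sub>M B) X"
    and dich: "\<And>D. D \<in> sets X \<Longrightarrow>
      (\<exists>g\<in>borel_measurable A. AE w in A \<Otimes>\<^sub>M B. indicator D (q w) = (g (fst w) :: real)) \<or>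
      (\<exists>g\<in>borel_measurable B. AE w in A \<Otimes>\<^sub>M B. indicator D (q w) = (g (snd w) :: real))"
  shows "(\<forall>D\<in>sets X. \<exists>g\<in>borel_measurable A. AE w in A \<Otimes>\<^sub>M B. indicator D (q w) = (g (fst w) :: real)) \<or>
    (\<forall>D\<in>sets X. \<exists>g\<in>borel_measurable B. AE w in A \<Otimes>\<^sub>M B. indicator D (q w) = (g (snd w) :: real))"
proof (rule ccontr)
  interpret A: prob_space A by fact
  interpret B: prob_space B by fact
  interpret AB: pair_prob_space A B ..
  assume neg: "\<not> ?thesis"
  then obtain D1 D2 where D: "D1 \<in> sets X" "D2 \<in> sets X"
    and D1: "\<And>g. g \<in> borel_measurable A \<Longrightarrow> \<not> (AE w in A \<Otimes>\<^sub>M B. indicator D1 (q w) = (g (fst w) :: real))"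
    and D2: "\<And>g. g \<in> borel_measurable B \<Longrightarrow> \<not> (AE w in A \<Otimes>\<^sub>M B. indicator D2 (q w) = (g (snd w) :: real))"
    by blast
  obtain g1 where g1 [measurable]: "g1 \<in> borel_measurable B" and e1: "AE w in A \<Otimes>\<^sub>M B. indicator D1 (q w) = (g1 (snd w) :: real)"
    using dich[OF D(1)] D1 by blast
  obtain g2 where g2 [measurable]: "g2 \<in> borel_measurable A" and e2: "AE w in A \<Otimes>\<^sub>M B. indicator D2 (q w) = (g2 (fst w) :: real)"
    using dich[OF D(2)] D2 by blast
  have n1: "\<not> (AE y in B. g1 y = c)" for c
  proof
    assume "AE y in B. g1 y = c"
    from measure_preserving_AE[OF measure_preserving_snd[OF A B] this] e1
    have "AE w in A \<Otimes>\<^sub>M B. indicator D1 (q w) = c" by eventually_elim simp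
    then show False using D1[of "\<lambda>_. c"] by simp
  qed
  have n2: "\<not> (AE x in A. g2 x = c)" for c
  proof
    assume "AE x in A. g2 x = c"
    from measure_preserving_AE[OF measure_preserving_fst[OF B] this] e2
    have "AE w in A \<Otimes>\<^sub>M B. indicator D2 (q w) = c" by eventually_elim simp
    then show False using D2[of "\<lambda>_. c"] by simp
  qed
  have e12: "AE w in A \<Otimes>\<^sub>M B. indicator (D1 \<inter> D2) (q w) = g1 (snd w) * g2 (fst w)"
    using e1 e2 by eventually_elim (simp add: indicator_inter_arith)
  from dich[of "D1 \<inter> D2"] D
  consider (a) g where "g \<in> borel_measurable A" "AE w in A \<Otimes>\<^sub>M B. indicator (D1 \<inter> D2) (q w) = (g (fst w) :: real)"
    | (b) g where "g \<in> borel_measurable B" "AE w in A \<Otimes>\<^sub>M B. indicator (D1 \<inter> D2) (q w) = (g (snd w) :: real)" by blast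
  then show False
  proof cases
    case a
    from e12 a(2) have "AE w in A \<Otimes>\<^sub>M B. g1 (snd w) * g2 (fst w) = g (fst w)" by eventually_elim simp
    then have "AE x in A. AE y in B. g1 y * g2 x = g x" by (drule_tac AB.AE_pair) simp
    then obtain x where x: "g2 x \<noteq> 0" "AE y in B. g1 y * g2 x = g x"
      by (rule A.AE_witness2[OF n2[of 0]])
    then have "AE y in B. g1 y = g x / g2 x" by (auto simp: field_simps)
    then show False using n1 by blast
  next
    case b
    have [measurable]: "g \<in> borel_measurable B" by fact
    from e12 b(2) have "AE w in A \<Otimes>\<^sub>M B. g1 (snd w) * g2 (fst w) = g (snd w)" by eventually_elim simp
    then have "AE x in A. AE y in B. g1 y * g2 x = g y" by (drule_tac AB.AE_pair) simp
    then have "AE y in B. AE x in A. g1 y * g2 x = g y"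
      by (subst (asm) AB.AE_commute) auto
    then obtain y where y: "g1 y \<noteq> 0" "AE x in A. g1 y * g2 x = g y"
      by (rule B.AE_witness2[OF n1[of 0]])
    then have "AE x in A. g2 x = g y / g1 y" by (auto simp: field_simps)
    then show False using n2 by blast
  qed
qed

text \<open>A countable base of a Hausdorff topology separates points. Through such a family, almost
  sure statements about countably many sets become statements about points.\<close>

lemma standard_borel_separating:
  assumes "standard_borel X"
  shows "\<exists>D :: nat \<Rightarrow> 'a set. (\<forall>n. D n \<in> sets X) \<and>
    (\<forall>x\<in>space X. \<forall>y\<in>space X. (\<forall>n. x \<in> D n \<longleftrightarrow> y \<in> D n) \<longrightarrow> x = y)"
proof -
  obtain T where T: "topspace T = space X" "completely_metrizable_space T" "second_countable T"
    "sets X = sigma_sets (space X) {U. openin T U}"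
    using assms unfolding standard_borel_def by blast
  obtain \<B> where \<B>: "countable \<B>" "\<And>V. V \<in> \<B> \<Longrightarrow> openin T V"
    "\<And>U x. openin T U \<Longrightarrow> x \<in> U \<Longrightarrow> \<exists>V\<in>\<B>. x \<in> V \<and> V \<subseteq> U"
    using T(3) unfolding second_countable_def by metis
  have haus: "Hausdorff_space T"
    using T(2) completely_metrizable_imp_metrizable_space metrizable_imp_Hausdorff_space by blast
  \<comment> \<open>\<open>from_nat_into\<close> enumerates nonempty collections; the added empty
    set covers an empty base.\<close>
  define \<C> where "\<C> = insert {} \<B>"
  have \<C>: "countable \<C>" "\<C> \<noteq> {}" "\<And>V. V \<in> \<C> \<Longrightarrow> openin T V" using \<B> unfolding \<C>_def by auto
  define D where "D = from_nat_into \<C>"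
  have rng: "range D = \<C>" unfolding D_def using \<C> by (simp add: range_from_nat_into)
  show ?thesis
  proof (intro exI[of _ D] conjI allI ballI impI)
    show "D n \<in> sets X" for n
      using \<C>(3)[of "D n"] rng unfolding T(4) by (auto intro: sigma_sets.Basic)
    fix x y assume xy: "x \<in> space X" "y \<in> space X" and eq: "\<forall>n. x \<in> D n \<longleftrightarrow> y \<in> D n"
    show "x = y"
    proof (rule ccontr)
      assume "x \<noteq> y"
      then obtain U where U: "openin T U" "x \<in> U" "y \<notin> U"
        using haus xy T(1) unfolding Hausdorff_space_def by (metis disjnt_iff)
      then obtain V where V: "V \<in> \<B>" "x \<in> V" "V \<subseteq> U" using \<B>(3) by blast
      then obtain n where "D n = V" using rng unfolding \<C>_def by (metis insertCI imageE)
      then show False using eq V U by auto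
    qed
  qed
qed

text \<open>If every set of a separating sequence had measure 0 or 1, almost all points would share
  one membership pattern and so be a single point.\<close>

lemma (in flow) nontrivial_set:
  obtains D where "D \<in> sets M" "0 < measure M D" "measure M D < 1"
proof -
  obtain D :: "nat \<Rightarrow> 'a set" where D [measurable]: "\<And>n. D n \<in> sets M"
    and sep: "\<And>x y. x \<in> space M \<Longrightarrow> y \<in> space M \<Longrightarrow> (\<forall>n. x \<in> D n \<longleftrightarrow> y \<in> D n) \<Longrightarrow> x = y"
    using standard_borel_separating[OF standard_borel] by blast
  have "\<exists>n. 0 < measure M (D n) \<and> measure M (D n) < 1"
  proof (rule ccontr)
    assume "\<not> ?thesis"
    then have triv: "measure M (D n) = 0 \<or> measure M (D n) = 1" for n
      using measure_nonneg[of M "D n"] prob_le_1[of "D n"] by (meson antisym_conv not_le_imp_less)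
    have "AE x in M. x \<in> D n \<longleftrightarrow> measure M (D n) = 1" for n
    proof (cases "measure M (D n) = 1")
      case True
      then have "AE x in M. x \<in> D n" by (subst (asm) prob_eq_1) auto
      then show ?thesis by eventually_elim (simp add: True)
    next
      case False
      then have "measure M (D n) = 0" using triv by blast
      then have "AE x in M. x \<notin> D n" by (subst (asm) prob_eq_0) auto
      then show ?thesis by eventually_elim (simp add: False)
    qed
    then have ae: "AE x in M. \<forall>n. x \<in> D n \<longleftrightarrow> measure M (D n) = 1" by (subst AE_all_countable) blast
    obtain x where x: "x \<in> space M" "\<forall>n. x \<in> D n \<longleftrightarrow> measure M (D n) = 1"
      by (rule AE_witness[OF ae])
    have "AE y in M. y = x" using ae AE_space by eventually_elim (rule sep, use x in auto)
    then show False using nontrivial x(1) by blast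
  qed
  then show thesis using that D by blast
qed

text \<open>The map is \<open>q\<close> with its second argument frozen at a generic
  \<open>y\<close>: almost surely, \<open>q w\<close> and \<open>q (fst w, y)\<close> lie in the
  same sets of a separating sequence.\<close>

lemma one_coordinate_map:
  assumes A: "prob_space A" and B: "prob_space B" and q [measurable]: "q \<in> measurable (A \<Otimes>\<^sub>M B) X"
    and X: "standard_borel X"
    and one: "\<forall>D\<in>sets X. \<exists>g\<in>borel_measurable A. AE w in A \<Otimes>\<^sub>M B. indicator D (q w) = (g (fst w) :: real)"
  obtains \<theta> where "\<theta> \<in> measurable A X" "AE w in A \<Otimes>\<^sub>M B. q w = \<theta> (fst w)"
proof -
  interpret A: prob_space A by fact
  interpret B: prob_space B by fact
  interpret AB: pair_prob_space A B ..
  obtain D :: "nat \<Rightarrow> 'c set" where D [measurable]: "\<And>n. D n \<in> sets X"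
    and sep: "\<And>x y. x \<in> space X \<Longrightarrow> y \<in> space X \<Longrightarrow> (\<forall>n. x \<in> D n \<longleftrightarrow> y \<in> D n) \<Longrightarrow> x = y"
    using standard_borel_separating[OF X] by blast
  have "\<forall>n. \<exists>g. g \<in> borel_measurable A \<and> (AE w in A \<Otimes>\<^sub>M B. indicator (D n) (q w) = (g (fst w) :: real))"
    using one D by blast
  then obtain g where g [measurable]: "\<And>n. g n \<in> borel_measurable A"
    and "\<And>n. AE w in A \<Otimes>\<^sub>M B. indicator (D n) (q w) = (g n (fst w) :: real)" by metis
  then have ae: "AE w in A \<Otimes>\<^sub>M B. \<forall>n. indicator (D n) (q w) = (g n (fst w) :: real)"
    by (subst AE_all_countable) blast
  then have "AE x in A. AE y in B. \<forall>n. indicator (D n) (q (x, y)) = (g n x :: real)" by (drule_tac AB.AE_pair) simp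
  then have "AE y in B. AE x in A. \<forall>n. indicator (D n) (q (x, y)) = (g n x :: real)"
    by (subst (asm) AB.AE_commute) auto
  then obtain y where y: "y \<in> space B" "AE x in A. \<forall>n. indicator (D n) (q (x, y)) = (g n x :: real)"
    by (rule B.AE_witness)
  show thesis
  proof (rule that[of "\<lambda>x. q (x, y)"])
    show "(\<lambda>x. q (x, y)) \<in> measurable A X" using y(1) by measurable
    show "AE w in A \<Otimes>\<^sub>M B. q w = q (fst w, y)"
      using ae measure_preserving_AE[OF measure_preserving_fst[OF B] y(2)] AE_space
    proof eventually_elim
      case (elim w)
      have "q w \<in> space X" "q (fst w, y) \<in> space X"
        using elim(3) y(1) measurable_space[OF q] by (auto simp: space_pair_measure)
      moreover have "q w \<in> D n \<longleftrightarrow> q (fst w, y) \<in> D n" for n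
        using elim(1,2) by (metis (no_types, opaque_lifting) indicator_simps zero_neq_one)
      ultimately show ?case using sep by blast
    qed
  qed
qed

section \<open>Product flows\<close>

lemma measure_preserving_comp:
  assumes "measure_preserving A B f" "measure_preserving B C g"
  shows "measure_preserving A C (\<lambda>x. g (f x))"
  using assms distr_distr[of g B C f A] unfolding measure_preserving_def comp_def by auto

text \<open>The spaces are exchanged before sectioning, so the conclusion is available for arbitrary
  predicates \<open>P\<close>, such as equalities involving maps into the products.\<close>

lemma AE_pair_swapped:
  assumes A: "prob_space A" and B: "prob_space B" and P: "AE w in A \<Otimes>\<^sub>M B. P w"
  shows "AE y in B. AE x in A. P (x, y)"
proof -
  interpret A: prob_space A by fact
  interpret B: prob_space B by fact
  interpret AB: pair_prob_space A B ..
  interpret BA: pair_prob_space B A ..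
  have "measure_preserving (B \<Otimes>\<^sub>M A) (A \<Otimes>\<^sub>M B) (\<lambda>(x, y). (y, x))"
    unfolding measure_preserving_def using AB.distr_pair_swap by simp
  from measure_preserving_AE[OF this P] show ?thesis by (drule_tac BA.AE_pair) simp
qed

text \<open>Equality is agreement on the countably many sets of a separating sequence.\<close>

lemma standard_borel_eq_sets:
  assumes X: "standard_borel X" and f [measurable]: "f \<in> measurable M X" and g [measurable]: "g \<in> measurable M X"
  shows "{x \<in> space M. f x = g x} \<in> sets M"
proof -
  obtain D :: "nat \<Rightarrow> 'a set" where D [measurable]: "\<And>n. D n \<in> sets X"
    and sep: "\<And>x y. x \<in> space X \<Longrightarrow> y \<in> space X \<Longrightarrow> (\<forall>n. x \<in> D n \<longleftrightarrow> y \<in> D n) \<Longrightarrow> x = y"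
    using standard_borel_separating[OF X] by blast
  have "{x \<in> space M. f x = g x} = {x \<in> space M. \<forall>n. f x \<in> D n \<longleftrightarrow> g x \<in> D n}"
    using sep measurable_space[OF f] measurable_space[OF g] by auto
  also have "\<dots> \<in> sets M" by measurable
  finally show ?thesis .
qed

section \<open>Splitting off one coordinate of a product\<close>

definition insert_coord :: "'i \<Rightarrow> 'b \<times> ('i \<Rightarrow> 'b) \<Rightarrow> 'i \<Rightarrow> 'b" where
  "insert_coord j w = (snd w)(j := fst w)"

definition extract_coord :: "'i set \<Rightarrow> 'i \<Rightarrow> ('i \<Rightarrow> 'b) \<Rightarrow> 'b \<times> ('i \<Rightarrow> 'b)" where
  "extract_coord I j y = (y j, restrict y (I - {j}))"

lemma insert_coord_mp:
  assumes N: "\<And>i. prob_space (N i)" and j: "j \<in> I"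
  shows "measure_preserving (N j \<Otimes>\<^sub>M PiM (I - {j}) N) (PiM I N) (insert_coord j)"
proof -
  have eq: "insert_coord j = (\<lambda>(x, X). X(j := x))" by (auto simp: insert_coord_def)
  have I: "insert j (I - {j}) = I" using j by blast
  have "distr (N j \<Otimes>\<^sub>M PiM (I - {j}) N) (PiM I N) (insert_coord j) = PiM I N"
    using distr_pair_PiM_eq_PiM[of "I - {j}" N j] N unfolding eq I by blast
  moreover have "insert_coord j \<in> measurable (N j \<Otimes>\<^sub>M PiM (I - {j}) N) (PiM (insert j (I - {j})) N)"
    unfolding eq by measurable
  ultimately show ?thesis unfolding measure_preserving_def I by blast
qed

lemma extract_coord_mp:
  assumes N: "\<And>i. prob_space (N i)" and j: "j \<in> I"
  shows "measure_preserving (PiM I N) (N j \<Otimes>\<^sub>M PiM (I - {j}) N) (extract_coord I j)"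
proof -
  note ins = insert_coord_mp[of N, OF N j]
  have [measurable]: "extract_coord I j \<in> measurable (PiM I N) (N j \<Otimes>\<^sub>M PiM (I - {j}) N)"
    unfolding extract_coord_def[abs_def] using j
    by (intro measurable_Pair measurable_component_singleton measurable_restrict_subset) auto
  have id: "extract_coord I j (insert_coord j w) = w" if "w \<in> space (N j \<Otimes>\<^sub>M PiM (I - {j}) N)" for w
    using that by (auto simp: extract_coord_def insert_coord_def space_pair_measure space_PiM PiE_iff extensional_def restrict_def prod_eq_iff)
  have "distr (PiM I N) (N j \<Otimes>\<^sub>M PiM (I - {j}) N) (extract_coord I j)
      = distr (distr (N j \<Otimes>\<^sub>M PiM (I - {j}) N) (PiM I N) (insert_coord j)) (N j \<Otimes>\<^sub>M PiM (I - {j}) N) (extract_coord I j)"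
    using ins unfolding measure_preserving_def by simp
  also have "\<dots> = distr (N j \<Otimes>\<^sub>M PiM (I - {j}) N) (N j \<Otimes>\<^sub>M PiM (I - {j}) N) (extract_coord I j \<circ> insert_coord j)"
    using measure_preserving_measurable[OF ins] by (subst distr_distr) auto
  also have "\<dots> = distr (N j \<Otimes>\<^sub>M PiM (I - {j}) N) (N j \<Otimes>\<^sub>M PiM (I - {j}) N) (\<lambda>w. w)"
    by (intro distr_cong) (auto simp: id)
  finally show ?thesis unfolding measure_preserving_def by (simp add: distr_id)
qed

lemma insert_extract:
  "y \<in> space (PiM I N) \<Longrightarrow> j \<in> I \<Longrightarrow> insert_coord j (extract_coord I j y) = y"
  by (auto simp: extract_coord_def insert_coord_def space_PiM PiE_iff extensional_def)

lemma product_flow_insert_coord: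
  "j \<in> I \<Longrightarrow> product_flow I S t (insert_coord j w)
    = insert_coord j (map_prod (S j t) (product_flow (I - {j}) S t) w)"
  by (auto simp: product_flow_def insert_coord_def)

section \<open>Coordinates of an isomorphism between two products\<close>

text \<open>The hypotheses on the factors hold for every index of the type, not just on
  \<open>I\<close>, which spares side conditions; families given on \<open>I\<close> are extended
  before the locale is entered.\<close>

locale product_isomorphism =
  fixes I :: "'i set" and M :: "'i \<Rightarrow> 'a measure" and T :: "'i \<Rightarrow> real \<Rightarrow> 'a \<Rightarrow> 'a"
    and N :: "'i \<Rightarrow> 'b measure" and S :: "'i \<Rightarrow> real \<Rightarrow> 'b \<Rightarrow> 'b"
    and \<Phi> :: "('i \<Rightarrow> 'b) \<Rightarrow> 'i \<Rightarrow> 'a" and \<Psi> :: "('i \<Rightarrow> 'a) \<Rightarrow> 'i \<Rightarrow> 'b"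
  assumes finite_I: "finite I"
    and flow_M: "\<And>i. flow (M i) (T i)" and flow_N: "\<And>i. flow (N i) (S i)"
    and wm: "\<And>i. weakly_mixing (M i) (T i)"
    and \<Phi>_mp: "measure_preserving (PiM I N) (PiM I M) \<Phi>"
    and \<Psi>_mp: "measure_preserving (PiM I M) (PiM I N) \<Psi>"
    and \<Psi>\<Phi>: "AE y in PiM I N. \<Psi> (\<Phi> y) = y"
    and \<Phi>\<Psi>: "AE x in PiM I M. \<Phi> (\<Psi> x) = x"
    and equivariant: "\<And>t. AE y in PiM I N. product_flow I T t (\<Phi> y) = \<Phi> (product_flow I S t y)"
begin

lemma mp_M: "mp_action (M i) (T i)" and mp_N: "mp_action (N i) (S i)"
  by (rule flow.mp_action[OF flow_M] flow.mp_action[OF flow_N])+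

lemma prob_M: "prob_space (M i)" and prob_N: "prob_space (N i)"
  using mp_M[of i] mp_N[of i] by (auto simp: mp_action_def)

lemma prob_PiN: "prob_space (PiM J N)" and prob_PiM: "prob_space (PiM J M)"
  by (rule prob_space_PiM, rule prob_N, rule prob_space_PiM, rule prob_M)

lemma \<Psi>_equivariant: "AE x in PiM I M. \<Psi> (product_flow I T t x) = product_flow I S t (\<Psi> x)"
proof -
  interpret Y: mp_action "PiM I N" "product_flow I S" by (rule mp_action_PiM[OF mp_N finite_I])
  have "AE y in PiM I N. \<Psi> (\<Phi> (product_flow I S t y)) = product_flow I S t y"
    by (rule measure_preserving_AE[OF Y.T_mp \<Psi>\<Phi>])
  from measure_preserving_AE[OF \<Psi>_mp this] measure_preserving_AE[OF \<Psi>_mp equivariant[of t]] \<Phi>\<Psi>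
  show ?thesis by eventually_elim simp
qed

text \<open>Each coordinate of the \<open>S\<close>-side and each complementary product is a factor
  of the product of the \<open>T\<close>-flows through \<open>\<Psi>\<close> followed by a
  projection.\<close>

lemma mixing_sets_coordinate:
  assumes j: "j \<in> I"
  shows "mixing_sets (N j) (S j)" and "mixing_sets (PiM (I - {j}) N) (product_flow (I - {j}) S)"
proof -
  note mpX = mp_action_PiM[of M T, OF mp_M finite_I]
  have mix: "mixing_sets (PiM I M) (product_flow I T)"
    by (rule mixing_sets_PiM[OF mp_M finite_I]) (rule mp_action.weakly_mixing_imp_mixing_sets[OF mp_M wm])
  have ext: "measure_preserving (PiM I M) (N j \<Otimes>\<^sub>M PiM (I - {j}) N) (\<lambda>x. extract_coord I j (\<Psi> x))"
    by (rule measure_preserving_comp[OF \<Psi>_mp extract_coord_mp[of N, OF prob_N j]])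
  show "mixing_sets (N j) (S j)"
  proof (rule mixing_sets_factor[OF mpX mp_N _ _ mix])
    show "measure_preserving (PiM I M) (N j) (\<lambda>x. fst (extract_coord I j (\<Psi> x)))"
      by (rule measure_preserving_comp[OF ext measure_preserving_fst[OF prob_PiN]])
    show "AE x in PiM I M. fst (extract_coord I j (\<Psi> (product_flow I T t x))) = S j t (fst (extract_coord I j (\<Psi> x)))" for t
      using \<Psi>_equivariant[of t] by eventually_elim (simp add: extract_coord_def product_flow_def j)
  qed
  show "mixing_sets (PiM (I - {j}) N) (product_flow (I - {j}) S)"
  proof (rule mixing_sets_factor[OF mpX mp_action_PiM[OF mp_N] _ _ mix])
    show "measure_preserving (PiM I M) (PiM (I - {j}) N) (\<lambda>x. snd (extract_coord I j (\<Psi> x)))"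
      by (rule measure_preserving_comp[OF ext measure_preserving_snd[OF prob_N prob_PiN]])
    show "AE x in PiM I M. snd (extract_coord I j (\<Psi> (product_flow I T t x)))
        = product_flow (I - {j}) S t (snd (extract_coord I j (\<Psi> x)))" for t
      using \<Psi>_equivariant[of t]
      by eventually_elim (auto simp: extract_coord_def product_flow_def restrict_def)
  qed (use finite_I in simp)
qed

lemma component_mp: "i \<in> I \<Longrightarrow> measure_preserving (PiM I M) (M i) (\<lambda>x. x i)"
  unfolding measure_preserving_def
  by (intro conjI measurable_component_singleton distr_PiM_component prob_M)

lemma \<Phi>_component_mp: "i \<in> I \<Longrightarrow> measure_preserving (PiM I N) (M i) (\<lambda>y. \<Phi> y i)"
  by (rule measure_preserving_comp[OF \<Phi>_mp component_mp])

lemma coordinate_mp: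
  assumes i: "i \<in> I" and j: "j \<in> I"
  shows "measure_preserving (N j \<Otimes>\<^sub>M PiM (I - {j}) N) (M i) (\<lambda>w. \<Phi> (insert_coord j w) i)"
  by (rule measure_preserving_comp[OF insert_coord_mp[of N, OF prob_N j] \<Phi>_component_mp[OF i]])

text \<open>\<open>product_orthogonality\<close> applied to coordinate \<open>j\<close> against the
  remaining ones. The first alternative is strengthened to a map; the second stays in terms of sets,
  the form in which independence is derived from it.\<close>

lemma coordinate_dichotomy:
  assumes i: "i \<in> I" and j: "j \<in> I"
    and lim: "weak_limit_along (M i) (T i) \<tau> a P" and a: "a < 1"
    and P: "real_distribution P" "real_analytic (char P)" "\<And>x. P \<noteq> return borel x"
  shows "(\<exists>\<theta>\<in>measurable (N j) (M i). AE y in PiM I N. \<Phi> y i = \<theta> (y j)) \<or>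
    (\<forall>D\<in>sets (M i). \<exists>g\<in>borel_measurable (PiM (I - {j}) N).
       AE w in N j \<Otimes>\<^sub>M PiM (I - {j}) N. indicator D (\<Phi> (insert_coord j w) i) = (g (snd w) :: real))"
proof -
  let ?A = "N j" and ?B = "PiM (I - {j}) N"
  let ?q = "\<lambda>w. \<Phi> (insert_coord j w) i"
  have fin: "finite (I - {j})" using finite_I by simp
  note q = coordinate_mp[OF i j]
  have eq: "AE w in ?A \<Otimes>\<^sub>M ?B. ?q (map_prod (S j t) (product_flow (I - {j}) S t) w) = T i t (?q w)" for t
    using measure_preserving_AE[OF insert_coord_mp[of N, OF prob_N j] equivariant[of t]]
  proof eventually_elim
    case (elim w)
    have "T i t (?q w) = product_flow I T t (\<Phi> (insert_coord j w)) i" using i by (simp add: product_flow_def)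
    also have "\<dots> = \<Phi> (product_flow I S t (insert_coord j w)) i" using elim by simp
    finally show ?case unfolding product_flow_insert_coord[OF j] by simp
  qed
  have orth: "(\<integral>w. centered (M i) D (?q w) * (centered ?A C1 (fst w) * centered ?B C2 (snd w)) \<partial>(?A \<Otimes>\<^sub>M ?B)) = 0"
    if D: "D \<in> sets (M i)" and C: "C1 \<in> sets ?A" "C2 \<in> sets ?B" for D C1 C2
  proof (rule product_orthogonality[OF mp_N mp_action_PiM[OF mp_N fin] mp_M q eq lim a P D C])
    show "continuous_on UNIV (cov ?A (S j) C1 C1)" by (rule flow.continuous_cov[OF flow_N C(1) C(1)])
    show "continuous_on UNIV (cov ?B (product_flow (I - {j}) S) C2 C2)"
      by (rule continuous_cov_PiM[OF flow_N fin C(2) C(2)])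
    show "averages_to_zero (\<lambda>t. \<bar>cov ?A (S j) C1 C1 t\<bar>)"
      using mixing_sets_coordinate(1)[OF j] C(1) unfolding mixing_sets_def by blast
    show "averages_to_zero (\<lambda>t. \<bar>cov ?B (product_flow (I - {j}) S) C2 C2 t\<bar>)"
      using mixing_sets_coordinate(2)[OF j] C(2) unfolding mixing_sets_def by blast
  qed
  note dich = one_coordinate_dichotomy[OF prob_N prob_PiN measure_preserving_measurable[OF q]
      orthogonal_imp_one_coordinate[OF prob_N prob_PiN q _ orth]]
  then consider "\<forall>D\<in>sets (M i). \<exists>g\<in>borel_measurable ?A. AE w in ?A \<Otimes>\<^sub>M ?B. indicator D (?q w) = (g (fst w) :: real)"
    | "\<forall>D\<in>sets (M i). \<exists>g\<in>borel_measurable ?B. AE w in ?A \<Otimes>\<^sub>M ?B. indicator D (?q w) = (g (snd w) :: real)"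
    by blast
  then show ?thesis
  proof cases
    case 1
    obtain \<theta> where \<theta>: "\<theta> \<in> measurable ?A (M i)" "AE w in ?A \<Otimes>\<^sub>M ?B. ?q w = \<theta> (fst w)"
      by (rule one_coordinate_map[OF prob_N prob_PiN measure_preserving_measurable[OF q] flow.standard_borel[OF flow_M] 1])
    have "AE y in PiM I N. \<Phi> y i = \<theta> (y j)"
      using measure_preserving_AE[OF extract_coord_mp[of N, OF prob_N j] \<theta>(2)] AE_space
    proof eventually_elim
      case (elim y)
      then show ?case using insert_extract[OF elim(2) j] by (simp add: extract_coord_def)
    qed
    then show ?thesis using \<theta>(1) by blast
  next
    case 2
    then show ?thesis by (rule disjI2)
  qed
qed

text \<open>Induction on the set \<open>K\<close> of constrained coordinates. As the indicator of
  \<open>D\<close> ignores coordinate \<open>k\<close>, it may be replaced by a function of the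
  other coordinates, and by Fubini the factor of \<open>C k\<close> splits off.\<close>

lemma ignored_coordinates_independent:
  assumes i: "i \<in> I" and D [measurable]: "D \<in> sets (M i)"
    and ign: "\<And>j. j \<in> I \<Longrightarrow> \<exists>g\<in>borel_measurable (PiM (I - {j}) N).
       AE w in N j \<Otimes>\<^sub>M PiM (I - {j}) N. indicator D (\<Phi> (insert_coord j w) i) = (g (snd w) :: real)"
    and K: "K \<subseteq> I" and C: "\<And>k. k \<in> I \<Longrightarrow> C k \<in> sets (N k)"
  shows "(\<integral>y. indicator D (\<Phi> y i) * (\<Prod>k\<in>K. indicator (C k) (y k)) \<partial>PiM I N)
      = measure (M i) D * (\<Prod>k\<in>K. measure (N k) (C k))"
proof -
  interpret Y: prob_space "PiM I N" by (rule prob_PiN)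
  interpret N: prob_space "N k" for k by (rule prob_N)
  note \<Phi>i = \<Phi>_component_mp[OF i]
  note [measurable] = measure_preserving_measurable[OF \<Phi>i]
  show ?thesis
    using finite_subset[OF K finite_I] K
  proof (induction K rule: finite_induct)
    case empty
    have "(\<integral>y. indicator D (\<Phi> y i) \<partial>PiM I N) = (\<integral>x. indicator D x \<partial>M i :: real)"
      by (rule measure_preserving_integral[OF \<Phi>i]) measurable
    also have "\<dots> = measure (M i) D" using sets.sets_into_space[OF D] by (simp add: Int_absorb2)
    finally show ?case by simp
  next
    case (insert k K)
    then have k: "k \<in> I" "K \<subseteq> I" "k \<notin> K" by auto
    obtain g where g [measurable]: "g \<in> borel_measurable (PiM (I - {k}) N)"
      and ge: "AE w in N k \<Otimes>\<^sub>M PiM (I - {k}) N. indicator D (\<Phi> (insert_coord k w) i) = (g (snd w) :: real)"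
      using ign[OF k(1)] by blast
    interpret B: prob_space "PiM (I - {k}) N" by (rule prob_PiN)
    define G where "G b = g b * (\<Prod>l\<in>K. indicator (C l) (b l))" for b
    have Cm: "(\<lambda>y. indicator (C l) (y l) :: real) \<in> borel_measurable (PiM J N)" if "l \<in> J" "l \<in> I" for l J
      using C[OF that(2)] that(1) by measurable
    have [measurable]: "G \<in> borel_measurable (PiM (I - {k}) N)"
      unfolding G_def using k by (intro borel_measurable_times g borel_measurable_prod Cm) auto
    have Pm: "(\<lambda>y. indicator D (\<Phi> y i) * (\<Prod>l\<in>L. indicator (C l) (y l)) :: real) \<in> borel_measurable (PiM I N)"
      if "L \<subseteq> I" for L
      using that by (intro borel_measurable_times borel_measurable_prod Cm) auto
    note ins = insert_coord_mp[of N, OF prob_N k(1)]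
    have Kprod: "(\<Prod>l\<in>K. indicator (C l) (insert_coord k w l)) = (\<Prod>l\<in>K. indicator (C l) (snd w l) :: real)" for w
      using k(3) by (intro prod.cong refl) (auto simp: insert_coord_def)
    have ck: "integrable (N k) (\<lambda>x. indicator (C k) x :: real)" "(\<integral>x. indicator (C k) x \<partial>N k) = measure (N k) (C k)"
      using C[OF k(1)] by (auto simp: N.emeasure_eq_measure)
    have G_ae: "AE w in N k \<Otimes>\<^sub>M PiM (I - {k}) N. G (snd w) = indicator D (\<Phi> (insert_coord k w) i) * (\<Prod>l\<in>K. indicator (C l) (insert_coord k w l))"
      using ge by eventually_elim (simp add: G_def Kprod)
    have PmK: "(\<lambda>w. indicator D (\<Phi> (insert_coord k w) i) * (\<Prod>l\<in>L. indicator (C l) (insert_coord k w l)) :: real)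
        \<in> borel_measurable (N k \<Otimes>\<^sub>M PiM (I - {k}) N)" if "L \<subseteq> I" for L
      by (rule measurable_compose[OF measure_preserving_measurable[OF ins] Pm[OF that]])
    have G_val: "(\<integral>b. G b \<partial>PiM (I - {k}) N) = measure (M i) D * (\<Prod>l\<in>K. measure (N l) (C l))"
    proof -
      have "(\<integral>b. G b \<partial>PiM (I - {k}) N) = (\<integral>w. G (snd w) \<partial>(N k \<Otimes>\<^sub>M PiM (I - {k}) N))"
        by (rule measure_preserving_integral[OF measure_preserving_snd[OF prob_N prob_PiN], symmetric]) measurable
      also have "\<dots> = (\<integral>w. indicator D (\<Phi> (insert_coord k w) i) * (\<Prod>l\<in>K. indicator (C l) (insert_coord k w l)) \<partial>(N k \<Otimes>\<^sub>M PiM (I - {k}) N))"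
        by (rule integral_cong_AE[OF _ PmK[OF k(2)] G_ae]) measurable
      also have "\<dots> = (\<integral>y. indicator D (\<Phi> y i) * (\<Prod>l\<in>K. indicator (C l) (y l)) \<partial>PiM I N)"
        by (rule measure_preserving_integral[OF ins Pm[OF k(2)]])
      finally show ?thesis using insert.IH[OF k(2)] by simp
    qed
    \<comment> \<open>\<open>G\<close> agrees with a product of indicators only after composition
      with \<open>snd\<close>, almost everywhere on the product space; its bound is read off from a
      generic section.\<close>
    have G_int: "integrable (PiM (I - {k}) N) G"
    proof -
      have "AE w in N k \<Otimes>\<^sub>M PiM (I - {k}) N. \<bar>G (snd w)\<bar> \<le> 1"
        using G_ae
      proof eventually_elim
        case (elim w)
        define p where "p = (\<Prod>l\<in>K. indicat_real (C l) (insert_coord k w l))"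
        have "0 \<le> p" "p \<le> 1" unfolding p_def by (auto intro!: prod_nonneg prod_le_1)
        then show ?case unfolding elim p_def[symmetric] by (cases "\<Phi> (insert_coord k w) i \<in> D") auto
      qed
      then have "AE x in N k. AE b in PiM (I - {k}) N. \<bar>G b\<bar> \<le> 1"
      proof -
        interpret pair_prob_space "N k" "PiM (I - {k}) N" ..
        assume "AE w in N k \<Otimes>\<^sub>M PiM (I - {k}) N. \<bar>G (snd w)\<bar> \<le> 1"
        then show ?thesis by (drule_tac AE_pair) simp
      qed
      then obtain x where "AE b in PiM (I - {k}) N. \<bar>G b\<bar> \<le> 1" by (rule N.AE_witness)
      then show ?thesis by (intro B.integrable_const_bound[of _ 1]) auto
    qed
    have "(\<integral>y. indicator D (\<Phi> y i) * (\<Prod>l\<in>insert k K. indicat_real (C l) (y l)) \<partial>PiM I N)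
        = (\<integral>w. indicator D (\<Phi> (insert_coord k w) i) * (\<Prod>l\<in>insert k K. indicator (C l) (insert_coord k w l)) \<partial>(N k \<Otimes>\<^sub>M PiM (I - {k}) N))"
      by (rule measure_preserving_integral[OF ins Pm, symmetric]) (use k in auto)
    also have "\<dots> = (\<integral>w. indicator (C k) (fst w) * G (snd w) \<partial>(N k \<Otimes>\<^sub>M PiM (I - {k}) N))"
    proof (rule integral_cong_AE[OF PmK])
      show "insert k K \<subseteq> I" using k by auto
      show "(\<lambda>w. indicator (C k) (fst w) * G (snd w)) \<in> borel_measurable (N k \<Otimes>\<^sub>M PiM (I - {k}) N)"
        using C[OF k(1)] by measurable
      show "AE w in N k \<Otimes>\<^sub>M PiM (I - {k}) N. indicator D (\<Phi> (insert_coord k w) i) * (\<Prod>l\<in>insert k K. indicator (C l) (insert_coord k w l))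
          = indicator (C k) (fst w) * G (snd w)"
        using G_ae
      proof eventually_elim
        case (elim w)
        then show ?case using insert.hyps by (simp add: insert_coord_def)
      qed
    qed
    also have "\<dots> = measure (N k) (C k) * (measure (M i) D * (\<Prod>l\<in>K. measure (N l) (C l)))"
      using pair_integral_mult(2)[OF prob_N prob_PiN ck(1) G_int] ck(2) G_val by simp
    finally show ?case using insert.hyps by simp
  qed
qed

text \<open>A set in the factor that ignores every coordinate is independent of all rectangles, hence of
  itself.\<close>

lemma not_all_coordinates_ignored:
  assumes i: "i \<in> I"
    and ign: "\<And>j D. j \<in> I \<Longrightarrow> D \<in> sets (M i) \<Longrightarrow> \<exists>g\<in>borel_measurable (PiM (I - {j}) N).
       AE w in N j \<Otimes>\<^sub>M PiM (I - {j}) N. indicator D (\<Phi> (insert_coord j w) i) = (g (snd w) :: real)"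
  shows False
proof -
  interpret Y: prob_space "PiM I N" by (rule prob_PiN)
  interpret N: prob_space "N k" for k by (rule prob_N)
  have ppN: "product_prob_space N" by (rule mp_action_product_prob_space[of N S]) (rule mp_N)
  obtain D where D [measurable]: "D \<in> sets (M i)" and D01: "0 < measure (M i) D" "measure (M i) D < 1"
    by (rule flow.nontrivial_set[OF flow_M[of i]])
  note \<Phi>i = \<Phi>_component_mp[OF i]
  note [measurable] = measure_preserving_measurable[OF \<Phi>i]
  define E where "E = {y \<in> space (PiM I N). \<Phi> y i \<in> D}"
  have [measurable]: "E \<in> sets (PiM I N)" unfolding E_def by measurable
  have mE: "measure (PiM I N) E = measure (M i) D"
    unfolding E_def by (rule measure_preserving_measure[OF \<Phi>i D])
  have indep: "(\<integral>y. indicator D (\<Phi> y i) * (\<Prod>k\<in>I. indicator (C k) (y k)) \<partial>PiM I N)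
      = measure (M i) D * (\<Prod>k\<in>I. measure (N k) (C k))" if "\<And>k. k \<in> I \<Longrightarrow> C k \<in> sets (N k)" for C
    by (rule ignored_coordinates_independent[OF i D]) (use ign D that in auto)
  \<comment> \<open>The covariance of \<open>E\<close> with \<open>U\<close>; the time argument is a
    dummy for \<open>additive_family_induct\<close>.\<close>
  define \<kappa> where "\<kappa> U t = measure (PiM I N) (E \<inter> U) - measure (PiM I N) E * measure (PiM I N) U" for U and t :: real
  have "\<forall>t. \<kappa> E t = 0"
  proof (rule additive_family_induct[where M="PiM I N" and \<kappa>=\<kappa> and P="\<lambda>f. \<forall>t. f t = 0" and \<G>="prod_algebra I N"])
    show "prob_space (PiM I N)" by (rule prob_PiN)
    show "sets (PiM I N) = sigma_sets (space (PiM I N)) (prod_algebra I N)" by (simp add: sets_PiM space_PiM)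
    show "Int_stable (prod_algebra I N)" by (rule Int_stable_prod_algebra)
    show "prod_algebra I N \<subseteq> Pow (space (PiM I N))" using prod_algebra_sets_into_space by (simp add: space_PiM)
    show "\<kappa> (space (PiM I N) - U) t = - \<kappa> U t" if [measurable]: "U \<in> sets (PiM I N)" for U t
    proof -
      have "E \<inter> (space (PiM I N) - U) = E - E \<inter> U" unfolding E_def by auto
      moreover have "measure (PiM I N) (E - E \<inter> U) = measure (PiM I N) E - measure (PiM I N) (E \<inter> U)"
        by (rule Y.finite_measure_Diff) auto
      ultimately show ?thesis unfolding \<kappa>_def by (simp add: Y.prob_compl algebra_simps)
    qed
    show "\<kappa> (U \<union> V) t = \<kappa> U t + \<kappa> V t" if [measurable]: "U \<in> sets (PiM I N)" "V \<in> sets (PiM I N)" and "U \<inter> V = {}" for U V t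
    proof -
      have "measure (PiM I N) (U \<union> V) = measure (PiM I N) U + measure (PiM I N) V"
        by (rule Y.finite_measure_Union) (use that in auto)
      moreover have "measure (PiM I N) (E \<inter> U \<union> E \<inter> V) = measure (PiM I N) (E \<inter> U) + measure (PiM I N) (E \<inter> V)"
        by (rule Y.finite_measure_Union) (use that in auto)
      ultimately show ?thesis unfolding \<kappa>_def by (simp add: Int_Un_distrib algebra_simps)
    qed
    show "\<bar>\<kappa> U t\<bar> \<le> 2 * measure (PiM I N) U" if [measurable]: "U \<in> sets (PiM I N)" for U t
    proof -
      have "measure (PiM I N) (E \<inter> U) \<le> measure (PiM I N) U" by (rule Y.finite_measure_mono) auto
      moreover have "measure (PiM I N) E * measure (PiM I N) U \<le> 1 * measure (PiM I N) U" by (intro mult_right_mono) auto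
      moreover have "0 \<le> measure (PiM I N) E * measure (PiM I N) U" "0 \<le> measure (PiM I N) (E \<inter> U)" by auto
      ultimately show ?thesis unfolding \<kappa>_def abs_le_iff by linarith
    qed
    show "\<forall>t. f t = 0" if lim: "\<And>\<epsilon>. \<epsilon> > 0 \<Longrightarrow> \<exists>g. (\<forall>t. g t = 0) \<and> (\<forall>t. \<bar>f t - g t\<bar> \<le> \<epsilon>)" for f :: "real \<Rightarrow> real"
    proof
      fix t
      have "\<bar>f t\<bar> \<le> \<epsilon>" if "\<epsilon> > 0" for \<epsilon> using lim[OF that] by force
      then have "\<bar>f t\<bar> \<le> 0" by (rule field_le_epsilon[of _ 0, simplified])
      then show "f t = 0" by simp
    qed
    show "\<forall>t. \<kappa> U t = 0" if U: "U \<in> prod_algebra I N" for U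
    proof -
      obtain C where C: "U = Pi\<^sub>E I C" "\<And>k. k \<in> I \<Longrightarrow> C k \<in> sets (N k)"
        using U unfolding prod_algebra_eq_finite[OF finite_I] by auto
      have [measurable]: "U \<in> sets (PiM I N)" unfolding C(1) by (intro sets_PiM_I_finite finite_I C)
      have "indicator (E \<inter> U) y = indicator D (\<Phi> y i) * (\<Prod>k\<in>I. indicator (C k) (y k) :: real)" if "y \<in> space (PiM I N)" for y
      proof -
        have "(\<Prod>k\<in>I. indicator (C k) (y k) :: real) = indicator U y"
          using that finite_I unfolding C(1) by (auto simp: indicator_def PiE_iff space_PiM prod_zero_iff)
        then show ?thesis using that by (simp add: E_def indicator_def)
      qed
      then have "(\<integral>y. indicator (E \<inter> U) y \<partial>PiM I N) = (\<integral>y. indicator D (\<Phi> y i) * (\<Prod>k\<in>I. indicator (C k) (y k) :: real) \<partial>PiM I N)"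
        by (intro Bochner_Integration.integral_cong) auto
      then have "measure (PiM I N) (E \<inter> U) = measure (M i) D * (\<Prod>k\<in>I. measure (N k) (C k))"
        using indep[of C] C(2) by (simp add: Y.emeasure_eq_measure)
      moreover have "measure (PiM I N) U = (\<Prod>k\<in>I. measure (N k) (C k))"
        unfolding C(1) by (rule measure_PiM_rectangle[OF ppN finite_I C(2)])
      ultimately show ?thesis unfolding \<kappa>_def mE by simp
    qed
  qed auto
  then have "measure (M i) D * (1 - measure (M i) D) = 0" unfolding \<kappa>_def mE by (simp add: algebra_simps mE)
  then show False using D01 by simp
qed

end

context product_isomorphism
begin

lemma coordinate_factors:
  assumes \<sigma>: "\<And>i. i \<in> I \<Longrightarrow> \<sigma> i \<in> I" and \<theta>: "\<And>i. i \<in> I \<Longrightarrow> \<theta> i \<in> measurable (N (\<sigma> i)) (M i)"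
    and eq: "\<And>i. i \<in> I \<Longrightarrow> AE y in PiM I N. \<Phi> y i = \<theta> i (y (\<sigma> i))"
  shows \<Phi>_eq_coordinates: "AE y in PiM I N. \<Phi> y = (\<lambda>i\<in>I. \<theta> i (y (\<sigma> i)))"
    and recover_coordinates: "AE y in PiM I N. \<Psi> (\<lambda>i\<in>I. \<theta> i (y (\<sigma> i))) = y"
proof -
  have "AE y in PiM I N. \<forall>i\<in>I. \<Phi> y i = \<theta> i (y (\<sigma> i))"
    using eq finite_I by (intro AE_ball_countable[THEN iffD2]) (auto intro: countable_finite)
  then show ae: "AE y in PiM I N. \<Phi> y = (\<lambda>i\<in>I. \<theta> i (y (\<sigma> i)))"
    using AE_space
  proof eventually_elim
    case (elim y)
    have "\<Phi> y \<in> space (PiM I M)" by (rule measurable_space[OF measure_preserving_measurable[OF \<Phi>_mp] elim(2)])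
    then show ?case using elim(1) by (auto simp: space_PiM PiE_iff extensional_def restrict_def)
  qed
  show "AE y in PiM I N. \<Psi> (\<lambda>i\<in>I. \<theta> i (y (\<sigma> i))) = y"
    using ae \<Psi>\<Phi> by eventually_elim simp
qed

text \<open>If no \<open>\<sigma> i\<close> equals \<open>j\<close>, the coordinate \<open>y j\<close> is a function of the remaining coordinates and
  therefore constant.\<close>

lemma coordinate_selection_surj:
  assumes \<sigma>: "\<And>i. i \<in> I \<Longrightarrow> \<sigma> i \<in> I" and \<theta>: "\<And>i. i \<in> I \<Longrightarrow> \<theta> i \<in> measurable (N (\<sigma> i)) (M i)"
    and eq: "\<And>i. i \<in> I \<Longrightarrow> AE y in PiM I N. \<Phi> y i = \<theta> i (y (\<sigma> i))"
  shows "\<sigma> ` I = I"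
proof (rule ccontr)
  assume "\<sigma> ` I \<noteq> I"
  then obtain j where j: "j \<in> I" "j \<notin> \<sigma> ` I" using \<sigma> by blast
  interpret Nj: prob_space "N j" by (rule prob_N)
  interpret B: prob_space "PiM (I - {j}) N" by (rule prob_PiN)
  define c where "c b = \<Psi> (\<lambda>i\<in>I. \<theta> i (b (\<sigma> i))) j" for b
  have rec: "AE y in PiM I N. \<Psi> (\<lambda>i\<in>I. \<theta> i (y (\<sigma> i))) = y"
    by (rule recover_coordinates[OF \<sigma> \<theta> eq])
  have "AE w in N j \<Otimes>\<^sub>M PiM (I - {j}) N. fst w = c (snd w)"
    using measure_preserving_AE[OF insert_coord_mp[of N, OF prob_N j(1)] rec]
  proof eventually_elim
    case (elim w)
    have "(\<lambda>i\<in>I. \<theta> i (insert_coord j w (\<sigma> i))) = (\<lambda>i\<in>I. \<theta> i (snd w (\<sigma> i)))"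
      using j(2) by (intro restrict_ext) (auto simp: insert_coord_def)
    then have "c (snd w) = insert_coord j w j" unfolding c_def using elim by simp
    then show ?case by (simp add: insert_coord_def)
  qed
  from AE_pair_swapped[OF prob_N prob_PiN this]
  have "AE b in PiM (I - {j}) N. AE x in N j. x = c b" by simp
  then obtain b where b: "AE x in N j. x = c b" by (rule B.AE_witness)
  then obtain x where "x \<in> space (N j)" "x = c b" by (rule Nj.AE_witness)
  then show False using b flow.nontrivial[OF flow_N, of j] by blast
qed

text \<open>The inverse of \<open>\<theta> i\<close> reads coordinate \<open>j\<close> of
  \<open>\<Psi>\<close> after placing \<open>x\<close> at index \<open>i\<close> and generic
  constants elsewhere. Injectivity of \<open>\<sigma>\<close> ensures that these constants do not
  involve coordinate \<open>j\<close>.\<close>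

lemma coordinate_isomorphic:
  assumes \<sigma>: "\<And>i. i \<in> I \<Longrightarrow> \<sigma> i \<in> I" and \<theta>: "\<And>i. i \<in> I \<Longrightarrow> \<theta> i \<in> measurable (N (\<sigma> i)) (M i)"
    and eq: "\<And>i. i \<in> I \<Longrightarrow> AE y in PiM I N. \<Phi> y i = \<theta> i (y (\<sigma> i))"
    and inj: "inj_on \<sigma> I" and i: "i \<in> I"
  shows "isomorphic_flows (M i) (T i) (N (\<sigma> i)) (S (\<sigma> i))"
proof -
  define j where "j = \<sigma> i"
  have j: "j \<in> I" unfolding j_def by (rule \<sigma>[OF i])
  interpret Y: mp_action "PiM I N" "product_flow I S" by (rule mp_action_PiM[OF mp_N finite_I])
  interpret Nj: mp_action "N j" "S j" by (rule mp_N)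
  interpret B: prob_space "PiM (I - {j}) N" by (rule prob_PiN)
  note ins = insert_coord_mp[of N, OF prob_N j]
  have comp: "measure_preserving (PiM I N) (N j) (\<lambda>y. y j)"
    unfolding measure_preserving_def
    by (intro conjI measurable_component_singleton distr_PiM_component prob_N j)
  have \<theta>m [measurable]: "\<theta> i \<in> measurable (N j) (M i)" unfolding j_def by (rule \<theta>[OF i])
  have eqi: "AE y in PiM I N. \<Phi> y i = \<theta> i (y j)" unfolding j_def by (rule eq[OF i])
  have \<theta>_mp: "measure_preserving (N j) (M i) (\<theta> i)"
  proof -
    have "distr (N j) (M i) (\<theta> i) = distr (distr (PiM I N) (N j) (\<lambda>y. y j)) (M i) (\<theta> i)"
      using comp unfolding measure_preserving_def by simp
    also have "\<dots> = distr (PiM I N) (M i) (\<lambda>y. \<theta> i (y j))"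
      using measure_preserving_measurable[OF comp] by (subst distr_distr) (auto simp: comp_def)
    also have "\<dots> = distr (PiM I N) (M i) (\<lambda>y. \<Phi> y i)"
    proof (rule distr_cong_AE)
      show "AE y in PiM I N. \<theta> i (y j) = \<Phi> y i" using eqi by eventually_elim simp
      show "(\<lambda>y. \<theta> i (y j)) \<in> measurable (PiM I N) (M i)"
        using measure_preserving_measurable[OF comp] by measurable
      show "(\<lambda>y. \<Phi> y i) \<in> measurable (PiM I N) (M i)"
        by (rule measure_preserving_measurable[OF \<Phi>_component_mp[OF i]])
    qed auto
    also have "\<dots> = M i" using \<Phi>_component_mp[OF i] unfolding measure_preserving_def by simp
    finally show ?thesis unfolding measure_preserving_def using \<theta>m by simp
  qed
  have from_coord: "AE x in N j. Q x" if "AE y in PiM I N. Q (y j)" for Q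
  proof -
    have "AE w in N j \<Otimes>\<^sub>M PiM (I - {j}) N. Q (fst w)"
      using measure_preserving_AE[OF ins that] by (simp add: insert_coord_def)
    from AE_pair_swapped[OF prob_N prob_PiN this] have "AE b in PiM (I - {j}) N. AE x in N j. Q x" by simp
    then show ?thesis by (rule B.AE_witness)
  qed
  define c where "c b x = \<Psi> (\<lambda>k\<in>I. if k = i then x else \<theta> k (b (\<sigma> k))) j" for b x
  have rec: "AE y in PiM I N. \<Psi> (\<lambda>i\<in>I. \<theta> i (y (\<sigma> i))) = y"
    by (rule recover_coordinates[OF \<sigma> \<theta> eq])
  have "AE w in N j \<Otimes>\<^sub>M PiM (I - {j}) N. c (snd w) (\<theta> i (fst w)) = fst w"
    using measure_preserving_AE[OF ins rec]
  proof eventually_elim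
    case (elim w)
    have "(\<lambda>k\<in>I. \<theta> k (insert_coord j w (\<sigma> k))) = (\<lambda>k\<in>I. if k = i then \<theta> i (fst w) else \<theta> k (snd w (\<sigma> k)))"
      using inj i by (intro restrict_ext) (auto simp: insert_coord_def j_def inj_on_eq_iff)
    then have "c (snd w) (\<theta> i (fst w)) = insert_coord j w j" unfolding c_def using elim by simp
    then show ?case by (simp add: insert_coord_def)
  qed
  from AE_pair_swapped[OF prob_N prob_PiN this]
  have "AE b in PiM (I - {j}) N. AE x in N j. c b (\<theta> i x) = x" by simp
  then obtain b where b: "b \<in> space (PiM (I - {j}) N)" "AE x in N j. c b (\<theta> i x) = x" by (rule B.AE_witness)
  define \<eta> where "\<eta> = c b"
  have \<eta>m [measurable]: "\<eta> \<in> measurable (M i) (N j)"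
  proof -
    have "(\<lambda>x. \<lambda>k\<in>I. if k = i then x else \<theta> k (b (\<sigma> k))) \<in> measurable (M i) (PiM I M)"
    proof (rule measurable_restrict)
      fix k assume k: "k \<in> I"
      show "(\<lambda>x. if k = i then x else \<theta> k (b (\<sigma> k))) \<in> measurable (M i) (M k)"
      proof (cases "k = i")
        case False
        then have "\<sigma> k \<in> I - {j}" using \<sigma>[OF k] inj k i unfolding j_def by (auto simp: inj_on_eq_iff)
        then have "b (\<sigma> k) \<in> space (N (\<sigma> k))" using b(1) by (auto simp: space_PiM PiE_iff)
        then have "\<theta> k (b (\<sigma> k)) \<in> space (M k)" by (rule measurable_space[OF \<theta>[OF k]])
        then show ?thesis using False by simp
      qed simp
    qed
    from measurable_compose[OF measurable_compose[OF this measure_preserving_measurable[OF \<Psi>_mp]] measure_preserving_measurable[OF comp]]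
    show ?thesis unfolding \<eta>_def c_def[abs_def] .
  qed
  have \<eta>\<theta>: "AE x in N j. \<eta> (\<theta> i x) = x" using b(2) unfolding \<eta>_def .
  have \<theta>_distr: "distr (N j) (M i) (\<theta> i) = M i" using \<theta>_mp unfolding measure_preserving_def by simp
  have \<eta>_mp: "measure_preserving (M i) (N j) \<eta>"
  proof -
    have "distr (M i) (N j) \<eta> = distr (distr (N j) (M i) (\<theta> i)) (N j) \<eta>" by (simp only: \<theta>_distr)
    also have "\<dots> = distr (N j) (N j) (\<lambda>x. \<eta> (\<theta> i x))" by (subst distr_distr) (auto simp: comp_def)
    also have "\<dots> = distr (N j) (N j) (\<lambda>x. x)" by (rule distr_cong_AE[OF refl refl \<eta>\<theta>]) auto
    finally show ?thesis unfolding measure_preserving_def using \<eta>m by (simp add: distr_id)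
  qed
  \<comment> \<open>The identity holds at points \<open>\<theta> i x\<close>; measurability of the
    set where it holds, from the standard Borel structure, transfers it to almost every point of
    \<open>M i\<close>.\<close>
  have \<theta>\<eta>: "AE x in M i. \<theta> i (\<eta> x) = x"
  proof -
    have "{x \<in> space (M i). \<theta> i (\<eta> x) = x} \<in> sets (M i)"
      by (rule standard_borel_eq_sets[OF flow.standard_borel[OF flow_M]]) measurable
    moreover have "AE x in N j. \<theta> i (\<eta> (\<theta> i x)) = \<theta> i x" using \<eta>\<theta> by eventually_elim simp
    ultimately have "AE x in distr (N j) (M i) (\<theta> i). \<theta> i (\<eta> x) = x"
      by (subst AE_distr_iff) auto
    then show ?thesis unfolding \<theta>_distr .
  qed
  have "AE x in N j. T i t (\<theta> i x) = \<theta> i (S j t x)" for t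
  proof (rule from_coord)
    show "AE y in PiM I N. T i t (\<theta> i (y j)) = \<theta> i (S j t (y j))"
      using eqi measure_preserving_AE[OF Y.T_mp eqi, of t] equivariant[of t]
    proof eventually_elim
      case (elim y)
      have "T i t (\<theta> i (y j)) = product_flow I T t (\<Phi> y) i" using elim(1) i by (simp add: product_flow_def)
      also have "\<dots> = \<theta> i (product_flow I S t y j)" using elim(2,3) by simp
      finally show ?case using j by (simp add: product_flow_def)
    qed
  qed
  then show ?thesis
    unfolding isomorphic_flows_def j_def[symmetric] using \<theta>_mp \<eta>_mp \<eta>\<theta> \<theta>\<eta> by blast
qed

theorem unique_factors:
  assumes lim: "\<And>i. i \<in> I \<Longrightarrow> \<exists>\<tau> a P. a < 1 \<and> real_distribution P \<and> weak_limit_along (M i) (T i) \<tau> a P \<and>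
      (\<forall>x. P \<noteq> return borel x) \<and> real_analytic (char P)"
  shows "\<exists>\<sigma>. \<sigma> permutes I \<and> (\<forall>i\<in>I. isomorphic_flows (M i) (T i) (N (\<sigma> i)) (S (\<sigma> i)))"
proof -
  \<comment> \<open>If no coordinate determines the \<open>i\<close>-th component, the second
    alternative of the dichotomy holds at every \<open>j\<close>, contradicting
    \<open>not_all_coordinates_ignored\<close>.\<close>
  have ex: "\<exists>j\<in>I. \<exists>\<theta>\<in>measurable (N j) (M i). AE y in PiM I N. \<Phi> y i = \<theta> (y j)" if i: "i \<in> I" for i
  proof (rule ccontr)
    assume neg: "\<not> ?thesis"
    obtain \<tau> a P where P: "a < 1" "real_distribution P" "weak_limit_along (M i) (T i) \<tau> a P"
      "\<And>x. P \<noteq> return borel x" "real_analytic (char P)"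
      using lim[OF i] by (elim exE conjE) (rule that, simp_all)
    show False
    proof (rule not_all_coordinates_ignored[OF i])
      fix j D assume j: "j \<in> I" and D: "D \<in> sets (M i)"
      show "\<exists>g\<in>borel_measurable (PiM (I - {j}) N).
         AE w in N j \<Otimes>\<^sub>M PiM (I - {j}) N. indicator D (\<Phi> (insert_coord j w) i) = (g (snd w) :: real)"
      proof (rule disjE[OF coordinate_dichotomy[OF i j P(3,1,2,5,4)]])
        assume "\<exists>\<theta>\<in>measurable (N j) (M i). AE y in PiM I N. \<Phi> y i = \<theta> (y j)"
        with j have "\<exists>j\<in>I. \<exists>\<theta>\<in>measurable (N j) (M i). AE y in PiM I N. \<Phi> y i = \<theta> (y j)" by (rule bexI[rotated])
        with neg show ?thesis by (rule notE)
      qed (rule bspec[OF _ D])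
    qed
  qed
  have "\<forall>i\<in>I. \<exists>p. fst p \<in> I \<and> snd p \<in> measurable (N (fst p)) (M i) \<and> (AE y in PiM I N. \<Phi> y i = snd p (y (fst p)))"
  proof (intro ballI)
    fix i assume "i \<in> I"
    from ex[OF this] obtain j \<theta> where "j \<in> I" "\<theta> \<in> measurable (N j) (M i)" "AE y in PiM I N. \<Phi> y i = \<theta> (y j)"
      by (elim bexE) (rule that)
    then show "\<exists>p. fst p \<in> I \<and> snd p \<in> measurable (N (fst p)) (M i) \<and> (AE y in PiM I N. \<Phi> y i = snd p (y (fst p)))"
      by (intro exI[of _ "(j, \<theta>)"]) simp
  qed
  from bchoice[OF this] obtain p where p: "\<forall>i\<in>I. fst (p i) \<in> I \<and> snd (p i) \<in> measurable (N (fst (p i))) (M i) \<and>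
      (AE y in PiM I N. \<Phi> y i = snd (p i) (y (fst (p i))))" ..
  define \<sigma> \<theta> where "\<sigma> i = fst (p i)" and "\<theta> i = snd (p i)" for i
  have \<sigma>: "\<sigma> i \<in> I" and \<theta>: "\<theta> i \<in> measurable (N (\<sigma> i)) (M i)"
    and eq: "AE y in PiM I N. \<Phi> y i = \<theta> i (y (\<sigma> i))" if "i \<in> I" for i
    using bspec[OF p that] unfolding \<sigma>_def \<theta>_def by auto
  have surj: "\<sigma> ` I = I" by (rule coordinate_selection_surj[OF \<sigma> \<theta> eq])
  then have inj: "inj_on \<sigma> I" using finite_I by (simp add: eq_card_imp_inj_on)
  \<comment> \<open>\<open>permutes\<close> asks for the identity outside \<open>I\<close>, where
    \<open>\<sigma>\<close> is unspecified.\<close>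
  define \<pi> where "\<pi> i = (if i \<in> I then \<sigma> i else i)" for i
  have "bij_betw \<pi> I I"
    using surj inj unfolding bij_betw_def \<pi>_def by (auto simp: inj_on_def)
  then have "\<pi> permutes I" by (rule bij_imp_permutes) (simp add: \<pi>_def)
  moreover have "isomorphic_flows (M i) (T i) (N (\<pi> i)) (S (\<pi> i))" if i: "i \<in> I" for i
  proof -
    have "isomorphic_flows (M i) (T i) (N (\<sigma> i)) (S (\<sigma> i))"
      by (rule coordinate_isomorphic[OF \<sigma> \<theta> eq inj i])
    then show ?thesis using i unfolding \<pi>_def by simp
  qed
  ultimately show ?thesis by blast
qed

end

lemma product_flow_cong:
  "(\<And>i. i \<in> I \<Longrightarrow> T i = T' i) \<Longrightarrow> product_flow I T = product_flow I T'"
  unfolding product_flow_def by (auto intro!: ext restrict_ext)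

section \<open>Unique factorization for families given on a finite index set\<close>

theorem product_factors_unique:
  fixes M :: "'i \<Rightarrow> 'a measure" and N :: "'i \<Rightarrow> 'b measure"
  assumes I: "finite I" "I \<noteq> {}"
    and M: "\<And>i. i \<in> I \<Longrightarrow> flow (M i) (T i)" and wm: "\<And>i. i \<in> I \<Longrightarrow> weakly_mixing (M i) (T i)"
    and N: "\<And>i. i \<in> I \<Longrightarrow> flow (N i) (S i)"
    and iso: "isomorphic_flows (PiM I M) (product_flow I T) (PiM I N) (product_flow I S)"
    and lim: "\<And>i. i \<in> I \<Longrightarrow> \<exists>\<tau> a P. a < 1 \<and> real_distribution P \<and> weak_limit_along (M i) (T i) \<tau> a P \<and>
      (\<forall>x. P \<noteq> return borel x) \<and> real_analytic (char P)"
  shows "\<exists>\<sigma>. \<sigma> permutes I \<and> (\<forall>i\<in>I. isomorphic_flows (M i) (T i) (N (\<sigma> i)) (S (\<sigma> i)))"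
proof -
  obtain i0 where i0: "i0 \<in> I" using I(2) by blast
  \<comment> \<open>outside \<open>I\<close> the families may be arbitrary; repeat one factor there\<close>
  define r where "r i = (if i \<in> I then i else i0)" for i
  have r: "r i \<in> I" "i \<in> I \<Longrightarrow> r i = i" for i unfolding r_def using i0 by auto
  have PM: "PiM I (\<lambda>i. M (r i)) = PiM I M" and PN: "PiM I (\<lambda>i. N (r i)) = PiM I N"
    by (intro PiM_cong; simp add: r)+
  have FT: "product_flow I (\<lambda>i. T (r i)) = product_flow I T" and FS: "product_flow I (\<lambda>i. S (r i)) = product_flow I S"
    by (intro product_flow_cong; simp add: r)+
  obtain \<Phi> \<Psi> where iso': "measure_preserving (PiM I N) (PiM I M) \<Phi>" "measure_preserving (PiM I M) (PiM I N) \<Psi>"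
    "AE y in PiM I N. \<Psi> (\<Phi> y) = y" "AE x in PiM I M. \<Phi> (\<Psi> x) = x"
    "\<And>t. AE y in PiM I N. product_flow I T t (\<Phi> y) = \<Phi> (product_flow I S t y)"
    using iso unfolding isomorphic_flows_def by blast
  interpret product_isomorphism I "\<lambda>i. M (r i)" "\<lambda>i. T (r i)" "\<lambda>i. N (r i)" "\<lambda>i. S (r i)" \<Phi> \<Psi>
  proof (rule product_isomorphism.intro; (unfold PM PN FT FS)?)
    show "finite I" by (rule I(1))
    show "flow (M (r i)) (T (r i))" "flow (N (r i)) (S (r i))" "weakly_mixing (M (r i)) (T (r i))" for i
      by (rule M[OF r(1)] N[OF r(1)] wm[OF r(1)])+
  qed (rule iso')+
  have "\<exists>\<sigma>. \<sigma> permutes I \<and> (\<forall>i\<in>I. isomorphic_flows (M (r i)) (T (r i)) (N (r (\<sigma> i))) (S (r (\<sigma> i))))"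
    by (rule unique_factors) (rule lim[OF r(1)])
  then obtain \<sigma> where \<sigma>: "\<sigma> permutes I" "\<And>i. i \<in> I \<Longrightarrow> isomorphic_flows (M (r i)) (T (r i)) (N (r (\<sigma> i))) (S (r (\<sigma> i)))"
    by blast
  have "isomorphic_flows (M i) (T i) (N (\<sigma> i)) (S (\<sigma> i))" if "i \<in> I" for i
    using \<sigma>(2)[OF that] r(2) that permutes_in_image[OF \<sigma>(1)] by simp
  then show ?thesis using \<sigma>(1) by blast
qed

theorem corollary1:
  fixes d :: nat
    and M :: "nat \<Rightarrow> 'a measure" and T :: "nat \<Rightarrow> real \<Rightarrow> 'a \<Rightarrow> 'a"
    and N :: "nat \<Rightarrow> 'b measure" and S :: "nat \<Rightarrow> real \<Rightarrow> 'b \<Rightarrow> 'b"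
  assumes "d \<ge> 1"
    and "\<And>i. i \<in> {1..d} \<Longrightarrow> flow (M i) (T i)"
    and "\<And>i. i \<in> {1..d} \<Longrightarrow> weakly_mixing (M i) (T i)"
    and "\<And>i. i \<in> {1..d} \<Longrightarrow> flow (N i) (S i)"
    and "isomorphic_flows (PiM {1..d} M) (product_flow {1..d} T) (PiM {1..d} N) (product_flow {1..d} S)"
  shows "((\<forall>i\<in>{1..d}. \<exists>\<tau> a P.
             filterlim \<tau> at_top sequentially \<and> a \<in> {0..<1} \<and> real_distribution P \<and>
             weak_limit_along (M i) (T i) \<tau> a P \<and>
             (\<forall>x. P \<noteq> return borel x) \<and> real_analytic (char P))
          \<longrightarrow> (\<exists>\<sigma>. \<sigma> permutes {1..d} \<and>
                 (\<forall>i\<in>{1..d}. isomorphic_flows (M i) (T i) (N (\<sigma> i)) (S (\<sigma> i)))))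
       \<and> ((\<forall>i\<in>{1..d}. \<exists>\<tau> a P.
             filterlim \<tau> at_top sequentially \<and> a \<in> {0..<1} \<and> real_distribution P \<and>
             weak_limit_along (M i) (T i) \<tau> a P \<and>
             (\<forall>x. measure P {x} = 0) \<and> bounded (measure_support P))
          \<longrightarrow> (\<exists>\<sigma>. \<sigma> permutes {1..d} \<and>
                 (\<forall>i\<in>{1..d}. isomorphic_flows (M i) (T i) (N (\<sigma> i)) (S (\<sigma> i)))))"
proof -
  let ?lim = "\<lambda>i. \<exists>\<tau> a P. a < 1 \<and> real_distribution P \<and> weak_limit_along (M i) (T i) \<tau> a P \<and>
    (\<forall>x. P \<noteq> return borel x) \<and> real_analytic (char P)"
  have main: "\<exists>\<sigma>. \<sigma> permutes {1..d} \<and> (\<forall>i\<in>{1..d}. isomorphic_flows (M i) (T i) (N (\<sigma> i)) (S (\<sigma> i)))"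
    if "\<And>i. i \<in> {1..d} \<Longrightarrow> ?lim i"
    by (rule product_factors_unique[OF _ _ assms(2-5) that]) (use assms(1) in simp_all)
  have analytic: "?lim i" if ex: "\<exists>\<tau> a P. filterlim \<tau> at_top sequentially \<and> a \<in> {0..<1} \<and> real_distribution P \<and>
      weak_limit_along (M i) (T i) \<tau> a P \<and> (\<forall>x. P \<noteq> return borel x) \<and> real_analytic (char P)" for i
  proof -
    from ex obtain \<tau> a P where "a \<in> {0..<1}" "real_distribution P \<and> weak_limit_along (M i) (T i) \<tau> a P \<and>
      (\<forall>x. P \<noteq> return borel x) \<and> real_analytic (char P)" by (elim exE conjE) (rule that, simp_all)
    then show ?thesis by (intro exI[of _ \<tau>] exI[of _ a] exI[of _ P]) simp
  qed
  have bounded: "?lim i" if ex: "\<exists>\<tau> a P. filterlim \<tau> at_top sequentially \<and> a \<in> {0..<1} \<and> real_distribution P \<and>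
      weak_limit_along (M i) (T i) \<tau> a P \<and> (\<forall>x. measure P {x} = 0) \<and> bounded (measure_support P)" for i
  proof -
    from ex obtain \<tau> a P where P: "a < 1" "real_distribution P" "weak_limit_along (M i) (T i) \<tau> a P"
      "\<forall>x. measure P {x} = 0" "bounded (measure_support P)"
      by (elim exE conjE) (rule that, simp_all)
    have "P \<noteq> return borel x" for x
    proof
      assume "P = return borel x"
      then have "measure P {x} = 1" by (simp add: measure_return)
      then show False using P(4) by simp
    qed
    then show ?thesis using P real_analytic_char_bounded_support[OF P(2,5)]
      by (intro exI[of _ \<tau>] exI[of _ a] exI[of _ P]) simp
  qed
  show ?thesis
  proof (rule conjI; rule impI; rule main)
    fix i
    assume "\<forall>i\<in>{1..d}. \<exists>\<tau> a P. filterlim \<tau> at_top sequentially \<and> a \<in> {0..<1} \<and> real_distribution P \<and>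
      weak_limit_along (M i) (T i) \<tau> a P \<and> (\<forall>x. P \<noteq> return borel x) \<and> real_analytic (char P)" "i \<in> {1..d}"
    from analytic[OF bspec[OF this]] show "?lim i" .
  next
    fix i
    assume "\<forall>i\<in>{1..d}. \<exists>\<tau> a P. filterlim \<tau> at_top sequentially \<and> a \<in> {0..<1} \<and> real_distribution P \<and>
      weak_limit_along (M i) (T i) \<tau> a P \<and> (\<forall>x. measure P {x} = 0) \<and> bounded (measure_support P)" "i \<in> {1..d}"
    from bounded[OF bspec[OF this]] show "?lim i" .
  qed
qed

end
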